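(* Let $W$ be an infinite-dimensional vector space over a field $k$ and let $\mathcal C=\operatorname{Sym}(W)$ be the symmetric coalgebra of $W$. Let $$0\longrightarrow k\longrightarrow\mathcal J^0\longrightarrow\mathcal J^1\longrightarrow\mathcal J^2\longrightarrow\cdots$$ denote the Koszul injective coresolution of the trivial one-dimensional $\mathcal C$-comodule $k$ described in the context, with $\mathcal J^n=\mathcal C\otimes_k\Lambda^n(W)$. Denote by $\mathcal J$ the cofree $\mathcal C$-comodule $\mathcal C\otimes_kW$ cospanned by $W$. Then the complex $$0\longrightarrow\operatorname{Hom}_{\mathcal C}(\mathcal J,\mathcal J^0)\longrightarrow\operatorname{Hom}_{\mathcal C}(\mathcal J,\mathcal J^1)\longrightarrow\operatorname{Hom}_{\mathcal C}(\mathcal J,\mathcal J^2)\longrightarrow\cdots$$ obtained by applying the functor $\operatorname{Hom}_{\mathcal C}(\mathcal J,-)$ to the truncated coresolution $0\to\mathcal J^0\to\mathcal J^1\to\mathcal J^2\to\cdots$ is a bounded below, noncontractible, acyclic complex of finitely generated projective left modules over the ring $S=\operatorname{Hom}_{\mathcal C}(\mathcal J,\mathcal J)^{\mathrm{op}}$.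
   Context: Coalgebras are coassociative and counital over the field $k$. Symmetric coalgebra: the tensor coalgebra $\bigoplus_{n\ge0}W^{\otimes n}$ has comultiplication $w_1\otimes\cdots\otimes w_n\mapsto\sum_{i=0}^n(w_1\otimes\cdots\otimes w_i)\otimes(w_{i+1}\otimes\cdots\otimes w_n)$ and counit the projection onto $W^{\otimes0}=k$. The symmetric coalgebra $\operatorname{Sym}(W)=\bigoplus_{n\ge0}\operatorname{Sym}_n(W)$ is the graded subcoalgebra whose component $\operatorname{Sym}_n(W)\subset W^{\otimes n}$ is the subspace of symmetric tensors; so $\operatorname{Sym}_0(W)=k$, $\operatorname{Sym}_1(W)=W$. It is cocommutative. Put $\mathcal C=\operatorname{Sym}(W)$. The cofree left $\mathcal C$-comodule cospanned by a vector space $V$ is $\mathcal C\otimes_kV$ with coaction induced by the comultiplication. $\operatorname{Hom}_{\mathcal C}$ denotes the space of morphisms in the category of left $\mathcal C$-comodules. The ring $S=\operatorname{Hom}_{\mathcal C}(\mathcal J,\mathcal J)^{\mathrm{op}}$ is the opposite ring of the endomorphism ring of $\mathcal J$, and $\operatorname{Hom}_{\mathcal C}(\mathcal J,\mathcal M)$ is a left $S$-module via precomposition. The Koszul injective (cofree) comodule coresolution of the trivial one-dimensional $\mathcal C$-comodule $k$ (the coaction being given by $k=\operatorname{Sym}_0(W)\subset\mathcal C$) is $$0\to k\to\mathcal C\to\mathcal C\otimes_kW\to\mathcal C\otimes_k\Lambda^2(W)\to\cdots\to\mathcal C\otimes_k\Lambda^n(W)\to\cdots,$$ where $\Lambda^n$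 denotes exterior powers, $k\to\mathcal C$ is the inclusion of $\operatorname{Sym}_0(W)$, and the differential $\mathcal C\otimes_k\Lambda^n(W)\to\mathcal C\otimes_k\Lambda^{n+1}(W)$ is the composition of the map $\mathcal C\otimes_k\Lambda^n(W)\to\mathcal C\otimes_kW\otimes_k\Lambda^n(W)$ induced by the component $\mathcal C\to\mathcal C\otimes_kW$ of the comultiplication and the map induced by the multiplication $W\otimes_k\Lambda^n(W)\to\Lambda^{n+1}(W)$. Complexes are cohomologically graded; bounded below means that the terms vanish in all sufficiently negative degrees. A complex is contractible if its identity endomorphism is homotopic to zero; noncontractible means not contractible (as a complex of left $S$-modules). *)

theory Defs
  imports
    Complex_Main
    "HOL-Library.Function_Algebras"
    "HOL-Library.FuncSet"
    "HOL-Combinatorics.Permutations"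
    "HOL-Algebra.Module"
begin

section \<open>Vector spaces presented by generators and relations\<close>

definition fscale :: "'k::field \<Rightarrow> ('y \<Rightarrow> 'k) \<Rightarrow> ('y \<Rightarrow> 'k)" where
  "fscale c f = (\<lambda>y. c * f y)"

lemma vector_space_fscale: "vector_space (fscale :: 'k::field \<Rightarrow> ('y \<Rightarrow> 'k) \<Rightarrow> _)"
  by unfold_locales (auto simp: fscale_def fun_eq_iff plus_fun_def algebra_simps)

abbreviation fspan :: "('y \<Rightarrow> 'k::field) set \<Rightarrow> ('y \<Rightarrow> 'k) set" where
  "fspan \<equiv> Modules.module.span fscale"

text \<open>
  Let \<open>k[X]\<close> be the free vector space on \<open>X\<close>, let \<open>R\<close> be a subspace of \<open>k[X]\<close> (the relations), and
  let \<open>\<Phi>\<close> be the set of functions \<open>X \<rightarrow> k\<close> whose linear extension to \<open>k[X]\<close> annihilates \<open>R\<close>.  Since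
  \<open>\<Phi>\<close> is the dual of \<open>k[X]/R\<close> and a vector space over a field embeds into its double dual, \<open>k[X]/R\<close>
  is the span of the evaluation functionals \<open>ev \<Phi> x\<close> on \<open>\<Phi>\<close>; \<open>ev \<Phi> x\<close> is the class of the generator
  \<open>x\<close>.  Tensor products, tensor powers and exterior powers are presented in this way below, with
  \<open>\<Phi>\<close> the bilinear, multilinear and alternating forms, respectively.  The universal properties are
  \<open>tensor_universal\<close>, \<open>tens_universal\<close> and \<open>wedge_universal\<close>.
\<close>

definition ev :: "('x \<Rightarrow> 'k::field) set \<Rightarrow> 'x \<Rightarrow> (('x \<Rightarrow> 'k) \<Rightarrow> 'k)" where
  "ev \<Phi> x = (\<lambda>\<phi>. if \<phi> \<in> \<Phi> then \<phi> x else 0)"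

text \<open>
  The linear extension to \<open>k[X]/R\<close> of a map \<open>h\<close> from the generators to a space of functions, see
  \<open>ev_lift_ev\<close>.
\<close>

definition ev_lift :: "('x \<Rightarrow> 'y \<Rightarrow> 'k::field) \<Rightarrow> (('x \<Rightarrow> 'k) \<Rightarrow> 'k) \<Rightarrow> ('y \<Rightarrow> 'k)" where
  "ev_lift h t = (\<lambda>y. t (\<lambda>x. h x y))"

lemma ev_lift_ev: "(\<And>y. (\<lambda>x. h x y) \<in> \<Phi>) \<Longrightarrow> ev_lift h (ev \<Phi> x) = h x"
  by (simp add: ev_lift_def ev_def)

lemma linear_ev_lift: "Vector_Spaces.linear fscale fscale (ev_lift h)"
  by (simp add: Vector_Spaces.linear_def module_hom_def module_hom_axioms_def ev_lift_def
      vector_space_fscale module_iff_vector_space) (simp add: fscale_def plus_fun_def fun_eq_iff)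

lemma ev_universal:
  fixes s :: "'k::field \<Rightarrow> 'v::ab_group_add \<Rightarrow> 'v" and h :: "'x \<Rightarrow> 'v"
  assumes s: "vector_space s"
    and h: "\<And>\<psi>. Vector_Spaces.linear s (*) \<psi> \<Longrightarrow> (\<lambda>x. \<psi> (h x)) \<in> \<Phi>"
  shows "\<exists>F. Vector_Spaces.linear fscale s F \<and> (\<forall>x. F (ev \<Phi> x) = h x)"
proof -
  interpret E: vector_space "fscale :: 'k \<Rightarrow> (('x \<Rightarrow> 'k) \<Rightarrow> 'k) \<Rightarrow> _" by (rule vector_space_fscale)
  interpret V: vector_space s by (rule s)
  interpret K: vector_space "(*) :: 'k \<Rightarrow> 'k \<Rightarrow> 'k"
    by unfold_locales (auto simp: algebra_simps)
  interpret EV: vector_space_pair "fscale :: 'k \<Rightarrow> (('x \<Rightarrow> 'k) \<Rightarrow> 'k) \<Rightarrow> _" s by unfold_locales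
  interpret VK: vector_space_pair s "(*) :: 'k \<Rightarrow> 'k \<Rightarrow> 'k" by unfold_locales
  interpret EK: vector_space_pair "fscale :: 'k \<Rightarrow> (('x \<Rightarrow> 'k) \<Rightarrow> 'k) \<Rightarrow> _" "(*) :: 'k \<Rightarrow> 'k \<Rightarrow> 'k"
    by unfold_locales
  obtain B where B: "B \<subseteq> range (ev \<Phi>)" "E.independent B" "range (ev \<Phi>) \<subseteq> E.span B"
    using E.maximal_independent_subset by blast
  obtain F where F: "Vector_Spaces.linear fscale s F" "\<forall>b\<in>B. F b = h (inv_into UNIV (ev \<Phi>) b)"
    using EV.linear_independent_extend[OF B(2), of "\<lambda>b. h (inv_into UNIV (ev \<Phi>) b)"] by blast
  have "F (ev \<Phi> x) = h x" for x
  proof (rule ccontr)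
    assume "F (ev \<Phi> x) \<noteq> h x"
    then have "V.independent {F (ev \<Phi> x) - h x}" by simp
    then obtain \<psi> where \<psi>: "Vector_Spaces.linear s (*) \<psi>" "\<psi> (F (ev \<Phi> x) - h x) = 1"
      using VK.linear_independent_extend[of "{F (ev \<Phi> x) - h x}" "\<lambda>_. 1"] by auto
    interpret \<psi>: Vector_Spaces.linear s "(*)" \<psi> by (rule \<psi>)
    interpret F: Vector_Spaces.linear fscale s F by (rule F)
    let ?\<phi> = "\<lambda>x. \<psi> (h x)"
    have \<phi>: "?\<phi> \<in> \<Phi>" by (rule h[OF \<psi>(1)])
    have l1: "Vector_Spaces.linear fscale (*) (\<lambda>t. \<psi> (F t))"
      by unfold_locales (auto simp: F.add F.scale \<psi>.add \<psi>.scale)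
    have l2: "Vector_Spaces.linear fscale (*) (\<lambda>t. t ?\<phi>)"
      by unfold_locales (auto simp: fscale_def plus_fun_def algebra_simps)
    have "\<psi> (F (ev \<Phi> x)) = ev \<Phi> x ?\<phi>"
    proof (rule EK.linear_eq_on[OF l1 l2])
      show "ev \<Phi> x \<in> E.span B" using B by blast
    next
      fix b assume b: "b \<in> B"
      then have "ev \<Phi> (inv_into UNIV (ev \<Phi>) b) = b" using B(1) by (metis f_inv_into_f subsetD)
      then have "b ?\<phi> = ev \<Phi> (inv_into UNIV (ev \<Phi>) b) ?\<phi>" by simp
      with b F \<phi> show "\<psi> (F b) = b ?\<phi>" by (simp add: ev_def)
    qed
    with \<phi> \<psi>(2) show False by (simp add: \<psi>.diff ev_def)
  qed
  with F show ?thesis by blast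
qed


section \<open>Linear maps and tensor products\<close>

record ('k, 'v) vect =
  vcarrier :: "'v set"
  vscale :: "'k \<Rightarrow> 'v \<Rightarrow> 'v"

definition vlinear ::
    "('k, 'v::ab_group_add, 'x) vect_scheme \<Rightarrow> ('k, 'u::ab_group_add, 'y) vect_scheme
      \<Rightarrow> ('v \<Rightarrow> 'u) \<Rightarrow> bool" where
  "vlinear V U f \<longleftrightarrow>
     f \<in> vcarrier V \<rightarrow> vcarrier U \<and>
     (\<forall>x\<in>vcarrier V. \<forall>y\<in>vcarrier V. f (x + y) = f x + f y) \<and>
     (\<forall>c. \<forall>x\<in>vcarrier V. f (vscale V c x) = vscale U c (f x))"

definition ground :: "('k::field, 'k) vect" where
  "ground = \<lparr>vcarrier = UNIV, vscale = (*)\<rparr>"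

definition bilinear_forms ::
    "('k::field, 'v::ab_group_add, 'x) vect_scheme \<Rightarrow> ('k, 'u::ab_group_add, 'y) vect_scheme
      \<Rightarrow> ('v \<times> 'u \<Rightarrow> 'k) set" where
  "bilinear_forms V U =
     {\<beta>. (\<forall>v\<in>vcarrier V. vlinear U ground (\<lambda>u. \<beta> (v, u))) \<and>
         (\<forall>u\<in>vcarrier U. vlinear V ground (\<lambda>v. \<beta> (v, u)))}"

definition tensor ::
    "('k::field, 'v::ab_group_add, 'x) vect_scheme \<Rightarrow> ('k, 'u::ab_group_add, 'y) vect_scheme
      \<Rightarrow> 'v \<Rightarrow> 'u \<Rightarrow> (('v \<times> 'u \<Rightarrow> 'k) \<Rightarrow> 'k)" where
  "tensor V U v u = ev (bilinear_forms V U) (v, u)"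

definition tensor_space ::
    "('k::field, 'v::ab_group_add, 'x) vect_scheme \<Rightarrow> ('k, 'u::ab_group_add, 'y) vect_scheme
      \<Rightarrow> ('k, ('v \<times> 'u \<Rightarrow> 'k) \<Rightarrow> 'k) vect" where
  "tensor_space V U =
     \<lparr>vcarrier = fspan {tensor V U v u | v u. v \<in> vcarrier V \<and> u \<in> vcarrier U}, vscale = fscale\<rparr>"

lemma tensor_universal:
  fixes s :: "'k::field \<Rightarrow> 'z::ab_group_add \<Rightarrow> 'z"
  assumes s: "vector_space s"
    and "\<And>v. v \<in> vcarrier V \<Longrightarrow> vlinear U \<lparr>vcarrier = UNIV, vscale = s\<rparr> (h v)"
    and "\<And>u. u \<in> vcarrier U \<Longrightarrow> vlinear V \<lparr>vcarrier = UNIV, vscale = s\<rparr> (\<lambda>v. h v u)"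
  shows "\<exists>F. Vector_Spaces.linear fscale s F \<and> (\<forall>v u. F (tensor V U v u) = h v u)"
proof -
  have "(\<lambda>x. \<psi> (case x of (v, u) \<Rightarrow> h v u)) \<in> bilinear_forms V U"
    if "Vector_Spaces.linear s (*) \<psi>" for \<psi>
  proof -
    interpret Vector_Spaces.linear s "(*)" \<psi> by (rule that)
    show ?thesis
      using assms by (auto simp: bilinear_forms_def vlinear_def ground_def add scale)
  qed
  from ev_universal[OF s, where \<Phi> = "bilinear_forms V U", OF this]
  show ?thesis by (auto simp: tensor_def)
qed

definition tensor_map ::
    "('k::field, 'v'::ab_group_add, 'x) vect_scheme \<Rightarrow> ('k, 'u'::ab_group_add, 'y) vect_scheme
      \<Rightarrow> ('v \<Rightarrow> 'v') \<Rightarrow> ('u \<Rightarrow> 'u')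
      \<Rightarrow> (('v \<times> 'u \<Rightarrow> 'k) \<Rightarrow> 'k) \<Rightarrow> (('v' \<times> 'u' \<Rightarrow> 'k) \<Rightarrow> 'k)" where
  "tensor_map V' U' f g = ev_lift (\<lambda>(v, u). tensor V' U' (f v) (g u))"

lemma ev_bilinear_forms:
  assumes "vlinear V V' f" "vlinear U U' g"
  shows "(\<lambda>(v, u). tensor V' U' (f v) (g u) \<gamma>) \<in> bilinear_forms V U"
  using assms by (auto simp: tensor_def ev_def bilinear_forms_def vlinear_def ground_def Pi_iff)

lemma tensor_map_tensor:
  assumes "vlinear V V' f" "vlinear U U' g"
  shows "tensor_map V' U' f g (tensor V U v u) = tensor V' U' (f v) (g u)"
  using ev_bilinear_forms[OF assms]
  by (simp add: tensor_map_def tensor_def[of V U] ev_lift_ev case_prod_unfold)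

definition tensor_assoc ::
    "('k::field, 'a::ab_group_add, 'x) vect_scheme \<Rightarrow> ('k, 'b::ab_group_add, 'y) vect_scheme
      \<Rightarrow> ('k, 'c::ab_group_add, 'z) vect_scheme
      \<Rightarrow> (((('a \<times> 'b \<Rightarrow> 'k) \<Rightarrow> 'k) \<times> 'c \<Rightarrow> 'k) \<Rightarrow> 'k)
      \<Rightarrow> (('a \<times> (('b \<times> 'c \<Rightarrow> 'k) \<Rightarrow> 'k) \<Rightarrow> 'k) \<Rightarrow> 'k)" where
  "tensor_assoc A B C =
     ev_lift (\<lambda>(x, c). ev_lift (\<lambda>(a, b). tensor A (tensor_space B C) a (tensor B C b c)) x)"


section \<open>Coalgebras and left comodules\<close>

record ('k, 'c) coalgebra = "('k, 'c) vect" +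
  comult :: "'c \<Rightarrow> (('c \<times> 'c \<Rightarrow> 'k) \<Rightarrow> 'k)"
  counit :: "'c \<Rightarrow> 'k"

record ('k, 'c, 'm) comodule = "('k, 'm) vect" +
  coact :: "'m \<Rightarrow> (('c \<times> 'm \<Rightarrow> 'k) \<Rightarrow> 'k)"

definition comodule_hom ::
    "('k::field, 'c::ab_group_add, 'x) coalgebra_scheme
      \<Rightarrow> ('k, 'c, 'm::ab_group_add, 'y) comodule_scheme
      \<Rightarrow> ('k, 'c, 'n::ab_group_add, 'z) comodule_scheme \<Rightarrow> ('m \<Rightarrow> 'n) set" where
  "comodule_hom C M N =
     {f \<in> extensional (vcarrier M).
        vlinear M N f \<and> (\<forall>m\<in>vcarrier M. tensor_map C N id f (coact M m) = coact N (f m))}"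

definition cofree_comodule ::
    "('k::field, 'c::ab_group_add, 'x) coalgebra_scheme \<Rightarrow> ('k, 'v::ab_group_add, 'y) vect_scheme
      \<Rightarrow> ('k, 'c, ('c \<times> 'v \<Rightarrow> 'k) \<Rightarrow> 'k) comodule" where
  "cofree_comodule C V =
     \<lparr>vcarrier = vcarrier (tensor_space C V), vscale = fscale,
      coact = (\<lambda>t. tensor_assoc C C V (tensor_map (tensor_space C C) V (comult C) id t))\<rparr>"

definition zero_comodule :: "('k::field, 'c, 'y \<Rightarrow> 'k) comodule" where
  "zero_comodule = \<lparr>vcarrier = {0}, vscale = fscale, coact = (\<lambda>_. 0)\<rparr>"


section \<open>The symmetric coalgebra\<close>

text \<open>
  Throughout, the vector space \<open>W\<close> is the whole type \<open>'w\<close> with scalar multiplication \<open>scale\<close>.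
\<close>

definition whole_space :: "('k \<Rightarrow> 'w \<Rightarrow> 'w) \<Rightarrow> ('k, 'w) vect" where
  "whole_space scale = \<lparr>vcarrier = UNIV, vscale = scale\<rparr>"

text \<open>
  The generators of the tensor coalgebra are the words \<open>xs\<close> over \<open>W\<close>, of any length; a form is
  multilinear if it is so on the words of each length.
\<close>

definition multilinear_forms ::
    "('k::field \<Rightarrow> 'w::ab_group_add \<Rightarrow> 'w) \<Rightarrow> ('w list \<Rightarrow> 'k) set" where
  "multilinear_forms scale =
     {\<phi>. \<forall>xs ys. Vector_Spaces.linear scale (*) (\<lambda>w. \<phi> (xs @ w # ys))}"

definition tens ::
    "('k::field \<Rightarrow> 'w::ab_group_add \<Rightarrow> 'w) \<Rightarrow> 'w list \<Rightarrow> (('w list \<Rightarrow> 'k) \<Rightarrow> 'k)" where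
  "tens scale xs = ev (multilinear_forms scale) xs"

lemma tens_universal:
  assumes s: "vector_space s"
    and h: "\<And>xs ys. Vector_Spaces.linear scale s (\<lambda>w. h (xs @ w # ys))"
  shows "\<exists>F. Vector_Spaces.linear fscale s F \<and> (\<forall>xs. F (tens scale xs) = h xs)"
  unfolding tens_def
proof (rule ev_universal[OF s])
  fix \<psi> assume "Vector_Spaces.linear s (*) \<psi>"
  from Vector_Spaces.linear_compose[OF h this]
  show "(\<lambda>x. \<psi> (h x)) \<in> multilinear_forms scale"
    by (simp add: multilinear_forms_def o_def)
qed

definition tensor_power ::
    "('k::field \<Rightarrow> 'w::ab_group_add \<Rightarrow> 'w) \<Rightarrow> nat \<Rightarrow> (('w list \<Rightarrow> 'k) \<Rightarrow> 'k) set" where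
  "tensor_power scale n = fspan {tens scale xs | xs. length xs = n}"

definition tensor_algebra_space ::
    "('k::field \<Rightarrow> 'w::ab_group_add \<Rightarrow> 'w) \<Rightarrow> ('k, ('w list \<Rightarrow> 'k) \<Rightarrow> 'k) vect" where
  "tensor_algebra_space scale = \<lparr>vcarrier = fspan (range (tens scale)), vscale = fscale\<rparr>"

definition tensor_coalgebra ::
    "('k::field \<Rightarrow> 'w::ab_group_add \<Rightarrow> 'w) \<Rightarrow> ('k, ('w list \<Rightarrow> 'k) \<Rightarrow> 'k) coalgebra" where
  "tensor_coalgebra scale =
     (let T = tensor_algebra_space scale in
      \<lparr>vcarrier = vcarrier T, vscale = fscale,
       comult = ev_lift (\<lambda>xs. \<Sum>i\<le>length xs. tensor T T (tens scale (take i xs)) (tens scale (drop i xs))),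
       counit = (\<lambda>t. t (\<lambda>xs. if xs = [] then 1 else 0))\<rparr>)"

text \<open>The projection of the tensor coalgebra onto its component of degree \<open>n\<close>.\<close>

definition degree_part ::
    "('k::field \<Rightarrow> 'w::ab_group_add \<Rightarrow> 'w) \<Rightarrow> nat
      \<Rightarrow> (('w list \<Rightarrow> 'k) \<Rightarrow> 'k) \<Rightarrow> (('w list \<Rightarrow> 'k) \<Rightarrow> 'k)" where
  "degree_part scale n = ev_lift (\<lambda>xs. if length xs = n then tens scale xs else 0)"

text \<open>
  The action of a permutation of \<open>{..<n}\<close> on \<open>tensor_power scale n\<close>.  The words of the other
  lengths are sent to \<open>0\<close> because \<open>permute_list \<sigma>\<close> is meaningless on them.
\<close>

definition permute_tensor ::
    "('k::field \<Rightarrow> 'w::ab_group_add \<Rightarrow> 'w) \<Rightarrow> nat \<Rightarrow> (nat \<Rightarrow> nat)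
      \<Rightarrow> (('w list \<Rightarrow> 'k) \<Rightarrow> 'k) \<Rightarrow> (('w list \<Rightarrow> 'k) \<Rightarrow> 'k)" where
  "permute_tensor scale n \<sigma> =
     ev_lift (\<lambda>xs. if length xs = n then tens scale (permute_list \<sigma> xs) else 0)"

definition symmetric_tensors ::
    "('k::field \<Rightarrow> 'w::ab_group_add \<Rightarrow> 'w) \<Rightarrow> nat \<Rightarrow> (('w list \<Rightarrow> 'k) \<Rightarrow> 'k) set" where
  "symmetric_tensors scale n =
     {t \<in> tensor_power scale n. \<forall>\<sigma>. \<sigma> permutes {..<n} \<longrightarrow> permute_tensor scale n \<sigma> t = t}"

definition sym_space ::
    "('k::field \<Rightarrow> 'w::ab_group_add \<Rightarrow> 'w) \<Rightarrow> ('k, ('w list \<Rightarrow> 'k) \<Rightarrow> 'k) vect" where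
  "sym_space scale = \<lparr>vcarrier = fspan (\<Union>n. symmetric_tensors scale n), vscale = fscale\<rparr>"

text \<open>
  \<open>Sym(W)\<close> as a subcoalgebra of the tensor coalgebra: its comultiplication is the restriction of
  that of the tensor coalgebra \<open>T\<close>, corestricted along the injection
  \<open>Sym(W) \<otimes> Sym(W) \<rightarrow> T \<otimes> T\<close>.
\<close>

definition sym_coalgebra ::
    "('k::field \<Rightarrow> 'w::ab_group_add \<Rightarrow> 'w) \<Rightarrow> ('k, ('w list \<Rightarrow> 'k) \<Rightarrow> 'k) coalgebra" where
  "sym_coalgebra scale =
     (let T = tensor_coalgebra scale; C = sym_space scale in
      \<lparr>vcarrier = vcarrier C, vscale = fscale,
       comult = (\<lambda>c. THE u. u \<in> vcarrier (tensor_space C C) \<and> tensor_map T T id id u = comult T c),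
       counit = counit T\<rparr>)"


section \<open>Exterior powers and the Koszul coresolution\<close>

definition alternating_forms ::
    "('k::field \<Rightarrow> 'w::ab_group_add \<Rightarrow> 'w) \<Rightarrow> ('w list \<Rightarrow> 'k) set" where
  "alternating_forms scale =
     {\<phi> \<in> multilinear_forms scale. \<forall>xs. \<not> distinct xs \<longrightarrow> \<phi> xs = 0}"

definition wedge ::
    "('k::field \<Rightarrow> 'w::ab_group_add \<Rightarrow> 'w) \<Rightarrow> 'w list \<Rightarrow> (('w list \<Rightarrow> 'k) \<Rightarrow> 'k)" where
  "wedge scale xs = ev (alternating_forms scale) xs"

lemma wedge_universal:
  assumes s: "vector_space s"
    and h: "\<And>xs ys. Vector_Spaces.linear scale s (\<lambda>w. h (xs @ w # ys))"
    and alt: "\<And>xs. \<not> distinct xs \<Longrightarrow> h xs = 0"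
  shows "\<exists>F. Vector_Spaces.linear fscale s F \<and> (\<forall>xs. F (wedge scale xs) = h xs)"
  unfolding wedge_def
proof (rule ev_universal[OF s])
  fix \<psi> assume \<psi>: "Vector_Spaces.linear s (*) \<psi>"
  interpret Vector_Spaces.linear s "(*)" \<psi> by (rule \<psi>)
  from Vector_Spaces.linear_compose[OF h \<psi>]
  show "(\<lambda>x. \<psi> (h x)) \<in> alternating_forms scale"
    by (simp add: multilinear_forms_def alternating_forms_def o_def alt)
qed

definition exterior_power ::
    "('k::field \<Rightarrow> 'w::ab_group_add \<Rightarrow> 'w) \<Rightarrow> nat \<Rightarrow> ('k, ('w list \<Rightarrow> 'k) \<Rightarrow> 'k) vect" where
  "exterior_power scale n =
     \<lparr>vcarrier = fspan {wedge scale xs | xs. length xs = n}, vscale = fscale\<rparr>"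

text \<open>The multiplication map from \<open>W\<close> and the \<open>n\<close>th exterior power to the \<open>(n + 1)\<close>st.\<close>

definition wedge_mult ::
    "('k::field \<Rightarrow> 'w::ab_group_add \<Rightarrow> 'w) \<Rightarrow> 'w
      \<Rightarrow> (('w list \<Rightarrow> 'k) \<Rightarrow> 'k) \<Rightarrow> (('w list \<Rightarrow> 'k) \<Rightarrow> 'k)" where
  "wedge_mult scale w = ev_lift (\<lambda>xs. wedge scale (w # xs))"

lemma wedge_mult_wedge:
  assumes "vector_space scale"
  shows "wedge_mult scale w (wedge scale xs) = wedge scale (w # xs)"
proof -
  interpret vector_space_pair scale "(*)"
    using assms by (simp add: vector_space_pair_def vector_space_def algebra_simps)
  have "(\<lambda>xs. wedge scale (w # xs) \<phi>) \<in> alternating_forms scale" for \<phi>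
  proof (cases "\<phi> \<in> alternating_forms scale")
    case True
    then have "Vector_Spaces.linear scale (*) (\<lambda>u. \<phi> ((w # xs) @ u # ys))" for xs ys
      unfolding alternating_forms_def multilinear_forms_def by blast
    with True show ?thesis
      by (simp add: wedge_def ev_def alternating_forms_def multilinear_forms_def)
  next
    case False
    then have "(\<lambda>xs. wedge scale (w # xs) \<phi>) = (\<lambda>_. 0)" by (simp add: wedge_def ev_def)
    then show ?thesis
      by (simp add: alternating_forms_def multilinear_forms_def linear_zero)
  qed
  from ev_lift_ev[of "\<lambda>xs. wedge scale (w # xs)", OF this] show ?thesis
    by (simp add: wedge_mult_def wedge_def[of _ xs])
qed

text \<open>
  The component \<open>C \<rightarrow> C \<otimes> W\<close> of the comultiplication of \<open>C = Sym(W)\<close>; the degree-one component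
  of \<open>Sym(W)\<close> is identified with \<open>W\<close> via \<open>w \<mapsto> tens scale [w]\<close>.
\<close>

definition sym_to_W ::
    "('k::field \<Rightarrow> 'w::ab_group_add \<Rightarrow> 'w) \<Rightarrow> (('w list \<Rightarrow> 'k) \<Rightarrow> 'k) \<Rightarrow> 'w" where
  "sym_to_W scale t = (THE w. degree_part scale 1 t = tens scale [w])"

definition sym_comult_W ::
    "('k::field \<Rightarrow> 'w::ab_group_add \<Rightarrow> 'w) \<Rightarrow> (('w list \<Rightarrow> 'k) \<Rightarrow> 'k)
      \<Rightarrow> (((('w list \<Rightarrow> 'k) \<Rightarrow> 'k) \<times> 'w \<Rightarrow> 'k) \<Rightarrow> 'k)" where
  "sym_comult_W scale c =
     (let C = sym_coalgebra scale in
      tensor_map C (whole_space scale) id (sym_to_W scale) (comult C c))"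

text \<open>
  The Koszul coresolution, without its augmentation, as a complex indexed by the integers that
  vanishes in negative degrees.  In degree \<open>n \<ge> 0\<close> the differential is the composition of
  \<open>C \<otimes> \<Lambda>\<^sup>n \<rightarrow> (C \<otimes> W) \<otimes> \<Lambda>\<^sup>n\<close> and \<open>(C \<otimes> W) \<otimes> \<Lambda>\<^sup>n \<rightarrow> C \<otimes> \<Lambda>\<^sup>n\<^sup>+\<^sup>1\<close>, where the second map sends
  \<open>(c \<otimes> w) \<otimes> \<omega>\<close> to \<open>c \<otimes> (w \<and> \<omega>)\<close>.
\<close>

definition koszul_term ::
    "('k::field \<Rightarrow> 'w::ab_group_add \<Rightarrow> 'w) \<Rightarrow> int
      \<Rightarrow> ('k, ('w list \<Rightarrow> 'k) \<Rightarrow> 'k,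
          ((('w list \<Rightarrow> 'k) \<Rightarrow> 'k) \<times> (('w list \<Rightarrow> 'k) \<Rightarrow> 'k) \<Rightarrow> 'k) \<Rightarrow> 'k) comodule" where
  "koszul_term scale n =
     (if n < 0 then zero_comodule
      else cofree_comodule (sym_coalgebra scale) (exterior_power scale (nat n)))"

definition koszul_diff ::
    "('k::field \<Rightarrow> 'w::ab_group_add \<Rightarrow> 'w) \<Rightarrow> int
      \<Rightarrow> (((('w list \<Rightarrow> 'k) \<Rightarrow> 'k) \<times> (('w list \<Rightarrow> 'k) \<Rightarrow> 'k) \<Rightarrow> 'k) \<Rightarrow> 'k)
      \<Rightarrow> (((('w list \<Rightarrow> 'k) \<Rightarrow> 'k) \<times> (('w list \<Rightarrow> 'k) \<Rightarrow> 'k) \<Rightarrow> 'k) \<Rightarrow> 'k)" where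
  "koszul_diff scale n =
     (if n < 0 then (\<lambda>_. 0)
      else let C = sym_coalgebra scale; W = whole_space scale;
               L = exterior_power scale (nat n); L' = exterior_power scale (nat n + 1)
        in ev_lift (\<lambda>(x, \<omega>). ev_lift (\<lambda>(c, w). tensor C L' c (wedge_mult scale w \<omega>)) x)
           \<circ> tensor_map (tensor_space C W) L (sym_comult_W scale) id)"


section \<open>Modules over noncommutative rings\<close>

definition opposite_ring :: "('a, 'x) ring_scheme \<Rightarrow> ('a, 'x) ring_scheme" where
  "opposite_ring R = R\<lparr>mult := (\<lambda>x y. mult R y x)\<rparr>"

text \<open>
  The locale \<open>module\<close> of \<open>HOL-Algebra\<close> demands a commutative ring.  The record type \<open>module\<close> is
  reused; the fields \<open>mult\<close> and \<open>one\<close> of a module are irrelevant.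
\<close>

locale left_module = R?: ring R + M?: abelian_group M
  for R :: "('r, 'x) ring_scheme" (structure) and M :: "('r, 'm, 'y) module_scheme" (structure) +
  assumes smult_closed:
      "\<lbrakk>a \<in> carrier R; x \<in> carrier M\<rbrakk> \<Longrightarrow> a \<odot>\<^bsub>M\<^esub> x \<in> carrier M"
    and smult_l_distr:
      "\<lbrakk>a \<in> carrier R; b \<in> carrier R; x \<in> carrier M\<rbrakk>
        \<Longrightarrow> (a \<oplus> b) \<odot>\<^bsub>M\<^esub> x = a \<odot>\<^bsub>M\<^esub> x \<oplus>\<^bsub>M\<^esub> b \<odot>\<^bsub>M\<^esub> x"
    and smult_r_distr:
      "\<lbrakk>a \<in> carrier R; x \<in> carrier M; y \<in> carrier M\<rbrakk>
        \<Longrightarrow> a \<odot>\<^bsub>M\<^esub> (x \<oplus>\<^bsub>M\<^esub> y) = a \<odot>\<^bsub>M\<^esub> x \<oplus>\<^bsub>M\<^esub> a \<odot>\<^bsub>M\<^esub> y"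
    and smult_assoc:
      "\<lbrakk>a \<in> carrier R; b \<in> carrier R; x \<in> carrier M\<rbrakk>
        \<Longrightarrow> (a \<otimes> b) \<odot>\<^bsub>M\<^esub> x = a \<odot>\<^bsub>M\<^esub> (b \<odot>\<^bsub>M\<^esub> x)"
    and smult_one:
      "x \<in> carrier M \<Longrightarrow> \<one> \<odot>\<^bsub>M\<^esub> x = x"

definition left_module_hom ::
    "('r, 'x) ring_scheme \<Rightarrow> ('r, 'm, 'y) module_scheme \<Rightarrow> ('r, 'n, 'z) module_scheme
      \<Rightarrow> ('m \<Rightarrow> 'n) set" where
  "left_module_hom R M N =
     {f \<in> carrier M \<rightarrow> carrier N.
        (\<forall>x\<in>carrier M. \<forall>y\<in>carrier M. f (x \<oplus>\<^bsub>M\<^esub> y) = f x \<oplus>\<^bsub>N\<^esub> f y) \<and>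
        (\<forall>a\<in>carrier R. \<forall>x\<in>carrier M. f (a \<odot>\<^bsub>M\<^esub> x) = a \<odot>\<^bsub>N\<^esub> f x)}"

definition finitely_generated_module ::
    "('r, 'x) ring_scheme \<Rightarrow> ('r, 'm, 'y) module_scheme \<Rightarrow> bool" where
  "finitely_generated_module R M \<longleftrightarrow>
     (\<exists>A. finite A \<and> A \<subseteq> carrier M \<and>
        (\<forall>m\<in>carrier M. \<exists>r\<in>A \<rightarrow> carrier R. m = (\<Oplus>\<^bsub>M\<^esub>a\<in>A. r a \<odot>\<^bsub>M\<^esub> a)))"

definition free_module :: "('r, 'x) ring_scheme \<Rightarrow> 'i set \<Rightarrow> ('r, 'i \<Rightarrow> 'r) module" where
  "free_module R X =
     \<lparr>carrier = {f \<in> X \<rightarrow>\<^sub>E carrier R. finite {x \<in> X. f x \<noteq> \<zero>\<^bsub>R\<^esub>}},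
      mult = undefined, one = undefined,
      zero = (\<lambda>x\<in>X. \<zero>\<^bsub>R\<^esub>), add = (\<lambda>f g. \<lambda>x\<in>X. f x \<oplus>\<^bsub>R\<^esub> g x),
      smult = (\<lambda>a f. \<lambda>x\<in>X. a \<otimes>\<^bsub>R\<^esub> f x)\<rparr>"

text \<open>
  Projective modules are the direct summands of free modules.  Index sets in the type of elements
  of \<open>P\<close> suffice because \<open>P\<close> is a quotient of the free module on the set \<open>carrier P\<close>.
\<close>

definition projective_module ::
    "('r, 'x) ring_scheme \<Rightarrow> ('r, 'm, 'y) module_scheme \<Rightarrow> bool" where
  "projective_module R P \<longleftrightarrow>
     (\<exists>X :: 'm set. \<exists>\<iota> \<in> left_module_hom R P (free_module R X).
        \<exists>\<pi> \<in> left_module_hom R (free_module R X) P. \<forall>p\<in>carrier P. \<pi> (\<iota> p) = p)"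


section \<open>Complexes of modules\<close>

definition cochain_complex ::
    "('r, 'x) ring_scheme \<Rightarrow> (int \<Rightarrow> ('r, 'm, 'y) module_scheme) \<Rightarrow> (int \<Rightarrow> 'm \<Rightarrow> 'm) \<Rightarrow> bool" where
  "cochain_complex R M d \<longleftrightarrow>
     (\<forall>n. left_module R (M n)) \<and>
     (\<forall>n. d n \<in> left_module_hom R (M n) (M (n + 1))) \<and>
     (\<forall>n. \<forall>x\<in>carrier (M n). d (n + 1) (d n x) = \<zero>\<^bsub>M (n + 2)\<^esub>)"

definition bounded_below_complex :: "(int \<Rightarrow> ('r, 'm, 'y) module_scheme) \<Rightarrow> bool" where
  "bounded_below_complex M \<longleftrightarrow> (\<exists>N. \<forall>n<N. carrier (M n) = {\<zero>\<^bsub>M n\<^esub>})"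

definition acyclic_complex ::
    "(int \<Rightarrow> ('r, 'm, 'y) module_scheme) \<Rightarrow> (int \<Rightarrow> 'm \<Rightarrow> 'm) \<Rightarrow> bool" where
  "acyclic_complex M d \<longleftrightarrow>
     (\<forall>n. {x \<in> carrier (M n). d n x = \<zero>\<^bsub>M (n + 1)\<^esub>} = d (n - 1) ` carrier (M (n - 1)))"

definition contractible_complex ::
    "('r, 'x) ring_scheme \<Rightarrow> (int \<Rightarrow> ('r, 'm, 'y) module_scheme) \<Rightarrow> (int \<Rightarrow> 'm \<Rightarrow> 'm) \<Rightarrow> bool" where
  "contractible_complex R M d \<longleftrightarrow>
     (\<exists>h. (\<forall>n. h n \<in> left_module_hom R (M n) (M (n - 1))) \<and>
          (\<forall>n. \<forall>x\<in>carrier (M n). x = d (n - 1) (h n x) \<oplus>\<^bsub>M n\<^esub> h (n + 1) (d n x)))"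


section \<open>The ring and the modules of comodule homomorphisms\<close>

definition comodule_End ::
    "('k::field, 'c::ab_group_add, 'x) coalgebra_scheme
      \<Rightarrow> ('k, 'c, 'm::ab_group_add, 'y) comodule_scheme \<Rightarrow> ('m \<Rightarrow> 'm) ring" where
  "comodule_End C J =
     \<lparr>carrier = comodule_hom C J J,
      mult = compose (vcarrier J), one = (\<lambda>x\<in>vcarrier J. x),
      zero = (\<lambda>x\<in>vcarrier J. 0), add = (\<lambda>f g. \<lambda>x\<in>vcarrier J. f x + g x)\<rparr>"

text \<open>\<open>Hom\<^sub>C(J, M)\<close> as a left module over \<open>opposite_ring (comodule_End C J)\<close>.\<close>

definition comodule_Hom ::
    "('k::field, 'c::ab_group_add, 'x) coalgebra_scheme
      \<Rightarrow> ('k, 'c, 'm::ab_group_add, 'y) comodule_scheme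
      \<Rightarrow> ('k, 'c, 'n::ab_group_add, 'z) comodule_scheme \<Rightarrow> ('m \<Rightarrow> 'm, 'm \<Rightarrow> 'n) module" where
  "comodule_Hom C J M =
     \<lparr>carrier = comodule_hom C J M,
      mult = undefined, one = undefined,
      zero = (\<lambda>x\<in>vcarrier J. 0), add = (\<lambda>f g. \<lambda>x\<in>vcarrier J. f x + g x),
      smult = (\<lambda>s f. compose (vcarrier J) f s)\<rparr>"

end

theory Submission
  imports Defs "HOL-Combinatorics.Multiset_Permutations"
begin

text \<open>
  Fix a basis \<open>B\<close> of \<open>W\<close>.  The sums \<open>e \<alpha>\<close> of all words with content \<open>\<alpha>\<close>, for \<open>\<alpha>\<close> a multiset over \<open>B\<close>,
  form a basis of \<open>C = Sym(W)\<close> with comultiplication \<open>e \<alpha> \<mapsto> \<Sum>\<beta> \<subseteq> \<alpha>. e \<beta> \<otimes> e (\<alpha> - \<beta>)\<close>.  A morphism from \<open>C \<otimes> W\<close>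
  to the cofree comodule \<open>C \<otimes> V\<close> is the same as a linear map from \<open>C \<otimes> W\<close> to \<open>V\<close>, hence as a family of elements
  \<open>F \<alpha> b\<close> of \<open>V\<close>, and for \<open>V = \<Lambda>\<^sup>n\<close> the Koszul differential becomes \<open>(d F) \<alpha> b = \<Sum>c \<in> \<alpha>. c \<and> F (\<alpha> - c) b\<close>.

  For \<open>b \<in> B\<close> with contraction \<open>\<iota>\<close>, the operator \<open>(h F) \<alpha> = \<iota> (F (\<alpha> + b))\<close> satisfies \<open>d h + h d = 1 - P\<close>, where
  \<open>(P F) \<alpha>\<close> is \<open>b \<and> \<iota> (F \<alpha>)\<close> if \<open>b\<close> is not in \<open>\<alpha>\<close>, and \<open>0\<close> otherwise.  The product of the operators \<open>P\<close> for \<open>n + 1\<close>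
  different basis vectors vanishes on families in \<open>\<Lambda>\<^sup>n\<close>; since \<open>B\<close> is infinite, the complex is acyclic.

  As \<open>\<Lambda>\<^sup>n\<close> is a direct summand of \<open>W\<close> for infinite \<open>B\<close>, the terms are direct summands of the left module \<open>S\<close>.
  By the same token a contracting homotopy in degree \<open>1\<close> is given by composition with a morphism, so it vanishes at every
  argument where its operand does; but \<open>d f\<close> vanishes where \<open>f\<close> takes the value \<open>e {#} \<otimes> 1\<close>.
\<close>

section \<open>Vector spaces and tensor products\<close>

text \<open>For fixed \<open>b\<close> a family is a formal power series with coefficients in
  \<open>\<Lambda>\<^sup>n\<close>, in one variable per basis vector: since
  \<open>C \<otimes> W\<close> is the source, nothing restricts the support in
  \<open>\<alpha>\<close>. The differential is exterior multiplication by the sum of all basis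
  vectors, each times its variable. The Euler-type homotopy of a Koszul complex, which treats all
  variables at once, would involve infinite sums and division by integers that may vanish in
  \<open>k\<close>; hence one variable at a time, at the price of the remainder \<open>P\<close>.
  This remainder is a genuine obstruction. For a basis of \<open>m\<close> elements the product of
  all \<open>P\<close> survives in degree \<open>m\<close>, where it picks the constant term of a
  top form, and this is the cohomology of the complex. An infinite basis leaves no degree in which
  it could live. Infinity enters a second time through cardinality: there are no more words of
  length \<open>n\<close> over \<open>B\<close> than elements of \<open>B\<close>, which embeds
  \<open>\<Lambda>\<^sup>n\<close> into \<open>W\<close>.\<close>

interpretation fs: vector_space "fscale :: 'k::field \<Rightarrow> ('y \<Rightarrow> 'k) \<Rightarrow> _"
  by (rule vector_space_fscale)

lemma vector_space_field: "vector_space ((*) :: 'k::field \<Rightarrow> 'k \<Rightarrow> 'k)"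
  by unfold_locales (auto simp: algebra_simps)

lemma linearI:
  assumes "vector_space s" "vector_space s'"
    and "\<And>x y. f (x + y) = f x + f y" "\<And>c x. f (s c x) = s' c (f x)"
  shows "Vector_Spaces.linear s s' f"
  using assms
  by (simp add: Vector_Spaces.linear_def module_hom_def module_hom_axioms_def module_iff_vector_space)

lemma linear_addD: "Vector_Spaces.linear s s' f \<Longrightarrow> f (x + y) = f x + f y"
  and linear_scaleD: "Vector_Spaces.linear s s' f \<Longrightarrow> f (s c x) = s' c (f x)"
  by (simp_all add: Vector_Spaces.linear_def module_hom_def module_hom_axioms_def)

lemma linear_zeroD: "Vector_Spaces.linear s s' f \<Longrightarrow> f 0 = 0"
  using linear_addD[of s s' f 0 0] by simp

lemma linear_sumD: "Vector_Spaces.linear s s' f \<Longrightarrow> f (sum g A) = (\<Sum>i\<in>A. f (g i))"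
  by (induction A rule: infinite_finite_induct) (simp_all add: linear_zeroD linear_addD)

text \<open>Elements of tensor products are functions; without this, the simplifier expands their sums pointwise.\<close>

declare plus_fun_apply [simp del] zero_fun_apply [simp del] minus_apply [simp del] uminus_apply [simp del]

abbreviation flinear where "flinear \<equiv> Vector_Spaces.linear fscale fscale"

text \<open>The scaling is a vector space structure on the whole type, as
  \<open>tensor_universal\<close> and the linear extension theorems demand; the carrier is only a
  subspace of it.\<close>

definition vspace :: "('k::field, 'v::ab_group_add, 'x) vect_scheme \<Rightarrow> bool" where
  "vspace V \<longleftrightarrow>
     vector_space (vscale V) \<and> Modules.module.subspace (vscale V) (vcarrier V)"

lemma vspace_vs: "vspace V \<Longrightarrow> vector_space (vscale V)"
  by (simp add: vspace_def)

lemma vspace_closed: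
  assumes "vspace V"
  shows vsp_zero: "0 \<in> vcarrier V"
    and vsp_add: "x \<in> vcarrier V \<Longrightarrow> y \<in> vcarrier V \<Longrightarrow> x + y \<in> vcarrier V"
    and vsp_scale: "x \<in> vcarrier V \<Longrightarrow> vscale V c x \<in> vcarrier V"
    and vsp_minus: "x \<in> vcarrier V \<Longrightarrow> - x \<in> vcarrier V"
    and vsp_diff: "x \<in> vcarrier V \<Longrightarrow> y \<in> vcarrier V \<Longrightarrow> x - y \<in> vcarrier V"
    and vsp_sum: "(\<And>i. i \<in> I \<Longrightarrow> g i \<in> vcarrier V) \<Longrightarrow> sum g I \<in> vcarrier V"
proof -
  interpret vector_space "vscale V" using assms by (rule vspace_vs)
  have s: "subspace (vcarrier V)" using assms by (simp add: vspace_def)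
  show "0 \<in> vcarrier V" using s by (rule subspace_0)
  show "x \<in> vcarrier V \<Longrightarrow> y \<in> vcarrier V \<Longrightarrow> x + y \<in> vcarrier V" using s by (rule subspace_add)
  show "x \<in> vcarrier V \<Longrightarrow> vscale V c x \<in> vcarrier V" using s by (rule subspace_scale)
  show "x \<in> vcarrier V \<Longrightarrow> - x \<in> vcarrier V" using s by (rule subspace_neg)
  show "x \<in> vcarrier V \<Longrightarrow> y \<in> vcarrier V \<Longrightarrow> x - y \<in> vcarrier V" using s by (rule subspace_diff)
  show "(\<And>i. i \<in> I \<Longrightarrow> g i \<in> vcarrier V) \<Longrightarrow> sum g I \<in> vcarrier V" using s by (rule subspace_sum)
qed

lemma vspace_fspan: "vcarrier V = fspan A \<Longrightarrow> vscale V = fscale \<Longrightarrow> vspace V"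
  by (simp add: vspace_def vector_space_fscale)

lemma vlinear_closed: "vlinear V U f \<Longrightarrow> x \<in> vcarrier V \<Longrightarrow> f x \<in> vcarrier U"
  and vlinear_add: "vlinear V U f \<Longrightarrow> x \<in> vcarrier V \<Longrightarrow> y \<in> vcarrier V \<Longrightarrow> f (x + y) = f x + f y"
  and vlinear_scale: "vlinear V U f \<Longrightarrow> x \<in> vcarrier V \<Longrightarrow> f (vscale V c x) = vscale U c (f x)"
  by (auto simp: vlinear_def)

lemma vlinear_zero: "vlinear V U f \<Longrightarrow> vspace V \<Longrightarrow> f 0 = 0"
  using vlinear_add[of V U f 0 0] vsp_zero[of V] by simp

lemma vlinear_sum:
  assumes f: "vlinear V U f" and V: "vspace V" and g: "\<And>i. i \<in> I \<Longrightarrow> g i \<in> vcarrier V"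
  shows "f (sum g I) = (\<Sum>i\<in>I. f (g i))"
  using g
proof (induction I rule: infinite_finite_induct)
  case (insert i I)
  then have "sum g I \<in> vcarrier V" using vsp_sum[OF V, of I g] by auto
  with insert show ?case by (simp add: vlinear_add[OF f])
qed (simp_all add: vlinear_zero[OF f V])

lemma vlinear_minus:
  assumes f: "vlinear V U f" and V: "vspace V" and x: "x \<in> vcarrier V"
  shows "f (- x) = - f x"
  using vlinear_add[OF f x vsp_minus[OF V x]] vlinear_zero[OF f V]
  by (simp add: eq_neg_iff_add_eq_0 add.commute)

lemma vlinear_cong: "vlinear V U f \<Longrightarrow> vspace V \<Longrightarrow> (\<And>x. x \<in> vcarrier V \<Longrightarrow> f x = g x) \<Longrightarrow> vlinear V U g"
  by (auto simp: vlinear_def vsp_add vsp_scale Pi_iff)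

lemma vlinear_compose: "vlinear V U f \<Longrightarrow> vlinear U Z g \<Longrightarrow> vlinear V Z (\<lambda>x. g (f x))"
  by (auto simp: vlinear_def Pi_iff)

lemma vlinear_id: "vlinear V V id" "vlinear V V (\<lambda>x. x)"
  by (auto simp: vlinear_def)

lemma vlinear_plus:
  assumes "vlinear V U f" "vlinear V U g" and U: "vspace U"
  shows "vlinear V U (\<lambda>x. f x + g x)"
proof -
  interpret vector_space "vscale U" using U by (rule vspace_vs)
  show ?thesis using assms by (auto simp: vlinear_def Pi_iff vsp_add scale_right_distrib)
qed

lemma vlinear_const_zero: "vspace U \<Longrightarrow> vlinear V U (\<lambda>x. 0)"
proof -
  assume U: "vspace U"
  interpret vector_space "vscale U" using U by (rule vspace_vs)
  show ?thesis using U by (auto simp: vlinear_def vsp_zero)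
qed

lemma vlinear_uminus:
  assumes "vlinear V U f" and U: "vspace U"
  shows "vlinear V U (\<lambda>x. - f x)"
proof -
  interpret vector_space "vscale U" using U by (rule vspace_vs)
  show ?thesis using assms by (auto simp: vlinear_def Pi_iff vsp_minus)
qed

lemma linear_imp_vlinear:
  assumes "Vector_Spaces.linear (vscale V) (vscale U) f"
    and "\<And>x. x \<in> vcarrier V \<Longrightarrow> f x \<in> vcarrier U"
  shows "vlinear V U f"
proof -
  interpret Vector_Spaces.linear "vscale V" "vscale U" f by (rule assms(1))
  show ?thesis using assms(2) by (auto simp: vlinear_def add scale)
qed

section \<open>Tensor products of spaces and of linear maps\<close>

lemma tensor_space_simps [simp]:
  "vscale (tensor_space V U) = fscale"
  by (simp add: tensor_space_def)

lemma vspace_tensor: "vspace (tensor_space V U)"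
  by (rule vspace_fspan) (simp_all add: tensor_space_def)

lemma tensor_in:
  "v \<in> vcarrier V \<Longrightarrow> u \<in> vcarrier U \<Longrightarrow> tensor V U v u \<in> vcarrier (tensor_space V U)"
  by (auto simp: tensor_space_def intro!: fs.span_base)

lemma tensor_add_left:
  "\<lbrakk>v \<in> vcarrier V; v' \<in> vcarrier V; u \<in> vcarrier U\<rbrakk>
    \<Longrightarrow> tensor V U (v + v') u = tensor V U v u + tensor V U v' u"
  by (rule ext) (auto simp: plus_fun_apply tensor_def ev_def bilinear_forms_def vlinear_def ground_def)

lemma tensor_add_right:
  "\<lbrakk>v \<in> vcarrier V; u \<in> vcarrier U; u' \<in> vcarrier U\<rbrakk>
    \<Longrightarrow> tensor V U v (u + u') = tensor V U v u + tensor V U v u'"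
  by (rule ext) (auto simp: plus_fun_apply tensor_def ev_def bilinear_forms_def vlinear_def ground_def)

lemma tensor_scale_left:
  "\<lbrakk>v \<in> vcarrier V; u \<in> vcarrier U\<rbrakk>
    \<Longrightarrow> tensor V U (vscale V c v) u = fscale c (tensor V U v u)"
  by (rule ext) (auto simp: fscale_def tensor_def ev_def bilinear_forms_def vlinear_def ground_def)

lemma tensor_scale_right:
  "\<lbrakk>v \<in> vcarrier V; u \<in> vcarrier U\<rbrakk>
    \<Longrightarrow> tensor V U v (vscale U c u) = fscale c (tensor V U v u)"
  by (rule ext) (auto simp: fscale_def tensor_def ev_def bilinear_forms_def vlinear_def ground_def)

lemma vlinear_tensor_right: "v \<in> vcarrier V \<Longrightarrow> vlinear U (tensor_space V U) (tensor V U v)"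
  by (auto simp: vlinear_def tensor_in tensor_add_right tensor_scale_right)

lemma vlinear_tensor_left:
  "u \<in> vcarrier U \<Longrightarrow> vlinear V (tensor_space V U) (\<lambda>v. tensor V U v u)"
  by (auto simp: vlinear_def tensor_in tensor_add_left tensor_scale_left)

lemma tensor_zero_right: "v \<in> vcarrier V \<Longrightarrow> vspace U \<Longrightarrow> tensor V U v 0 = 0"
  by (rule vlinear_zero[OF vlinear_tensor_right])

lemma tensor_zero_left: "u \<in> vcarrier U \<Longrightarrow> vspace V \<Longrightarrow> tensor V U 0 u = 0"
  by (rule vlinear_zero[OF vlinear_tensor_left])

text \<open>The scalar in a span step is absorbed into the right factor, so there is no case for
  scalar multiples.\<close>

lemma tensor_induct [consumes 3, case_names zero tensor add]:
  assumes x: "x \<in> vcarrier (tensor_space V U)" and U: "vspace U" and V: "vspace V"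
    and zero: "P 0"
    and tensor: "\<And>v u. v \<in> vcarrier V \<Longrightarrow> u \<in> vcarrier U \<Longrightarrow> P (tensor V U v u)"
    and add: "\<And>x y. \<lbrakk>x \<in> vcarrier (tensor_space V U); y \<in> vcarrier (tensor_space V U); P x; P y\<rbrakk>
      \<Longrightarrow> P (x + y)"
  shows "P x"
proof -
  have "x \<in> vcarrier (tensor_space V U) \<and> P x"
    using x[unfolded tensor_space_def vect.simps]
  proof (induction rule: fs.span_induct_alt)
    case base
    show ?case by (intro conjI zero vsp_zero vspace_tensor)
  next
    case (step c x y)
    then obtain v u where vu: "x = tensor V U v u" "v \<in> vcarrier V" "u \<in> vcarrier U" by auto
    then have *: "fscale c x = tensor V U v (vscale U c u)" by (simp add: tensor_scale_right)
    with vu step show ?case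
      by (auto simp: U vsp_scale tensor_in vsp_add vspace_tensor intro!: add tensor)
  qed
  then show ?thesis ..
qed

text \<open>The coefficients of the left factor are moved into the right one, so that only elements
  of the spanning set \<open>E\<close> itself occur on the left.\<close>

lemma tensor_span_induct [consumes 4, case_names zero tensor add]:
  assumes x: "x \<in> vcarrier (tensor_space V U)" and U: "vspace U"
    and V: "vcarrier V = fspan E" "vscale V = fscale"
    and zero: "P 0"
    and tensor: "\<And>v u. v \<in> E \<Longrightarrow> u \<in> vcarrier U \<Longrightarrow> P (tensor V U v u)"
    and add: "\<And>x y. \<lbrakk>x \<in> vcarrier (tensor_space V U); y \<in> vcarrier (tensor_space V U); P x; P y\<rbrakk>
      \<Longrightarrow> P (x + y)"
  shows "P x"
  using x U vspace_fspan[OF V]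
proof (induction rule: tensor_induct)
  case (tensor v u)
  note u = \<open>u \<in> vcarrier U\<close>
  have sV: "vspace V" by (rule vspace_fspan[OF V])
  from \<open>v \<in> vcarrier V\<close>[unfolded V] have "v \<in> vcarrier V \<and> P (tensor V U v u)"
  proof (induction rule: fs.span_induct_alt)
    case base
    then show ?case using u sV by (simp add: tensor_zero_left vsp_zero zero)
  next
    case (step c e v)
    then have e: "e \<in> vcarrier V" by (simp add: V fs.span_base)
    have "fscale c e \<in> vcarrier V" using vsp_scale[OF sV e] V by simp
    with step u sV e have "tensor V U (fscale c e + v) u = tensor V U e (vscale U c u) + tensor V U v u"
      using tensor_scale_left[OF e u, of c] by (simp add: tensor_add_left tensor_scale_right V)
    with step u sV e \<open>fscale c e \<in> vcarrier V\<close> U show ?case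
      by (auto simp: vsp_add vsp_scale tensor_in intro!: add assms(6))
  qed
  then show ?case ..
qed (use zero add in auto)

lemma vlinear_tensor_eqI:
  assumes "vlinear (tensor_space V U) Z f" "vlinear (tensor_space V U) Z' g"
    and "vspace U" "vspace V"
    and "\<And>v u. v \<in> vcarrier V \<Longrightarrow> u \<in> vcarrier U \<Longrightarrow> f (tensor V U v u) = g (tensor V U v u)"
    and "x \<in> vcarrier (tensor_space V U)"
  shows "f x = g x"
  using assms(6,3,4)
  by (induction rule: tensor_induct)
    (auto simp: assms(5) vlinear_add[OF assms(1)] vlinear_add[OF assms(2)]
      vlinear_zero[OF assms(1)] vlinear_zero[OF assms(2)] vspace_tensor)

lemma linear_imp_vlinear_tensor:
  assumes "Vector_Spaces.linear fscale (vscale Z) f" "vspace Z"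
    and "vspace U" "vspace V"
    and "\<And>v u. v \<in> vcarrier V \<Longrightarrow> u \<in> vcarrier U \<Longrightarrow> f (tensor V U v u) \<in> vcarrier Z"
  shows "vlinear (tensor_space V U) Z f"
proof (rule linear_imp_vlinear)
  interpret Vector_Spaces.linear fscale "vscale Z" f by (rule assms(1))
  fix x assume "x \<in> vcarrier (tensor_space V U)"
  then show "f x \<in> vcarrier Z" using assms(3,4)
    by (induction rule: tensor_induct) (auto simp: assms zero add vsp_add vsp_zero)
qed (simp add: assms)

lemma vlinear_tensor_map:
  assumes "vlinear V V' f" "vlinear U U' g" "vspace U" "vspace V"
  shows "vlinear (tensor_space V U) (tensor_space V' U') (tensor_map V' U' f g)"
  using assms
  by (intro linear_imp_vlinear_tensor)
    (auto simp: tensor_map_def[abs_def] linear_ev_lift[unfolded eta_contract_eq]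
      tensor_map_tensor[unfolded tensor_map_def] vspace_tensor
      intro!: tensor_in dest: vlinear_closed)

lemma tensor_map_id_eq:
  assumes "vlinear V V' f" "vlinear U U' g" "vlinear U U' g'" "vspace U" "vspace V"
    and "\<And>u. u \<in> vcarrier U \<Longrightarrow> g u = g' u" "x \<in> vcarrier (tensor_space V U)"
  shows "tensor_map V' U' f g x = tensor_map V' U' f g' x"
  by (rule vlinear_tensor_eqI[OF vlinear_tensor_map vlinear_tensor_map])
    (use assms in \<open>auto simp: tensor_map_tensor\<close>)

lemma tensor_map_compose:
  assumes "vlinear V V' f" "vlinear U U' g" "vlinear V' V'' f'" "vlinear U' U'' g'"
    and "vspace U" "vspace V" "vspace U'" "vspace V'"
    and "x \<in> vcarrier (tensor_space V U)"
  shows "tensor_map V'' U'' f' g' (tensor_map V' U' f g x) =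
    tensor_map V'' U'' (\<lambda>v. f' (f v)) (\<lambda>u. g' (g u)) x"
  by (rule vlinear_tensor_eqI[OF vlinear_compose[OF vlinear_tensor_map vlinear_tensor_map]
        vlinear_tensor_map[OF vlinear_compose vlinear_compose]])
    (use assms vlinear_compose[OF assms(1,3)] vlinear_compose[OF assms(2,4)]
       in \<open>auto simp: tensor_map_tensor\<close>)

lemma tensor_map_plus:
  assumes "vlinear V V' f" "vlinear U U' g" "vlinear U U' g'"
    and "vspace U" "vspace V" "vspace U'"
    and "x \<in> vcarrier (tensor_space V U)"
  shows "tensor_map V' U' f (\<lambda>u. g u + g' u) x = tensor_map V' U' f g x + tensor_map V' U' f g' x"
  by (rule vlinear_tensor_eqI[OF vlinear_tensor_map[OF _ vlinear_plus]
        vlinear_plus[OF vlinear_tensor_map vlinear_tensor_map]])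
    (use assms vlinear_plus[OF assms(2,3)] vlinear_closed[OF assms(1)] vlinear_closed[OF assms(2)]
       vlinear_closed[OF assms(3)]
      in \<open>auto simp: tensor_map_tensor vspace_tensor tensor_add_right\<close>)

text \<open>Each \<open>l i\<close> vanishes on the span of the other vectors but not on
  \<open>x i\<close>, so the family is independent and values on it can be prescribed.\<close>

lemma linear_extend_dual_family:
  assumes s: "vector_space s" and s': "vector_space s'"
    and lin: "\<And>i. i \<in> I \<Longrightarrow> Vector_Spaces.linear s (*) (l i)"
    and dual: "\<And>i j. i \<in> I \<Longrightarrow> j \<in> I \<Longrightarrow> l i (x j) = (if i = j then 1 else 0)"
  shows "\<exists>f. Vector_Spaces.linear s s' f \<and> (\<forall>i\<in>I. f (x i) = F i)"
proof -
  interpret S: vector_space s by (rule s)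
  interpret P: vector_space_pair s s' using s s' by (simp add: vector_space_pair_def)
  have inj: "inj_on x I"
  proof (rule inj_onI)
    fix i j assume "i \<in> I" "j \<in> I" "x i = x j"
    then show "i = j" using dual[of i i] dual[of i j] by (auto split: if_splits)
  qed
  have "S.independent (x ` I)"
    unfolding S.dependent_def
  proof clarify
    fix i assume i: "i \<in> I" and "x i \<in> S.span (x ` I - {x i})"
    interpret l: Vector_Spaces.linear s "(*)" "l i" by (rule lin[OF i])
    from \<open>x i \<in> S.span (x ` I - {x i})\<close> have "l i (x i) = 0"
      by (rule l.eq_0_on_span[rotated]) (use dual i in auto)
    then show False using dual[OF i i] by simp
  qed
  from P.linear_independent_extend[OF this, of "\<lambda>v. F (inv_into I x v)"]
  show ?thesis by (auto simp: inv_into_f_f[OF inj])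
qed

text \<open>The expansion is stated for all finite index sets containing \<open>A\<close>, because
  its users need to enlarge the support at will.\<close>

lemma dual_family_expansion:
  assumes s: "vector_space s"
    and lin: "\<And>i. i \<in> I \<Longrightarrow> Vector_Spaces.linear s (*) (l i)"
    and dual: "\<And>i j. i \<in> I \<Longrightarrow> j \<in> I \<Longrightarrow> l i (x j) = (if i = j then 1 else 0)"
    and t: "t \<in> Modules.module.span s (x ` I)"
  shows "\<exists>A. finite A \<and> A \<subseteq> I \<and>
    (\<forall>A'. finite A' \<longrightarrow> A \<subseteq> A' \<longrightarrow> A' \<subseteq> I \<longrightarrow> t = (\<Sum>i\<in>A'. s (l i t) (x i)))"
proof -
  interpret S: vector_space s by (rule s)
  show ?thesis using t
  proof (induction rule: S.span_induct_alt)
    case base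
    have "l i 0 = 0" if "i \<in> I" for i
      using lin[OF that] by (simp add: linear_iff_module_hom module_hom.zero)
    then show ?case by (intro exI[of _ "{}"]) (auto simp: subset_iff intro!: sum.neutral[symmetric])
  next
    case (step c y t)
    then obtain j A where j: "y = x j" "j \<in> I" and A: "finite A" "A \<subseteq> I"
      "\<And>A'. \<lbrakk>finite A'; A \<subseteq> A'; A' \<subseteq> I\<rbrakk> \<Longrightarrow> t = (\<Sum>i\<in>A'. s (l i t) (x i))"
      by blast
    have "s c y + t = (\<Sum>i\<in>A'. s (l i (s c y + t)) (x i))"
      if A': "finite A'" "insert j A \<subseteq> A'" "A' \<subseteq> I" for A'
    proof -
      have "l i (s c y + t) = c * (if i = j then 1 else 0) + l i t" if "i \<in> A'" for i
      proof -
        have i: "i \<in> I" using that A' by blast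
        interpret l: Vector_Spaces.linear s "(*)" "l i" by (rule lin[OF i])
        show ?thesis by (simp add: l.add l.scale j dual[OF i j(2)])
      qed
      then have "(\<Sum>i\<in>A'. s (l i (s c y + t)) (x i))
          = (\<Sum>i\<in>A'. (if i = j then s c (x i) else 0) + s (l i t) (x i))"
        by (intro sum.cong) (auto simp: S.scale_left_distrib)
      also have "\<dots> = s c y + t"
        using A' A(3)[of A'] by (simp add: sum.distrib j(1))
      finally show ?thesis ..
    qed
    with j A show ?case by (intro exI[of _ "insert j A"]) auto
  qed
qed

lemma linear_projection:
  assumes s: "vector_space s" and V: "Modules.module.subspace s V"
  shows "\<exists>p. Vector_Spaces.linear s s p \<and> range p \<subseteq> V \<and> (\<forall>v\<in>V. p v = v)"
proof -
  interpret P: vector_space_pair s s using s by (simp add: vector_space_pair_def)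
  have "Vector_Spaces.linear s s (\<lambda>x. x)" by (simp add: P.vs1.linear_ident)
  from P.linear_exists_left_inverse_on[OF this V] show ?thesis by auto
qed

text \<open>A linear projection \<open>p\<close> onto the carrier of \<open>V\<close> splits the
  inclusion, so \<open>p \<otimes> p\<close> is a left inverse of the induced map. This makes the
  comultiplication of the subcoalgebra \<open>Sym(W)\<close> unambiguous.\<close>

lemma tensor_map_inclusion_inj:
  assumes V: "vspace V" "vcarrier V \<subseteq> vcarrier T" "vscale V = vscale T" and T: "vspace T"
    and u: "u \<in> vcarrier (tensor_space V V)" and u': "u' \<in> vcarrier (tensor_space V V)"
    and eq: "tensor_map T T id id u = tensor_map T T id id u'"
  shows "u = u'"
proof -
  obtain p where p: "Vector_Spaces.linear (vscale V) (vscale V) p" "range p \<subseteq> vcarrier V"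
    "\<forall>v\<in>vcarrier V. p v = v"
    using linear_projection[of "vscale V" "vcarrier V"] V(1) by (auto simp: vspace_def)
  have p': "vlinear T V p" by (rule linear_imp_vlinear) (use p V(3) in auto)
  have i: "vlinear V T id" using V(2,3) by (auto simp: vlinear_def)
  have "tensor_map V V p p (tensor_map T T id id x) = x" if x: "x \<in> vcarrier (tensor_space V V)" for x
    by (rule vlinear_tensor_eqI[OF vlinear_compose[OF vlinear_tensor_map[OF i i V(1,1)]
          vlinear_tensor_map[OF p' p' T T]] vlinear_id(2) V(1,1) _ x])
      (use p p' i in \<open>simp add: tensor_map_tensor\<close>)
  from this[OF u] this[OF u'] eq show ?thesis by metis
qed

section \<open>Symmetric tensors in coordinates\<close>

abbreviation perms where "perms \<equiv> permutations_of_multiset"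

text \<open>The divided power monomials: each arrangement of \<open>\<alpha>\<close> occurs once
  rather than once per permutation, so that those with letters in a basis span the symmetric tensors
  in every characteristic.\<close>

definition dmon ::
    "('k::field \<Rightarrow> 'w::ab_group_add \<Rightarrow> 'w) \<Rightarrow> 'w multiset \<Rightarrow> (('w list \<Rightarrow> 'k) \<Rightarrow> 'k)" where
  "dmon scale \<alpha> = (\<Sum>xs\<in>perms \<alpha>. tens scale xs)"

text \<open>Every submultiset is the content of a prefix of some arrangement of
  \<open>\<alpha>\<close>.\<close>

lemma finite_submultisets: "finite {\<beta>. \<beta> \<subseteq># \<alpha>}"
proof (rule finite_subset)
  show "{\<beta>. \<beta> \<subseteq># \<alpha>} \<subseteq> (\<lambda>(xs, i). mset (take i xs)) ` (perms \<alpha> \<times> {..size \<alpha>})"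
  proof
    fix \<beta> assume "\<beta> \<in> {\<beta>. \<beta> \<subseteq># \<alpha>}"
    then have \<beta>: "\<beta> \<subseteq># \<alpha>" by simp
    obtain ys zs where "mset ys = \<beta>" "mset zs = \<alpha> - \<beta>" using ex_mset by metis
    with \<beta> have "mset (ys @ zs) = \<alpha>" "\<beta> = mset (take (length ys) (ys @ zs))" "length ys \<le> size \<alpha>"
      using size_mset_mono[of "mset ys" \<alpha>] by auto
    then show "\<beta> \<in> (\<lambda>(xs, i). mset (take i xs)) ` (perms \<alpha> \<times> {..size \<alpha>})"
      by (intro image_eqI[of _ _ "(ys @ zs, length ys)"]) (auto simp: permutations_of_multiset_def)
  qed
qed simp

lemma tens_multilinear_eval: "\<phi> \<in> multilinear_forms scale \<Longrightarrow> tens scale xs \<phi> = \<phi> xs"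
  by (simp add: tens_def ev_def)

lemma linear_fscale_eval: "Vector_Spaces.linear fscale (*) (\<lambda>t. t y)"
  by unfold_locales (auto simp: fscale_def plus_fun_def algebra_simps)

lemma sum_fun_apply: "sum f A x = (\<Sum>i\<in>A. f i x)"
  by (induction A rule: infinite_finite_induct) (auto simp: plus_fun_apply zero_fun_apply)

lemma linear_pointwiseI:
  fixes f :: "'v::ab_group_add \<Rightarrow> ('y \<Rightarrow> 'k::field)"
  assumes s: "vector_space s" and f: "\<And>y. Vector_Spaces.linear s (*) (\<lambda>v. f v y)"
  shows "Vector_Spaces.linear s fscale f"
proof (rule linearI[OF s vector_space_fscale])
  interpret f: Vector_Spaces.linear s "(*)" "\<lambda>v. f v y" for y by (rule f)
  show "f (x + y) = f x + f y" for x y by (simp add: fun_eq_iff plus_fun_apply f.add)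
  show "f (s c x) = fscale c (f x)" for c x by (simp add: fun_eq_iff fscale_def f.scale)
qed

locale based_space = vector_space scale
  for scale :: "'k::field \<Rightarrow> 'w::ab_group_add \<Rightarrow> 'w" +
  fixes B :: "'w set"
  assumes indep: "independent B" and span_B: "span B = UNIV"
begin

abbreviation wlinear where "wlinear \<equiv> Vector_Spaces.linear scale fscale"

lemma linear_zero_form: "Vector_Spaces.linear scale (*) (\<lambda>_. 0)"
  by (rule linearI[OF vector_space_axioms vector_space_field]) simp_all

lemma linear_tens: "wlinear (\<lambda>w. tens scale (us @ w # vs))"
proof (rule linear_pointwiseI[OF vector_space_axioms])
  fix \<phi> show "Vector_Spaces.linear scale (*) (\<lambda>w. tens scale (us @ w # vs) \<phi>)"
    by (cases "\<phi> \<in> multilinear_forms scale")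
      (simp_all add: tens_def ev_def linear_zero_form, simp add: multilinear_forms_def)
qed

text \<open>The varying letter lands at the single position that \<open>\<sigma>\<close> sends to
  its old one, and the other entries do not see it. This gives the multilinearity of permuted words
  that is required to evaluate \<open>ev_lift\<close> on them.\<close>

lemma permute_list_slot:
  fixes us vs :: "'w list"
  assumes "\<sigma> permutes {..<length us + Suc (length vs)}"
  shows "\<exists>us' vs'. \<forall>w. permute_list \<sigma> (us @ w # vs) = us' @ w # vs'"
proof -
  let ?n = "length us + Suc (length vs)"
  let ?i = "inv_into UNIV \<sigma> (length us)"
  have i: "?i < ?n"
    using permutes_in_image[OF permutes_inv[OF assms], of "length us"] by simp
  have \<sigma>i: "\<sigma> ?i = length us" using permutes_inverses(1)[OF assms] .
  let ?xs = "permute_list \<sigma> (us @ 0 # vs)"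
  have "permute_list \<sigma> (us @ w # vs) = take ?i ?xs @ w # drop (Suc ?i) ?xs" for w
  proof -
    have "permute_list \<sigma> (us @ w # vs) = ?xs[?i := w]"
    proof (rule nth_equalityI)
      fix j assume j: "j < length (permute_list \<sigma> (us @ w # vs))"
      have ne: "\<sigma> j \<noteq> length us" if "j \<noteq> ?i"
        using that permutes_inverses(2)[OF assms, of j] by metis
      have "(us @ w # vs) ! \<sigma> j = (us @ 0 # vs) ! \<sigma> j" if "\<sigma> j \<noteq> length us"
        using that by (auto simp: nth_append nth_Cons split: nat.splits)
      with j ne i \<sigma>i assms show "permute_list \<sigma> (us @ w # vs) ! j = ?xs[?i := w] ! j"
        by (cases "j = ?i") (auto simp: permute_list_nth nth_list_update)
    qed simp
    also have "\<dots> = take ?i ?xs @ w # drop (Suc ?i) ?xs"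
      using i by (subst upd_conv_take_nth_drop) auto
    finally show ?thesis .
  qed
  then show ?thesis by blast
qed

lemma permute_tensor_tens:
  assumes "\<sigma> permutes {..<n}"
  shows "permute_tensor scale n \<sigma> (tens scale xs) =
    (if length xs = n then tens scale (permute_list \<sigma> xs) else 0)"
  unfolding permute_tensor_def tens_def[of scale xs]
proof (rule ev_lift_ev)
  fix \<phi>
  show "(\<lambda>xs. (if length xs = n then tens scale (permute_list \<sigma> xs) else 0) \<phi>)
    \<in> multilinear_forms scale"
    unfolding multilinear_forms_def
  proof (intro CollectI allI)
    fix us vs
    show "Vector_Spaces.linear scale (*)
      (\<lambda>w. (if length (us @ w # vs) = n then tens scale (permute_list \<sigma> (us @ w # vs)) else 0) \<phi>)"
    proof (cases "length us + Suc (length vs) = n")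
      case True
      then obtain us' vs' where "\<And>w. permute_list \<sigma> (us @ w # vs) = us' @ w # vs'"
        using permute_list_slot[of \<sigma> us vs] assms by blast
      with True show ?thesis
        using Vector_Spaces.linear_compose[OF linear_tens[of us' vs'] linear_fscale_eval[of \<phi>]]
        by (simp add: o_def)
    qed (simp add: linear_zero_form zero_fun_apply)
  qed
qed

lemma degree_part_tens:
  "degree_part scale n (tens scale xs) = (if length xs = n then tens scale xs else 0)"
  unfolding degree_part_def tens_def[of scale xs]
proof (subst ev_lift_ev)
  fix \<phi>
  show "(\<lambda>xs. (if length xs = n then tens scale xs else 0) \<phi>) \<in> multilinear_forms scale"
    unfolding multilinear_forms_def
  proof (intro CollectI allI)
    fix us vs
    show "Vector_Spaces.linear scale (*)
      (\<lambda>w. (if length (us @ w # vs) = n then tens scale (us @ w # vs) else 0) \<phi>)"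
      using Vector_Spaces.linear_compose[OF linear_tens[of us vs] linear_fscale_eval[of \<phi>]]
      by (cases "length us + Suc (length vs) = n") (simp_all add: o_def linear_zero_form zero_fun_apply)
  qed
qed (simp add: tens_def)

lemma comult_tensor_coalgebra_tens:
  defines "T \<equiv> tensor_algebra_space scale"
  shows "comult (tensor_coalgebra scale) (tens scale xs) =
    (\<Sum>i\<le>length xs. tensor T T (tens scale (take i xs)) (tens scale (drop i xs)))"
proof -
  have T: "vcarrier T = fspan (range (tens scale))" "vscale T = fscale"
    by (simp_all add: T_def tensor_algebra_space_def)
  have t: "tens scale xs \<in> vcarrier T" for xs by (simp add: T fs.span_base)
  have "(\<lambda>xs. (\<Sum>i\<le>length xs. tensor T T (tens scale (take i xs)) (tens scale (drop i xs))) \<gamma>)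
    \<in> multilinear_forms scale" for \<gamma>
    unfolding multilinear_forms_def
  proof (intro CollectI allI)
    fix us vs
    let ?g = "\<lambda>i w. tensor T T (tens scale (take i (us @ w # vs))) (tens scale (drop i (us @ w # vs)))"
    have lin: "wlinear (?g i)" for i
    \<comment> \<open>A cut at or before position \<open>length us\<close> leaves the varying letter
      in the right tensor factor, a later cut leaves it in the left one.\<close>
    proof (cases "i \<le> length us")
      case True
      interpret l: Vector_Spaces.linear scale fscale "\<lambda>w. tens scale (drop i us @ w # vs)"
        by (rule linear_tens)
      from True show ?thesis
        by unfold_locales
          (auto simp: l.add l.scale tensor_add_right t tensor_scale_right[OF t t, unfolded T])
    next
      case False
      then obtain j where j: "i - length us = Suc j" by (metis Suc_diff_Suc not_le)
      interpret l: Vector_Spaces.linear scale fscale "\<lambda>w. tens scale (us @ w # take j vs)"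
        by (rule linear_tens)
      from False j show ?thesis
        by unfold_locales
          (auto simp: l.add l.scale tensor_add_left t tensor_scale_left[OF t t, unfolded T])
    qed
    have "Vector_Spaces.linear scale (*) (\<lambda>w. \<Sum>i\<le>length us + Suc (length vs). ?g i w \<gamma>)"
    proof -
      interpret P: vector_space_pair scale "(*) :: 'k \<Rightarrow> 'k \<Rightarrow> 'k"
        by (simp add: vector_space_pair_def vector_space_axioms vector_space_field)
      show ?thesis
        using Vector_Spaces.linear_compose[OF lin linear_fscale_eval[of \<gamma>]]
        by (intro P.linear_compose_sum) (simp add: o_def)
    qed
    then show "Vector_Spaces.linear scale (*) (\<lambda>w. (\<Sum>i\<le>length (us @ w # vs). ?g i w) \<gamma>)"
      by (simp only: sum_fun_apply length_append list.size add_Suc_right add_0_right)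
  qed
  from ev_lift_ev[of "\<lambda>xs. \<Sum>i\<le>length xs. tensor T T (tens scale (take i xs)) (tens scale (drop i xs))", OF this]
  show ?thesis
    by (simp add: tensor_coalgebra_def Let_def T_def tens_def[of scale xs])
qed

text \<open>The prefix \<open>us\<close> holds the letters that are already basis vectors, which
  lets the induction expand a word from left to right; the applications take
  \<open>us = []\<close>.\<close>

lemma multilinear_in_span:
  fixes s :: "'k \<Rightarrow> 'v::ab_group_add \<Rightarrow> 'v"
  assumes s: "vector_space s"
    and h: "\<And>us vs. Vector_Spaces.linear scale s (\<lambda>w. h (us @ w # vs))"
    and us: "us \<in> lists B"
  shows "h (us @ xs) \<in> Modules.module.span s (h ` {ys \<in> lists B. length ys = length us + length xs})"
  using us
proof (induction xs arbitrary: us)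
  case Nil
  interpret S: vector_space s by (rule s)
  from Nil show ?case by (auto intro!: S.span_base)
next
  case (Cons x xs)
  interpret S: vector_space s by (rule s)
  interpret l: Vector_Spaces.linear scale s "\<lambda>w. h (us @ w # xs)" by (rule h)
  have "x \<in> span B" using span_B by simp
  then show ?case
  proof (induction rule: span_induct_alt)
    case base
    show ?case by (simp add: l.zero S.span_zero)
  next
    case (step c b y)
    have "h ((us @ [b]) @ xs) \<in> S.span (h ` {ys \<in> lists B. length ys = length (us @ [b]) + length xs})"
      by (rule Cons.IH) (use Cons.prems step in auto)
    with step show ?case
      by (auto simp: l.add l.scale intro!: S.span_add S.span_scale)
  qed
qed

section \<open>Coordinates on words and on symmetric tensors\<close>

abbreviation MB :: "'w multiset set" where "MB \<equiv> {\<alpha>. set_mset \<alpha> \<subseteq> B}"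

abbreviation e where "e \<equiv> dmon scale"

definition dual :: "'w \<Rightarrow> 'w \<Rightarrow> 'k" where "dual b w = representation B w b"

lemma linear_dual: "Vector_Spaces.linear scale (*) (dual b)"
  unfolding dual_def[abs_def] by (rule linear_representation[OF indep span_B])

lemma dual_basis: "b \<in> B \<Longrightarrow> c \<in> B \<Longrightarrow> dual b c = (if b = c then 1 else 0)"
  by (auto simp: dual_def representation_basis[OF indep])

text \<open>For \<open>xs\<close> over \<open>B\<close> these are the forms dual to the words over
  \<open>B\<close>; the catch-all equation makes words of different lengths orthogonal.\<close>

fun word_form :: "'w list \<Rightarrow> 'w list \<Rightarrow> 'k" where
  "word_form [] [] = 1"
| "word_form (x # xs) (y # ys) = dual x y * word_form xs ys"
| "word_form _ _ = 0"

lemma word_form_multilinear: "word_form xs \<in> multilinear_forms scale"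
  unfolding multilinear_forms_def
proof (intro CollectI allI)
  fix us vs
  show "Vector_Spaces.linear scale (*) (\<lambda>w. word_form xs (us @ w # vs))"
  proof (induction us arbitrary: xs)
    case Nil
    show ?case
    proof (cases xs)
      case (Cons x xs')
      show ?thesis unfolding Cons
        by (rule linearI[OF vector_space_axioms vector_space_field])
          (simp_all add: linear_addD[OF linear_dual] linear_scaleD[OF linear_dual] distrib_right mult.assoc)
    qed (simp add: linear_zero_form)
  next
    case (Cons u us)
    show ?case
    proof (cases xs)
      case (Cons x xs')
      note l = linear_addD[OF Cons.IH] linear_scaleD[OF Cons.IH]
      show ?thesis unfolding Cons
        by (rule linearI[OF vector_space_axioms vector_space_field])
          (simp_all add: l distrib_left mult.left_commute)
    qed (simp add: linear_zero_form)
  qed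
qed

lemma word_form_basis:
  "xs \<in> lists B \<Longrightarrow> ys \<in> lists B \<Longrightarrow> word_form xs ys = (if xs = ys then 1 else 0)"
  by (induction xs ys rule: word_form.induct) (auto simp: dual_basis)

lemma tens_word_form:
  "xs \<in> lists B \<Longrightarrow> ys \<in> lists B \<Longrightarrow> tens scale ys (word_form xs) = (if xs = ys then 1 else 0)"
  by (simp add: tens_multilinear_eval word_form_multilinear word_form_basis)

lemma permutations_MB: "\<alpha> \<in> MB \<Longrightarrow> perms \<alpha> \<subseteq> lists B"
  using permutations_of_multiset_lists[of \<alpha>] by auto

text \<open>A word is an arrangement of exactly one multiset, so any single arrangement of
  \<open>\<alpha>\<close> reads off the coefficient of \<open>e \<alpha>\<close>.\<close>

lemma dmon_word_form:
  assumes "mset xs \<in> MB" "\<alpha> \<in> MB"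
  shows "e \<alpha> (word_form xs) = (if mset xs = \<alpha> then 1 else 0)"
proof -
  have "e \<alpha> (word_form xs) = (\<Sum>ys\<in>perms \<alpha>. if ys = xs then 1 else 0)"
    unfolding dmon_def sum_fun_apply
  proof (intro sum.cong refl)
    fix ys assume "ys \<in> perms \<alpha>"
    then have "ys \<in> lists B" using permutations_MB[OF assms(2)] by blast
    moreover have "xs \<in> lists B" using assms(1) by (auto simp: in_lists_conv_set)
    ultimately show "tens scale ys (word_form xs) = (if ys = xs then 1 else 0)"
      by (auto simp: tens_word_form)
  qed
  also have "\<dots> = (if xs \<in> perms \<alpha> then 1 else 0)" by simp
  also have "\<dots> = (if mset xs = \<alpha> then 1 else 0)"
    by (simp add: permutations_of_multiset_def)
  finally show ?thesis .
qed

lemma tensor_power_basis: "tensor_power scale n = fspan (tens scale ` {xs \<in> lists B. length xs = n})"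
proof
  have "tens scale xs \<in> fspan (tens scale ` {ys \<in> lists B. length ys = length xs})" for xs
    using multilinear_in_span[OF vector_space_fscale linear_tens, of "[]" xs] by simp
  then show "tensor_power scale n \<subseteq> fspan (tens scale ` {xs \<in> lists B. length xs = n})"
    unfolding tensor_power_def by (intro fs.span_minimal) auto
  show "fspan (tens scale ` {xs \<in> lists B. length xs = n}) \<subseteq> tensor_power scale n"
    unfolding tensor_power_def by (rule fs.span_mono) auto
qed

text \<open>A permutation of the positions permutes the arrangements of \<open>\<alpha>\<close>
  among themselves.\<close>

lemma dmon_symmetric: "e \<alpha> \<in> symmetric_tensors scale (size \<alpha>)"
  unfolding symmetric_tensors_def
proof (intro CollectI conjI allI impI)
  show "e \<alpha> \<in> tensor_power scale (size \<alpha>)"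
    unfolding dmon_def tensor_power_def
    by (intro fs.span_sum fs.span_base) (auto simp: permutations_of_multiset_def)
next
  fix \<sigma> assume \<sigma>: "\<sigma> permutes {..<size \<alpha>}"
  interpret l: Vector_Spaces.linear fscale fscale "permute_tensor scale (size \<alpha>) \<sigma>"
    unfolding permute_tensor_def[abs_def] by (rule linear_ev_lift[unfolded eta_contract_eq])
  have len: "length xs = size \<alpha>" if "xs \<in> perms \<alpha>" for xs
    using that by (auto simp: permutations_of_multiset_def)
  have \<sigma>': "inv_into UNIV \<sigma> permutes {..<size \<alpha>}" using \<sigma> by (rule permutes_inv)
  have "permute_tensor scale (size \<alpha>) \<sigma> (e \<alpha>) =
      (\<Sum>xs\<in>perms \<alpha>. tens scale (permute_list \<sigma> xs))"
    unfolding dmon_def l.sum by (intro sum.cong) (auto simp: permute_tensor_tens[OF \<sigma>] len)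
  also have "\<dots> = e \<alpha>"
    unfolding dmon_def
  proof (rule sum.reindex_bij_witness[of _ "permute_list (inv_into UNIV \<sigma>)" "permute_list \<sigma>"])
    fix xs assume xs: "xs \<in> perms \<alpha>"
    note p = \<sigma>[folded len[OF xs]] \<sigma>'[folded len[OF xs]]
    show "permute_list (inv_into UNIV \<sigma>) (permute_list \<sigma> xs) = xs"
      using permute_list_compose[OF p(2), of \<sigma>] permutes_inv_o(1)[OF p(1)] by simp
    show "permute_list \<sigma> (permute_list (inv_into UNIV \<sigma>) xs) = xs"
      using permute_list_compose[OF p(1), of "inv_into UNIV \<sigma>"] permutes_inv_o(2)[OF p(1)] by simp
    show "permute_list \<sigma> xs \<in> perms \<alpha>"
      "permute_list (inv_into UNIV \<sigma>) xs \<in> perms \<alpha>"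
      using xs p by (auto simp: permutations_of_multiset_def)
  qed simp
  finally show "permute_tensor scale (size \<alpha>) \<sigma> (e \<alpha>) = e \<alpha>" .
qed

text \<open>Invariance makes the coefficients of \<open>t\<close> constant on words with the same
  content, so its expansion in words collects into the sums \<open>e \<alpha>\<close>.\<close>

lemma symmetric_tensors_span: "symmetric_tensors scale n \<subseteq> fspan (e ` MB)"
proof
  fix t assume t: "t \<in> symmetric_tensors scale n"
  let ?I = "{xs \<in> lists B. length xs = n}"
  have t': "t \<in> fspan (tens scale ` ?I)" using t by (simp add: symmetric_tensors_def tensor_power_basis)
  have inv: "t (word_form xs) = t (word_form ys)" if "mset xs = mset ys" "ys \<in> ?I" for xs ys
  proof -
    from that(1) obtain \<sigma> where \<sigma>: "\<sigma> permutes {..<length ys}" "permute_list \<sigma> ys = xs"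
      by (rule mset_eq_permutation)
    interpret l: Vector_Spaces.linear fscale fscale "permute_tensor scale n \<sigma>"
      unfolding permute_tensor_def[abs_def] by (rule linear_ev_lift[unfolded eta_contract_eq])
    have \<sigma>n: "\<sigma> permutes {..<n}" using that \<sigma> by simp
    have xs: "xs \<in> lists B" using that mset_eq_setD[OF that(1)] by (auto simp: in_lists_conv_set)
    have inj: "permute_list \<sigma> zs = permute_list \<sigma> ys \<longleftrightarrow> zs = ys" if "length zs = n" for zs
    proof
      assume "permute_list \<sigma> zs = permute_list \<sigma> ys"
      then have "permute_list (inv_into UNIV \<sigma>) (permute_list \<sigma> zs) = permute_list (inv_into UNIV \<sigma>) (permute_list \<sigma> ys)"
        by simp
      then show "zs = ys"
        using permute_list_compose[of "inv_into UNIV \<sigma>" zs \<sigma>] permute_list_compose[of "inv_into UNIV \<sigma>" ys \<sigma>]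
          permutes_inv[OF \<sigma>n] permutes_inv_o(1)[OF \<sigma>n] that \<open>ys \<in> ?I\<close> by simp
    qed simp
    \<comment> \<open>For every tensor of degree \<open>n\<close>, the coefficient of
      \<open>xs\<close> after permuting is that of \<open>ys\<close> before, as \<open>ys\<close> is
      the only word that \<open>\<sigma>\<close> takes to \<open>xs\<close>. The invariance of
      \<open>t\<close> is used afterwards.\<close>
    from t' have "permute_tensor scale n \<sigma> t (word_form xs) = t (word_form ys)"
    proof (induction rule: fs.span_induct_alt)
      case base
      show ?case by (subst l.zero) (simp only: zero_fun_apply)
    next
      case (step c x y)
      then obtain zs where zs: "x = tens scale zs" "zs \<in> lists B" "length zs = n" by auto
      have "permute_tensor scale n \<sigma> x (word_form xs) = x (word_form ys)"
        using zs xs that inj[of zs] \<sigma>n set_permute_list[of \<sigma> zs]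
        by (auto simp: permute_tensor_tens tens_word_form in_lists_conv_set \<sigma>(2)[symmetric])
      moreover have "permute_tensor scale n \<sigma> (fscale c x + y) (word_form xs) =
          c * permute_tensor scale n \<sigma> x (word_form xs) + permute_tensor scale n \<sigma> y (word_form xs)"
        by (subst l.add, subst l.scale) (simp only: plus_fun_apply fscale_def)
      moreover have "(fscale c x + y) (word_form ys) = c * x (word_form ys) + y (word_form ys)"
        by (simp only: plus_fun_apply fscale_def)
      ultimately show ?case by (simp only: step(2))
    qed
    then show ?thesis using t \<sigma>n by (simp add: symmetric_tensors_def)
  qed
  have "\<exists>A. finite A \<and> A \<subseteq> ?I \<and> (\<forall>A'. finite A' \<longrightarrow> A \<subseteq> A' \<longrightarrow> A' \<subseteq> ?I \<longrightarrow>
      t = (\<Sum>xs\<in>A'. fscale (t (word_form xs)) (tens scale xs)))"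
    by (rule dual_family_expansion[OF vector_space_fscale linear_fscale_eval _ t'])
      (auto simp: tens_word_form)
  then obtain A where A: "finite A" "A \<subseteq> ?I"
    "\<And>A'. \<lbrakk>finite A'; A \<subseteq> A'; A' \<subseteq> ?I\<rbrakk> \<Longrightarrow> t = (\<Sum>xs\<in>A'. fscale (t (word_form xs)) (tens scale xs))"
    by blast
  \<comment> \<open>The support is enlarged until it is closed under rearrangement; the expansion
    remains valid because \<open>A\<close> admits every larger finite index set.\<close>
  let ?A' = "\<Union>\<alpha>\<in>mset ` A. perms \<alpha>"
  have mem: "set_mset \<alpha> \<subseteq> B" "size \<alpha> = n" if "\<alpha> \<in> mset ` A" for \<alpha>
    using that A(2) by (auto simp: in_lists_conv_set)
  have "t = (\<Sum>xs\<in>?A'. fscale (t (word_form xs)) (tens scale xs))"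
  proof (rule A(3))
    show "?A' \<subseteq> ?I"
    proof
      fix xs assume "xs \<in> ?A'"
      then obtain \<alpha> where \<alpha>: "\<alpha> \<in> mset ` A" "mset xs = \<alpha>"
        by (auto simp: permutations_of_multiset_def)
      from mem[OF \<alpha>(1)] show "xs \<in> ?I" unfolding \<alpha>(2)[symmetric] by auto
    qed
  qed (use A(1) in \<open>auto intro: permutations_of_multisetI\<close>)
  also have "\<dots> = (\<Sum>\<alpha>\<in>mset ` A. \<Sum>xs\<in>perms \<alpha>. fscale (t (word_form xs)) (tens scale xs))"
    using A(1) by (intro sum.UNION_disjoint) (auto, metis permutations_of_multisetD)
  also have "\<dots> \<in> fspan (e ` MB)"
  proof (rule fs.span_sum)
    fix \<alpha> assume \<alpha>: "\<alpha> \<in> mset ` A"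
    then obtain ys where ys: "ys \<in> A" "mset ys = \<alpha>" by auto
    have "(\<Sum>xs\<in>perms \<alpha>. fscale (t (word_form xs)) (tens scale xs)) =
        fscale (t (word_form ys)) (e \<alpha>)"
      unfolding dmon_def fs.scale_sum_right
    proof (intro sum.cong refl)
      fix xs assume "xs \<in> perms \<alpha>"
      then have "mset xs = mset ys" using ys(2) by (simp add: permutations_of_multiset_def)
      then have "t (word_form xs) = t (word_form ys)" using inv[of xs ys] ys A(2) by blast
      then show "fscale (t (word_form xs)) (tens scale xs) = fscale (t (word_form ys)) (tens scale xs)"
        by (simp only:)
    qed
    then show "(\<Sum>xs\<in>perms \<alpha>. fscale (t (word_form xs)) (tens scale xs)) \<in> fspan (e ` MB)"
      using mem[OF \<alpha>] by (simp only:) (intro fs.span_scale fs.span_base, blast)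
  qed
  finally show "t \<in> fspan (e ` MB)" .
qed

lemma vcarrier_sym_space: "vcarrier (sym_space scale) = fspan (e ` MB)"
proof
  show "vcarrier (sym_space scale) \<subseteq> fspan (e ` MB)"
    unfolding sym_space_def by (simp, intro fs.span_minimal) (use symmetric_tensors_span in auto)
  show "fspan (e ` MB) \<subseteq> vcarrier (sym_space scale)"
    unfolding sym_space_def using dmon_symmetric by (simp, intro fs.span_mono) blast
qed

end

section \<open>The comultiplication of the symmetric coalgebra\<close>

text \<open>Tensor products depend only on carriers and scalings. The same space occurs in records
  of different types (\<open>sym_space\<close> and \<open>sym_coalgebra\<close>, tensor spaces and
  cofree comodules), and these congruences identify the resulting tensor products.\<close>

lemma bilinear_forms_cong:
  "\<lbrakk>vcarrier V = vcarrier V'; vscale V = vscale V'; vcarrier U = vcarrier U'; vscale U = vscale U'\<rbrakk>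
    \<Longrightarrow> bilinear_forms V U = bilinear_forms V' U'"
  by (simp add: bilinear_forms_def vlinear_def)

lemma tensor_cong:
  "\<lbrakk>vcarrier V = vcarrier V'; vscale V = vscale V'; vcarrier U = vcarrier U'; vscale U = vscale U'\<rbrakk>
    \<Longrightarrow> tensor V U = tensor V' U'"
  using bilinear_forms_cong[of V V' U U'] by (simp add: tensor_def fun_eq_iff)

lemma tensor_space_cong:
  "\<lbrakk>vcarrier V = vcarrier V'; vscale V = vscale V'; vcarrier U = vcarrier U'; vscale U = vscale U'\<rbrakk>
    \<Longrightarrow> tensor_space V U = tensor_space V' U'"
  using tensor_cong[of V V' U U'] by (simp add: tensor_space_def)

lemma tensor_map_cong:
  "\<lbrakk>vcarrier V = vcarrier V'; vscale V = vscale V'; vcarrier U = vcarrier U'; vscale U = vscale U'\<rbrakk>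
    \<Longrightarrow> tensor_map V U f g = tensor_map V' U' f g"
  using tensor_cong[of V V' U U'] by (simp add: tensor_map_def)

lemma ev_lift_tensor:
  fixes g :: "'a::ab_group_add \<Rightarrow> 'b::ab_group_add \<Rightarrow> 'y \<Rightarrow> 'k::field"
  assumes "\<And>a. a \<in> vcarrier A \<Longrightarrow> vlinear B \<lparr>vcarrier = UNIV, vscale = fscale\<rparr> (g a)"
    and "\<And>b. b \<in> vcarrier B \<Longrightarrow> vlinear A \<lparr>vcarrier = UNIV, vscale = fscale\<rparr> (\<lambda>a. g a b)"
  shows "ev_lift (\<lambda>(a, b). g a b) (tensor A B a b) = g a b"
  unfolding tensor_def
  by (subst ev_lift_ev)
    (use assms in \<open>auto simp: bilinear_forms_def vlinear_def ground_def fscale_def plus_fun_apply\<close>)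

text \<open>The pattern of \<open>tensor_assoc\<close> and of the second map in
  \<open>koszul_diff\<close>. Evaluating the outer \<open>ev_lift\<close> requires linearity in
  \<open>d\<close> for every \<open>x\<close> in \<open>A \<otimes> B\<close>, while the inner one
  is known only on pure tensors; hence the induction on \<open>x\<close>.\<close>

lemma ev_lift_tensor_nested:
  fixes g :: "'a::ab_group_add \<Rightarrow> 'b::ab_group_add \<Rightarrow> 'd::ab_group_add \<Rightarrow> 'y \<Rightarrow> 'k::field"
  assumes A: "vspace A" and B: "vspace B" and D: "vspace D"
    and ga: "\<And>b d. \<lbrakk>b \<in> vcarrier B; d \<in> vcarrier D\<rbrakk> \<Longrightarrow> vlinear A \<lparr>vcarrier = UNIV, vscale = fscale\<rparr> (\<lambda>a. g a b d)"
    and gb: "\<And>a d. \<lbrakk>a \<in> vcarrier A; d \<in> vcarrier D\<rbrakk> \<Longrightarrow> vlinear B \<lparr>vcarrier = UNIV, vscale = fscale\<rparr> (\<lambda>b. g a b d)"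
    and gd: "\<And>a b. \<lbrakk>a \<in> vcarrier A; b \<in> vcarrier B\<rbrakk> \<Longrightarrow> vlinear D \<lparr>vcarrier = UNIV, vscale = fscale\<rparr> (g a b)"
    and mem: "a \<in> vcarrier A" "b \<in> vcarrier B" "d \<in> vcarrier D"
  shows "ev_lift (\<lambda>(x, d). ev_lift (\<lambda>(a, b). g a b d) x) (tensor (tensor_space A B) D (tensor A B a b) d) = g a b d"
proof -
  let ?Z = "\<lparr>vcarrier = UNIV, vscale = fscale\<rparr> :: ('k, 'y \<Rightarrow> 'k) vect"
  have Z: "vspace ?Z" by (simp add: vspace_def vector_space_fscale)
  let ?h = "\<lambda>d. ev_lift (\<lambda>(a, b). g a b d)"
  have h: "?h d (tensor A B a b) = g a b d" if "d \<in> vcarrier D" for a b d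
    using that by (intro ev_lift_tensor ga gb)
  have lin: "flinear (?h d)" for d by (rule linear_ev_lift)
  have "vlinear D ?Z (\<lambda>d. ?h d x)" if "x \<in> vcarrier (tensor_space A B)" for x
    using that B A
  proof (induction rule: tensor_induct)
    case zero
    show ?case unfolding linear_zeroD[OF lin] by (rule vlinear_const_zero[OF Z])
  next
    case (tensor a b)
    from gd[OF tensor] D show ?case by (rule vlinear_cong) (simp add: h)
  next
    case (add x y)
    show ?case unfolding linear_addD[OF lin] by (rule vlinear_plus[OF add(3,4) Z])
  qed
  then have "ev_lift (\<lambda>(x, d). ?h d x) (tensor (tensor_space A B) D (tensor A B a b) d) = ?h d (tensor A B a b)"
    by (intro ev_lift_tensor[of "tensor_space A B" D "\<lambda>x d. ?h d x"])
      (auto intro!: linear_imp_vlinear simp: lin[unfolded eta_contract_eq])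
  with h[OF mem(3)] show ?thesis by simp
qed

context based_space begin

abbreviation C where "C \<equiv> sym_coalgebra scale"
abbreviation T where "T \<equiv> tensor_coalgebra scale"
abbreviation W where "W \<equiv> whole_space scale"
abbreviation CT where "CT U \<equiv> vcarrier (tensor_space C U)"
abbreviation below :: "'w multiset \<Rightarrow> 'w multiset set" where "below \<alpha> \<equiv> {\<beta>. \<beta> \<subseteq># \<alpha>}"

lemma vscale_C [simp]: "vscale C = fscale"
  and vscale_T [simp]: "vscale T = fscale"
  and vscale_W [simp]: "vscale W = scale"
  and vcarrier_W [simp]: "vcarrier W = UNIV"
  by (simp_all add: sym_coalgebra_def tensor_coalgebra_def whole_space_def Let_def)

lemma vcarrier_C: "vcarrier C = fspan (e ` MB)"
  by (simp add: sym_coalgebra_def Let_def vcarrier_sym_space)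

lemma vcarrier_T: "vcarrier T = fspan (range (tens scale))"
  by (simp add: tensor_coalgebra_def Let_def tensor_algebra_space_def)

lemma vspace_C: "vspace C" by (rule vspace_fspan[OF vcarrier_C vscale_C])
lemma vspace_T: "vspace T" by (rule vspace_fspan[OF vcarrier_T vscale_T])
lemma vspace_W: "vspace W"
  by (simp add: vspace_def vector_space_axioms)

lemma dmon_in_C: "\<alpha> \<in> MB \<Longrightarrow> e \<alpha> \<in> vcarrier C"
  unfolding vcarrier_C by (rule fs.span_base) simp

lemma tens_in_T: "tens scale xs \<in> vcarrier T"
  unfolding vcarrier_T by (rule fs.span_base) simp

lemma dmon_in_T: "e \<alpha> \<in> vcarrier T"
  unfolding dmon_def by (rule vsp_sum[OF vspace_T tens_in_T])

lemma C_subset_T: "vcarrier C \<subseteq> vcarrier T"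
  unfolding vcarrier_C using dmon_in_T by (intro fs.span_minimal) (auto simp: vcarrier_T)

lemma comult_tens: "comult T (tens scale xs) =
    (\<Sum>i\<le>length xs. tensor T T (tens scale (take i xs)) (tens scale (drop i xs)))"
proof -
  have "tensor (tensor_algebra_space scale) (tensor_algebra_space scale) = tensor T T"
    by (rule tensor_cong) (simp_all add: tensor_coalgebra_def Let_def tensor_algebra_space_def)
  then show ?thesis by (simp add: comult_tensor_coalgebra_tens)
qed

lemma linear_comult_T: "flinear (comult T)"
  by (simp add: tensor_coalgebra_def Let_def linear_ev_lift)

text \<open>An arrangement of \<open>\<alpha>\<close> together with a cut is the same as a
  submultiset \<open>\<beta>\<close> with arrangements of \<open>\<beta>\<close> and of
  \<open>\<alpha> - \<beta>\<close>. Hence no binomial coefficients appear.\<close>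

lemma comult_T_dmon: "comult T (e \<alpha>) = (\<Sum>\<beta>\<in>below \<alpha>. tensor T T (e \<beta>) (e (\<alpha> - \<beta>)))"
proof -
  let ?P = permutations_of_multiset
  have take: "mset (take i xs) + mset (drop i xs) = mset xs" for i and xs :: "'w list"
    by (metis append_take_drop_id mset_append)
  have take_sub: "mset (take i xs) \<subseteq># mset xs" for i and xs :: "'w list"
    by (metis take mset_subset_eq_add_left)
  have take_diff: "mset xs - mset (take i xs) = mset (drop i xs)" for i and xs :: "'w list"
    by (metis take add_diff_cancel_left')
  have "comult T (e \<alpha>) = (\<Sum>xs\<in>?P \<alpha>. \<Sum>i\<le>length xs. tensor T T (tens scale (take i xs)) (tens scale (drop i xs)))"
    unfolding dmon_def linear_sumD[OF linear_comult_T] comult_tens ..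
  also have "\<dots> = (\<Sum>(xs, i)\<in>Sigma (?P \<alpha>) (\<lambda>xs. {..length xs}). tensor T T (tens scale (take i xs)) (tens scale (drop i xs)))"
    by (rule sum.Sigma) auto
  also have "\<dots> = (\<Sum>(\<beta>, ys, zs)\<in>Sigma (below \<alpha>) (\<lambda>\<beta>. ?P \<beta> \<times> ?P (\<alpha> - \<beta>)). tensor T T (tens scale ys) (tens scale zs))"
    by (rule sum.reindex_bij_witness[of _ "\<lambda>(\<beta>, ys, zs). (ys @ zs, length ys)"
          "\<lambda>(xs, i). (mset (take i xs), take i xs, drop i xs)"])
      (auto simp: permutations_of_multiset_def take_sub take_diff)
  also have "\<dots> = (\<Sum>\<beta>\<in>below \<alpha>. \<Sum>(ys, zs)\<in>?P \<beta> \<times> ?P (\<alpha> - \<beta>). tensor T T (tens scale ys) (tens scale zs))"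
    by (rule sum.Sigma[symmetric]) (auto simp: finite_submultisets)
  also have "\<dots> = (\<Sum>\<beta>\<in>below \<alpha>. tensor T T (e \<beta>) (e (\<alpha> - \<beta>)))"
  proof (rule sum.cong[OF refl])
    fix \<beta>
    have "tensor T T (e \<beta>) (e (\<alpha> - \<beta>)) = (\<Sum>ys\<in>?P \<beta>. tensor T T (tens scale ys) (e (\<alpha> - \<beta>)))"
      unfolding dmon_def[of _ \<beta>]
      by (rule vlinear_sum[OF vlinear_tensor_left[OF dmon_in_T] vspace_T tens_in_T])
    also have "\<dots> = (\<Sum>ys\<in>?P \<beta>. \<Sum>zs\<in>?P (\<alpha> - \<beta>). tensor T T (tens scale ys) (tens scale zs))"
      unfolding dmon_def
      by (intro sum.cong refl vlinear_sum[OF vlinear_tensor_right[OF tens_in_T] vspace_T tens_in_T])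
    finally show "(\<Sum>(ys, zs)\<in>?P \<beta> \<times> ?P (\<alpha> - \<beta>). tensor T T (tens scale ys) (tens scale zs)) = tensor T T (e \<beta>) (e (\<alpha> - \<beta>))"
      by (simp add: sum.cartesian_product)
  qed
  finally show ?thesis .
qed

lemma vlinear_id_C_T: "vlinear C T id"
  using C_subset_T by (auto simp: vlinear_def)

text \<open>Eliminates the definite description of the comultiplication of \<open>C\<close>: two
  candidates agree because \<open>C \<otimes> C\<close> injects into
  \<open>T \<otimes> T\<close>.\<close>

lemma comult_C_eq:
  assumes "u \<in> CT C" "tensor_map T T id id u = comult T c"
  shows "comult C c = u"
proof -
  have 1: "tensor (sym_space scale) (sym_space scale) = tensor C C"
    by (rule tensor_cong) (simp_all add: sym_coalgebra_def sym_space_def Let_def)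
  have 2: "tensor_space (sym_space scale) (sym_space scale) = tensor_space C C"
    by (rule tensor_space_cong) (simp_all add: sym_coalgebra_def sym_space_def Let_def)
  have "comult C c = (THE u. u \<in> CT C \<and> tensor_map T T id id u = comult T c)"
    unfolding 2[symmetric] by (simp add: sym_coalgebra_def Let_def)
  also have "\<dots> = u"
  proof (rule the_equality)
    fix u' assume "u' \<in> CT C \<and> tensor_map T T id id u' = comult T c"
    then show "u' = u"
      using tensor_map_inclusion_inj[OF vspace_C C_subset_T _ vspace_T, of u' u] assms by simp
  qed (use assms in simp)
  finally show ?thesis .
qed

lemma MB_submultiset: "\<alpha> \<in> MB \<Longrightarrow> \<beta> \<subseteq># \<alpha> \<Longrightarrow> \<beta> \<in> MB"
  and MB_diff: "\<alpha> \<in> MB \<Longrightarrow> \<alpha> - \<beta> \<in> MB"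
  and MB_add: "\<alpha> \<in> MB \<Longrightarrow> \<beta> \<in> MB \<Longrightarrow> \<alpha> + \<beta> \<in> MB"
  by (blast dest: set_mset_mono) (auto dest: in_diffD)

lemma linear_tensor_map: "flinear (tensor_map V U f g)"
  unfolding tensor_map_def by (rule linear_ev_lift)

lemma comult_summand_in:
  "\<alpha> \<in> MB \<Longrightarrow> \<beta> \<in> below \<alpha> \<Longrightarrow> tensor C C (e \<beta>) (e (\<alpha> - \<beta>)) \<in> CT C"
  by (intro tensor_in dmon_in_C MB_diff) (auto intro: MB_submultiset[unfolded mem_Collect_eq, THEN subsetD])

text \<open>The formula of \<open>comult_T_dmon\<close> involves only elements of \<open>C\<close>,
  so it can be read in \<open>C \<otimes> C\<close>; linear combinations follow.\<close>

lemma comult_exists: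
  assumes "c \<in> vcarrier C"
  shows "\<exists>u\<in>CT C. tensor_map T T id id u = comult T c"
  using assms unfolding vcarrier_C
proof (induction rule: fs.span_induct_alt)
  case base
  show ?case
    by (rule bexI[of _ 0])
      (simp_all only: linear_zeroD[OF linear_tensor_map] linear_zeroD[OF linear_comult_T]
        vsp_zero[OF vspace_tensor])
next
  case (step k x y)
  then obtain \<alpha> u where \<alpha>: "x = e \<alpha>" "\<alpha> \<in> MB" and
    u: "u \<in> CT C" "tensor_map T T id id u = comult T y" by blast
  let ?v = "\<Sum>\<beta>\<in>below \<alpha>. tensor C C (e \<beta>) (e (\<alpha> - \<beta>))"
  have v: "?v \<in> CT C"
    by (rule vsp_sum[OF vspace_tensor comult_summand_in[OF \<alpha>(2)]])
  have "tensor_map T T id id ?v = comult T x"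
    by (simp add: linear_sumD[OF linear_tensor_map] tensor_map_tensor[OF vlinear_id_C_T vlinear_id_C_T]
        comult_T_dmon \<alpha>)
  with u have "tensor_map T T id id (fscale k ?v + u) = comult T (fscale k x + y)"
    unfolding linear_addD[OF linear_tensor_map] linear_scaleD[OF linear_tensor_map]
      linear_addD[OF linear_comult_T] linear_scaleD[OF linear_comult_T] by simp
  moreover have "fscale k ?v + u \<in> CT C"
    using vsp_add[OF vspace_tensor vsp_scale[OF vspace_tensor v, of k] u(1)] by simp
  ultimately show ?case by blast
qed

lemma comult_C_dmon:
  assumes "\<alpha> \<in> MB"
  shows "comult C (e \<alpha>) = (\<Sum>\<beta>\<in>below \<alpha>. tensor C C (e \<beta>) (e (\<alpha> - \<beta>)))"
proof (rule comult_C_eq)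
  show "(\<Sum>\<beta>\<in>below \<alpha>. tensor C C (e \<beta>) (e (\<alpha> - \<beta>))) \<in> CT C"
    by (rule vsp_sum[OF vspace_tensor comult_summand_in[OF assms]])
qed (simp add: linear_sumD[OF linear_tensor_map] tensor_map_tensor[OF vlinear_id_C_T vlinear_id_C_T]
    comult_T_dmon)

text \<open>Linearity descends from \<open>comult T\<close> through the uniqueness in
  \<open>comult_C_eq\<close>.\<close>

lemma vlinear_comult: "vlinear C (tensor_space C C) (comult C)"
proof -
  have *: "comult C c \<in> CT C \<and> tensor_map T T id id (comult C c) = comult T c"
    if "c \<in> vcarrier C" for c
    using comult_exists[OF that] comult_C_eq by metis
  show ?thesis
    unfolding vlinear_def
  proof (intro conjI ballI allI funcsetI)
    fix c d k assume c: "c \<in> vcarrier C" and d: "d \<in> vcarrier C"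
    show "comult C (c + d) = comult C c + comult C d"
      by (rule comult_C_eq)
        (use *[OF c] *[OF d] in \<open>simp_all add: vsp_add[OF vspace_tensor]
          linear_addD[OF linear_tensor_map] linear_addD[OF linear_comult_T]\<close>)
  next
    fix c k assume c: "c \<in> vcarrier C"
    show "comult C (vscale C k c) = vscale (tensor_space C C) k (comult C c)"
      by (rule comult_C_eq)
        (use *[OF c] vsp_scale[OF vspace_tensor, of "comult C c" C C k] in \<open>simp_all add:
          linear_scaleD[OF linear_tensor_map] linear_scaleD[OF linear_comult_T]\<close>)
  qed (use * in auto)
qed

end

lemma vlinear_whole:
  "vlinear V U f \<Longrightarrow> vscale U = fscale \<Longrightarrow> vlinear V \<lparr>vcarrier = UNIV, vscale = fscale\<rparr> f"
  by (auto simp: vlinear_def)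

lemma tensor_assoc_tensor:
  assumes A: "vspace A" and B: "vspace B" and D: "vspace D"
    and mem: "a \<in> vcarrier A" "b \<in> vcarrier B" "d \<in> vcarrier D"
  shows "tensor_assoc A B D (tensor (tensor_space A B) D (tensor A B a b) d) =
    tensor A (tensor_space B D) a (tensor B D b d)"
  unfolding tensor_assoc_def
proof (rule ev_lift_tensor_nested[OF A B D _ _ _ mem])
  fix b d assume "b \<in> vcarrier B" "d \<in> vcarrier D"
  then show "vlinear A \<lparr>vcarrier = UNIV, vscale = fscale\<rparr> (\<lambda>a. tensor A (tensor_space B D) a (tensor B D b d))"
    by (intro vlinear_whole[OF vlinear_tensor_left] tensor_in) auto
next
  fix a d assume "a \<in> vcarrier A" "d \<in> vcarrier D"
  then show "vlinear B \<lparr>vcarrier = UNIV, vscale = fscale\<rparr> (\<lambda>b. tensor A (tensor_space B D) a (tensor B D b d))"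
    by (intro vlinear_whole[OF vlinear_compose[OF vlinear_tensor_left vlinear_tensor_right]]) auto
next
  fix a b assume "a \<in> vcarrier A" "b \<in> vcarrier B"
  then show "vlinear D \<lparr>vcarrier = UNIV, vscale = fscale\<rparr> (\<lambda>d. tensor A (tensor_space B D) a (tensor B D b d))"
    by (intro vlinear_whole[OF vlinear_compose[OF vlinear_tensor_right vlinear_tensor_right]]) auto
qed

lemma size_one_diff:
  assumes "\<beta> \<subseteq># \<alpha>" "size (\<alpha> - \<beta>) = 1"
  shows "\<exists>b\<in>#\<alpha>. \<beta> = \<alpha> - {#b#}"
proof -
  obtain b where b: "\<alpha> - \<beta> = {#b#}" using size_1_singleton_mset[OF assms(2)] by blast
  have "\<alpha> = \<beta> + (\<alpha> - \<beta>)" using subset_mset.add_diff_inverse[OF assms(1)] by (rule sym)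
  then have "\<alpha> = add_mset b \<beta>" unfolding b by simp
  then show ?thesis by auto
qed

lemma diff_diff_single: "b \<in># \<alpha> \<Longrightarrow> \<alpha> - (\<alpha> - {#b#}) = {#b#}"
  by (metis add_diff_cancel_right' add_mset_add_single insert_DiffM2 union_commute)

context based_space begin

abbreviation L where "L n \<equiv> exterior_power scale n"

section \<open>The component of the comultiplication with values in
  \<open>C \<otimes> W\<close>\<close>

lemma linear_degree_part: "flinear (degree_part scale n)"
  by (simp add: degree_part_def linear_ev_lift)

lemma degree_part_dmon: "degree_part scale n (e \<alpha>) = (if size \<alpha> = n then e \<alpha> else 0)"
proof -
  have "degree_part scale n (e \<alpha>) = (\<Sum>xs\<in>perms \<alpha>. if size \<alpha> = n then tens scale xs else 0)"
    unfolding dmon_def linear_sumD[OF linear_degree_part]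
    by (intro sum.cong) (auto simp: degree_part_tens permutations_of_multiset_def)
  then show ?thesis by (simp add: dmon_def)
qed

lemma dmon_single: "e {#b#} = tens scale [b]"
  by (simp add: dmon_def)

lemma dual_ext: "(\<And>b. dual b v = dual b w) \<Longrightarrow> v = w"
proof -
  assume "\<And>b. dual b v = dual b w"
  then have "representation B v = representation B w" by (simp add: dual_def fun_eq_iff)
  moreover have "u \<in> span B" for u by (simp add: span_B)
  ultimately show "v = w"
    using sum_nonzero_representation_eq[OF indep, of v] sum_nonzero_representation_eq[OF indep, of w]
    by metis
qed

lemma tens_single_inj: "tens scale [v] = tens scale [w] \<Longrightarrow> v = w"
proof (rule dual_ext)
  fix b assume "tens scale [v] = tens scale [w]"
  then have "tens scale [v] (word_form [b]) = tens scale [w] (word_form [b])" by simp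
  then show "dual b v = dual b w" by (simp add: tens_multilinear_eval word_form_multilinear)
qed

lemma tens_single_add: "tens scale [v + w] = tens scale [v] + tens scale [w]"
  and tens_single_scale: "tens scale [scale c v] = fscale c (tens scale [v])"
  and tens_single_zero: "tens scale [0] = 0"
  using linear_addD[OF linear_tens[of "[]" "[]"]] linear_scaleD[OF linear_tens[of "[]" "[]"]]
    linear_zeroD[OF linear_tens[of "[]" "[]"]] by simp_all

lemma sym_to_W_eq: "degree_part scale 1 t = tens scale [w] \<Longrightarrow> sym_to_W scale t = w"
  unfolding sym_to_W_def by (rule the_equality) (auto dest: tens_single_inj)

lemma sym_to_W_single: "sym_to_W scale (e {#b#}) = b"
  by (rule sym_to_W_eq) (simp add: dmon_single degree_part_tens)

lemma sym_to_W_other: "size \<alpha> \<noteq> 1 \<Longrightarrow> sym_to_W scale (e \<alpha>) = 0"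
  by (rule sym_to_W_eq) (simp only: degree_part_dmon tens_single_zero if_False)

text \<open>Existence for the definite description \<open>sym_to_W\<close> on \<open>C\<close>: an
  \<open>e \<alpha>\<close> of degree one is a single letter.\<close>

lemma degree_part_1: "t \<in> vcarrier C \<Longrightarrow> degree_part scale 1 t = tens scale [sym_to_W scale t]"
proof -
  assume "t \<in> vcarrier C"
  then have "\<exists>w. degree_part scale 1 t = tens scale [w]"
    unfolding vcarrier_C
  proof (induction rule: fs.span_induct_alt)
    case base
    show ?case unfolding linear_zeroD[OF linear_degree_part] using tens_single_zero by metis
  next
    case (step c x y)
    then obtain \<alpha> w where \<alpha>: "x = e \<alpha>" "degree_part scale 1 y = tens scale [w]" by blast
    have "\<exists>v. degree_part scale 1 x = tens scale [v]"
    proof (cases "size \<alpha> = 1")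
      case True
      then obtain b where "\<alpha> = {#b#}" using size_1_singleton_mset by blast
      then have "degree_part scale 1 x = tens scale [b]"
        unfolding \<alpha>(1) degree_part_dmon by (simp only: size_single simp_thms if_True dmon_single)
      then show ?thesis ..
    next
      case False
      then show ?thesis unfolding \<alpha>(1) degree_part_dmon
        by (simp only: if_False) (rule exI[of _ 0], rule tens_single_zero[symmetric])
    qed
    then obtain v where "degree_part scale 1 x = tens scale [v]" ..
    then have "degree_part scale 1 (fscale c x + y) = tens scale [scale c v + w]"
      unfolding linear_addD[OF linear_degree_part] linear_scaleD[OF linear_degree_part]
      by (simp only: \<alpha>(2) tens_single_add tens_single_scale)
    then show ?case ..
  qed
  then show ?thesis using sym_to_W_eq by metis
qed

lemma vlinear_sym_to_W: "vlinear C W (sym_to_W scale)"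
  unfolding vlinear_def
proof (intro conjI ballI allI funcsetI)
  fix x y assume "x \<in> vcarrier C" "y \<in> vcarrier C"
  then show "sym_to_W scale (x + y) = sym_to_W scale x + sym_to_W scale y"
    by (intro sym_to_W_eq) (simp only: linear_addD[OF linear_degree_part] degree_part_1 tens_single_add)
next
  fix c x assume "x \<in> vcarrier C"
  then show "sym_to_W scale (vscale C c x) = vscale W c (sym_to_W scale x)"
    by (intro sym_to_W_eq)
      (simp only: linear_scaleD[OF linear_degree_part] degree_part_1 tens_single_scale vscale_C vscale_W)
qed simp

lemma vlinear_sym_comult_W: "vlinear C (tensor_space C W) (sym_comult_W scale)"
  unfolding sym_comult_W_def[abs_def] Let_def
  by (intro vlinear_compose[OF vlinear_comult] vlinear_tensor_map vlinear_id vlinear_sym_to_W vspace_C)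

text \<open>\<open>sym_to_W\<close> kills \<open>e (\<alpha> - \<beta>)\<close> unless exactly one
  letter is left over. Each letter of \<open>\<alpha>\<close> contributes once, whatever its
  multiplicity: differentiating divided powers produces no factors.\<close>

lemma sym_comult_W_dmon:
  assumes \<alpha>: "\<alpha> \<in> MB"
  shows "sym_comult_W scale (e \<alpha>) = (\<Sum>b\<in>set_mset \<alpha>. tensor C W (e (\<alpha> - {#b#})) b)"
proof -
  have sub: "e \<beta> \<in> vcarrier C" if "\<beta> \<subseteq># \<alpha>" for \<beta>
    using MB_submultiset[OF \<alpha> that] by (rule dmon_in_C)
  have "sym_comult_W scale (e \<alpha>) = (\<Sum>\<beta>\<in>below \<alpha>. tensor C W (e \<beta>) (sym_to_W scale (e (\<alpha> - \<beta>))))"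
    unfolding sym_comult_W_def Let_def comult_C_dmon[OF \<alpha>] linear_sumD[OF linear_tensor_map]
    by (simp only: tensor_map_tensor[OF vlinear_id(1) vlinear_sym_to_W] id_apply)
  also have "\<dots> = (\<Sum>\<beta>\<in>(\<lambda>b. \<alpha> - {#b#}) ` set_mset \<alpha>. tensor C W (e \<beta>) (sym_to_W scale (e (\<alpha> - \<beta>))))"
  proof (rule sum.mono_neutral_right[OF finite_submultisets], safe)
    fix \<beta> assume \<beta>: "\<beta> \<subseteq># \<alpha>" "\<beta> \<notin> (\<lambda>b. \<alpha> - {#b#}) ` set_mset \<alpha>"
    then have "size (\<alpha> - \<beta>) \<noteq> 1" using size_one_diff by blast
    show "tensor C W (e \<beta>) (sym_to_W scale (e (\<alpha> - \<beta>))) = 0"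
      unfolding sym_to_W_other[OF \<open>size (\<alpha> - \<beta>) \<noteq> 1\<close>]
      by (rule tensor_zero_right[OF sub[OF \<beta>(1)] vspace_W])
  qed auto
  also have "\<dots> = (\<Sum>b\<in>set_mset \<alpha>. tensor C W (e (\<alpha> - {#b#})) (sym_to_W scale (e (\<alpha> - (\<alpha> - {#b#})))))"
  proof (rule sum.reindex_cong[OF _ refl refl])
    show "inj_on (\<lambda>b. \<alpha> - {#b#}) (set_mset \<alpha>)"
    proof (rule inj_onI)
      fix b c assume "b \<in># \<alpha>" "c \<in># \<alpha>" "\<alpha> - {#b#} = \<alpha> - {#c#}"
      then have "{#b#} = {#c#}" using diff_diff_single by metis
      then show "b = c" by simp
    qed
  qed
  also have "\<dots> = (\<Sum>b\<in>set_mset \<alpha>. tensor C W (e (\<alpha> - {#b#})) b)"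
  proof (rule sum.cong[OF refl])
    fix b assume "b \<in># \<alpha>"
    then have "\<alpha> - (\<alpha> - {#b#}) = {#b#}" by (rule diff_diff_single)
    then show "tensor C W (e (\<alpha> - {#b#})) (sym_to_W scale (e (\<alpha> - (\<alpha> - {#b#})))) = tensor C W (e (\<alpha> - {#b#})) b"
      by (simp only: sym_to_W_single)
  qed
  finally show ?thesis .
qed

section \<open>Exterior powers and the Koszul differential on basis elements\<close>

lemma vscale_L [simp]: "vscale (L n) = fscale"
  by (simp add: exterior_power_def)

lemma vcarrier_L: "vcarrier (L n) = fspan {wedge scale xs | xs. length xs = n}"
  by (simp add: exterior_power_def)

lemma vspace_L: "vspace (L n)"
  by (rule vspace_fspan[OF vcarrier_L vscale_L])

lemma wedge_in_L: "length xs = n \<Longrightarrow> wedge scale xs \<in> vcarrier (L n)"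
  unfolding vcarrier_L by (rule fs.span_base) auto

lemma linear_wedge: "wlinear (\<lambda>w. wedge scale (us @ w # vs))"
proof (rule linear_pointwiseI[OF vector_space_axioms])
  fix \<phi> show "Vector_Spaces.linear scale (*) (\<lambda>w. wedge scale (us @ w # vs) \<phi>)"
    by (cases "\<phi> \<in> alternating_forms scale")
      (simp_all add: wedge_def ev_def linear_zero_form, simp add: alternating_forms_def multilinear_forms_def)
qed

lemmas wedge_mult_wedge' = wedge_mult_wedge[OF vector_space_axioms]

lemma linear_wedge_mult: "flinear (wedge_mult scale w)"
  by (simp add: wedge_mult_def linear_ev_lift)

lemma wedge_not_distinct: "\<not> distinct xs \<Longrightarrow> wedge scale xs = 0"
  by (rule ext) (simp add: wedge_def ev_def alternating_forms_def zero_fun_apply)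

lemma L_induct [consumes 1, case_names zero wedge add]:
  assumes "\<omega> \<in> vcarrier (L n)" "P 0" "\<And>c xs. length xs = n \<Longrightarrow> P (fscale c (wedge scale xs))"
    and "\<And>x y. P x \<Longrightarrow> P y \<Longrightarrow> P (x + y)"
  shows "P \<omega>"
  using assms(1)[unfolded vcarrier_L] by (induction rule: fs.span_induct_alt) (use assms in blast)+

lemma wedge_mult_in_L: "\<omega> \<in> vcarrier (L n) \<Longrightarrow> wedge_mult scale w \<omega> \<in> vcarrier (L (Suc n))"
proof (induction rule: L_induct)
  case zero
  show ?case unfolding linear_zeroD[OF linear_wedge_mult] by (rule vsp_zero[OF vspace_L])
next
  case (wedge c xs)
  then show ?case
    unfolding linear_scaleD[OF linear_wedge_mult] wedge_mult_wedge'
    using vsp_scale[OF vspace_L, of _ _ c] by (simp add: wedge_in_L)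
next
  case (add x y)
  then show ?case unfolding linear_addD[OF linear_wedge_mult] by (rule vsp_add[OF vspace_L])
qed

lemma vlinear_wedge_mult: "vlinear (L n) (L (Suc n)) (wedge_mult scale w)"
  by (rule linear_imp_vlinear) (simp_all add: linear_wedge_mult wedge_mult_in_L)

lemma linear_wedge_mult_left:
  assumes "\<omega> \<in> vcarrier (L n)"
  shows "wlinear (\<lambda>w. wedge_mult scale w \<omega>)"
  using assms
proof (induction rule: L_induct)
  case zero
  show ?case unfolding linear_zeroD[OF linear_wedge_mult]
    by (rule linearI[OF vector_space_axioms vector_space_fscale]) simp_all
next
  case (wedge c xs)
  show ?case unfolding linear_scaleD[OF linear_wedge_mult] wedge_mult_wedge'
    by (intro linearI[OF vector_space_axioms vector_space_fscale])
      (simp_all add: linear_addD[OF linear_wedge[of "[]" xs, simplified]]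
        linear_scaleD[OF linear_wedge[of "[]" xs, simplified]] fs.scale_right_distrib mult.commute)
next
  case (add x y)
  show ?case unfolding linear_addD[OF linear_wedge_mult]
    by (intro linearI[OF vector_space_axioms vector_space_fscale])
      (simp_all add: linear_addD[OF add(1)] linear_addD[OF add(2)] linear_scaleD[OF add(1)]
        linear_scaleD[OF add(2)] fs.scale_right_distrib add_ac)
qed

lemma vlinear_wedge_mult_left:
  "\<omega> \<in> vcarrier (L n) \<Longrightarrow> vlinear W (L (Suc n)) (\<lambda>w. wedge_mult scale w \<omega>)"
  by (rule linear_imp_vlinear) (simp_all add: linear_wedge_mult_left wedge_mult_in_L)

lemma linear_koszul_diff: "flinear (koszul_diff scale n)"
proof (cases "n < 0")
  case True
  then show ?thesis unfolding koszul_diff_def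
    by (auto intro!: linearI[OF vector_space_fscale vector_space_fscale])
next
  case False
  then show ?thesis unfolding koszul_diff_def Let_def
    by (simp only: if_False) (rule Vector_Spaces.linear_compose[OF linear_tensor_map linear_ev_lift])
qed

lemma koszul_diff_dmon:
  assumes \<alpha>: "\<alpha> \<in> MB" and \<omega>: "\<omega> \<in> vcarrier (L n)"
  shows "koszul_diff scale (int n) (tensor C (L n) (e \<alpha>) \<omega>) =
    (\<Sum>b\<in>set_mset \<alpha>. tensor C (L (Suc n)) (e (\<alpha> - {#b#})) (wedge_mult scale b \<omega>))"
proof -
  let ?F = "ev_lift (\<lambda>(x, \<omega>). ev_lift (\<lambda>(c, w). tensor C (L (Suc n)) c (wedge_mult scale w \<omega>)) x)"
  have mem: "tensor C W (e (\<alpha> - {#b#})) b \<in> CT W" for b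
    using \<alpha> by (intro tensor_in dmon_in_C MB_diff) simp_all
  have step: "?F (tensor (tensor_space C W) (L n) (tensor C W c w) \<omega>) = tensor C (L (Suc n)) c (wedge_mult scale w \<omega>)"
    if "c \<in> vcarrier C" for c w
    by (rule ev_lift_tensor_nested[OF vspace_C vspace_W vspace_L _ _ _ that _ \<omega>])
      ((intro vlinear_whole[OF vlinear_tensor_left] vlinear_whole[OF vlinear_compose[OF vlinear_wedge_mult_left vlinear_tensor_right]]
        vlinear_whole[OF vlinear_compose[OF vlinear_wedge_mult vlinear_tensor_right]] wedge_mult_in_L;
       simp)+, simp)
  have "koszul_diff scale (int n) (tensor C (L n) (e \<alpha>) \<omega>) =
      ?F (tensor_map (tensor_space C W) (L n) (sym_comult_W scale) id (tensor C (L n) (e \<alpha>) \<omega>))"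
    by (simp add: koszul_diff_def Let_def)
  also have "\<dots> = ?F (tensor (tensor_space C W) (L n) (\<Sum>b\<in>set_mset \<alpha>. tensor C W (e (\<alpha> - {#b#})) b) \<omega>)"
    by (simp only: tensor_map_tensor[OF vlinear_sym_comult_W vlinear_id(1)] sym_comult_W_dmon[OF \<alpha>] id_apply)
  also have "\<dots> = (\<Sum>b\<in>set_mset \<alpha>. ?F (tensor (tensor_space C W) (L n) (tensor C W (e (\<alpha> - {#b#})) b) \<omega>))"
    by (simp only: vlinear_sum[OF vlinear_tensor_left[OF \<omega>] vspace_tensor mem] linear_sumD[OF linear_ev_lift])
  also have "\<dots> = (\<Sum>b\<in>set_mset \<alpha>. tensor C (L (Suc n)) (e (\<alpha> - {#b#})) (wedge_mult scale b \<omega>))"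
    using \<alpha> by (intro sum.cong step dmon_in_C MB_diff) auto
  finally show ?thesis .
qed

end

section \<open>Cofree comodules in coordinates\<close>

context based_space begin

abbreviation cof where "cof \<equiv> cofree_comodule C"

lemma cof_simps [simp]:
  "vcarrier (cof V) = CT V" "vscale (cof V) = fscale"
  by (simp_all add: cofree_comodule_def)

lemma vspace_cof: "vspace (cof V)"
  using vspace_tensor[of C V] by (simp add: vspace_def)

lemma tensor_space_cof: "tensor_space C (cof V) = tensor_space C (tensor_space C V)"
  and tensor_map_cof: "tensor_map C (cof V) = tensor_map C (tensor_space C V)"
  by (intro tensor_space_cong ext tensor_map_cong; simp)+

lemma tensor_C_induct [consumes 2, case_names zero tensor add]:
  assumes "x \<in> CT U" "vspace U" "P 0"
    and "\<And>\<alpha> u. \<alpha> \<in> MB \<Longrightarrow> u \<in> vcarrier U \<Longrightarrow> P (tensor C U (e \<alpha>) u)"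
    and "\<And>x y. \<lbrakk>x \<in> CT U; y \<in> CT U; P x; P y\<rbrakk> \<Longrightarrow> P (x + y)"
  shows "P x"
  using assms(1,2) vcarrier_C vscale_C
  by (rule tensor_span_induct) (use assms(3-) in auto)

text \<open>The coefficient functional of \<open>e \<alpha>\<close> tensored with the identity of
  \<open>U\<close>. By \<open>dmon_word_form\<close> any word with content \<open>\<alpha>\<close>
  may serve.\<close>

definition coord :: "('k, 'u::ab_group_add, 'x) vect_scheme \<Rightarrow> 'w multiset
    \<Rightarrow> (((('w list \<Rightarrow> 'k) \<Rightarrow> 'k) \<times> 'u \<Rightarrow> 'k) \<Rightarrow> 'k) \<Rightarrow> 'u" where
  "coord U \<alpha> = (SOME F. Vector_Spaces.linear fscale (vscale U) F \<and>
     (\<forall>c u. F (tensor C U c u) = vscale U (c (word_form (SOME xs. mset xs = \<alpha>))) u))"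

lemma coord_exists:
  assumes U: "vspace U"
  shows linear_coord: "Vector_Spaces.linear fscale (vscale U) (coord U \<alpha>)"
    and coord_tensor: "coord U \<alpha> (tensor C U c u) = vscale U (c (word_form (SOME xs. mset xs = \<alpha>))) u"
proof -
  interpret U: vector_space "vscale U" using U by (rule vspace_vs)
  let ?h = "\<lambda>c u. vscale U (c (word_form (SOME xs. mset xs = \<alpha>))) u"
  have "\<exists>F. Vector_Spaces.linear fscale (vscale U) F \<and> (\<forall>c u. F (tensor C U c u) = ?h c u)"
    by (rule tensor_universal[OF U.vector_space_axioms])
      (auto simp: vlinear_def U.scale_right_distrib U.scale_left_distrib plus_fun_apply fscale_def mult.commute)
  from someI_ex[OF this, folded coord_def]
  show "Vector_Spaces.linear fscale (vscale U) (coord U \<alpha>)" "coord U \<alpha> (tensor C U c u) = ?h c u"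
    by auto
qed

lemma coord_dmon:
  assumes "vspace U" "\<alpha> \<in> MB" "\<beta> \<in> MB"
  shows "coord U \<beta> (tensor C U (e \<alpha>) u) = (if \<alpha> = \<beta> then u else 0)"
proof -
  interpret U: vector_space "vscale U" using assms(1) by (rule vspace_vs)
  have "mset (SOME xs. mset xs = \<beta>) = \<beta>" by (rule someI_ex) (rule ex_mset)
  then have "e \<alpha> (word_form (SOME xs. mset xs = \<beta>)) = (if \<alpha> = \<beta> then 1 else 0)"
    using dmon_word_form[of "SOME xs. mset xs = \<beta>" \<alpha>] assms by auto
  then show ?thesis by (auto simp: coord_tensor[OF assms(1)])
qed

lemma coord_in:
  assumes "t \<in> CT U" "vspace U" "\<alpha> \<in> MB"
  shows "coord U \<alpha> t \<in> vcarrier U"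
  using assms(1,2)
proof (induction rule: tensor_C_induct)
  case zero
  show ?case unfolding linear_zeroD[OF linear_coord[OF assms(2)]] by (rule vsp_zero[OF assms(2)])
next
  case (tensor \<beta> u)
  then show ?case by (simp only: coord_dmon[OF assms(2) _ assms(3)]) (simp add: vsp_zero[OF assms(2)])
next
  case (add x y)
  show ?case unfolding linear_addD[OF linear_coord[OF assms(2)]] by (rule vsp_add[OF assms(2) add(3,4)])
qed

lemma vlinear_coord: "vspace U \<Longrightarrow> \<alpha> \<in> MB \<Longrightarrow> vlinear (tensor_space C U) U (coord U \<alpha>)"
  by (rule linear_imp_vlinear) (simp_all add: linear_coord coord_in)

text \<open>Admitting every larger finite index set lets two tensors be expanded over the union of
  their supports, as in sums and in \<open>coord_ext\<close>.\<close>

definition coord_support :: "('k, 'u::ab_group_add, 'x) vect_scheme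
    \<Rightarrow> (((('w list \<Rightarrow> 'k) \<Rightarrow> 'k) \<times> 'u \<Rightarrow> 'k) \<Rightarrow> 'k) \<Rightarrow> 'w multiset set \<Rightarrow> bool" where
  "coord_support U t A \<longleftrightarrow> finite A \<and> A \<subseteq> MB \<and>
    (\<forall>A'. finite A' \<longrightarrow> A \<subseteq> A' \<longrightarrow> A' \<subseteq> MB \<longrightarrow> t = (\<Sum>\<alpha>\<in>A'. tensor C U (e \<alpha>) (coord U \<alpha> t)))"

lemma coord_supportI:
  "\<lbrakk>finite A; A \<subseteq> MB;
    \<And>A'. \<lbrakk>finite A'; A \<subseteq> A'; A' \<subseteq> MB\<rbrakk> \<Longrightarrow> (\<Sum>\<alpha>\<in>A'. tensor C U (e \<alpha>) (coord U \<alpha> t)) = t\<rbrakk>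
    \<Longrightarrow> coord_support U t A"
  unfolding coord_support_def by (metis (no_types, lifting))

lemma coord_supportD:
  assumes "coord_support U t A"
  shows "finite A" "A \<subseteq> MB"
    and "\<lbrakk>finite A'; A \<subseteq> A'; A' \<subseteq> MB\<rbrakk> \<Longrightarrow> (\<Sum>\<alpha>\<in>A'. tensor C U (e \<alpha>) (coord U \<alpha> t)) = t"
  using assms unfolding coord_support_def by (blast, blast, metis (no_types, lifting))

lemma coord_support_exists:
  assumes t: "t \<in> CT U" and U: "vspace U"
  shows "\<exists>A. coord_support U t A"
  using t U
proof (induction rule: tensor_C_induct)
  case zero
  have "tensor C U (e \<alpha>) (coord U \<alpha> 0) = 0" if "\<alpha> \<in> MB" for \<alpha>
    unfolding linear_zeroD[OF linear_coord[OF U]] by (rule tensor_zero_right[OF dmon_in_C[OF that] U])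
  then have "coord_support U 0 {}"
    by (intro coord_supportI sum.neutral) blast+
  then show ?case ..
next
  case (tensor \<beta> u)
  have "coord_support U (tensor C U (e \<beta>) u) {\<beta>}"
  proof (rule coord_supportI)
    fix A' :: "'w multiset set" assume A': "finite A'" "{\<beta>} \<subseteq> A'" "A' \<subseteq> MB"
    have "(\<Sum>\<alpha>\<in>A'. tensor C U (e \<alpha>) (coord U \<alpha> (tensor C U (e \<beta>) u))) =
        (\<Sum>\<alpha>\<in>A'. if \<alpha> = \<beta> then tensor C U (e \<alpha>) u else 0)"
    proof (rule sum.cong[OF refl])
      fix \<alpha> assume "\<alpha> \<in> A'"
      then have \<alpha>: "\<alpha> \<in> MB" using A' by blast
      show "tensor C U (e \<alpha>) (coord U \<alpha> (tensor C U (e \<beta>) u)) = (if \<alpha> = \<beta> then tensor C U (e \<alpha>) u else 0)"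
        unfolding coord_dmon[OF U tensor(1) \<alpha>]
        using tensor_zero_right[OF dmon_in_C[OF \<alpha>] U] by auto
    qed
    also have "\<dots> = (if \<beta> \<in> A' then tensor C U (e \<beta>) u else 0)" by (rule sum.delta[OF A'(1)])
    also have "\<dots> = tensor C U (e \<beta>) u" using A'(2) by simp
    finally show "(\<Sum>\<alpha>\<in>A'. tensor C U (e \<alpha>) (coord U \<alpha> (tensor C U (e \<beta>) u))) = tensor C U (e \<beta>) u" .
  qed (use tensor(1) in simp_all)
  then show ?case ..
next
  case (add x y)
  obtain A1 A2 where A: "coord_support U x A1" "coord_support U y A2"
    using add(3,4) by (elim exE)
  have "coord_support U (x + y) (A1 \<union> A2)"
  proof (rule coord_supportI)
    fix A' :: "'w multiset set" assume A': "finite A'" "A1 \<union> A2 \<subseteq> A'" "A' \<subseteq> MB"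
    have "(\<Sum>\<alpha>\<in>A'. tensor C U (e \<alpha>) (coord U \<alpha> (x + y))) =
        (\<Sum>\<alpha>\<in>A'. tensor C U (e \<alpha>) (coord U \<alpha> x) + tensor C U (e \<alpha>) (coord U \<alpha> y))"
    proof (rule sum.cong[OF refl])
      fix \<alpha> assume "\<alpha> \<in> A'"
      then have \<alpha>: "\<alpha> \<in> MB" using A' by blast
      show "tensor C U (e \<alpha>) (coord U \<alpha> (x + y)) = tensor C U (e \<alpha>) (coord U \<alpha> x) + tensor C U (e \<alpha>) (coord U \<alpha> y)"
        unfolding linear_addD[OF linear_coord[OF U]]
        by (rule tensor_add_right[OF dmon_in_C[OF \<alpha>] coord_in[OF add(1) U \<alpha>] coord_in[OF add(2) U \<alpha>]])
    qed
    also have "\<dots> = x + y"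
      unfolding sum.distrib using A' by (simp only: coord_supportD(3)[OF A(1)] coord_supportD(3)[OF A(2)] Un_subset_iff)
    finally show "(\<Sum>\<alpha>\<in>A'. tensor C U (e \<alpha>) (coord U \<alpha> (x + y))) = x + y" .
  qed (use coord_supportD[OF A(1)] coord_supportD[OF A(2)] in simp_all)
  then show ?case ..
qed

lemma coord_ext:
  assumes t: "t \<in> CT U" "t' \<in> CT U" and U: "vspace U"
    and eq: "\<And>\<alpha>. \<alpha> \<in> MB \<Longrightarrow> coord U \<alpha> t = coord U \<alpha> t'"
  shows "t = t'"
proof -
  obtain A1 A2 where A: "coord_support U t A1" "coord_support U t' A2"
    using coord_support_exists[OF t(1) U] coord_support_exists[OF t(2) U] by (elim exE)
  note A1 = coord_supportD[OF A(1)] and A2 = coord_supportD[OF A(2)]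
  have fin: "finite (A1 \<union> A2)" "A1 \<union> A2 \<subseteq> MB" using A1(1,2) A2(1,2) by blast+
  have "t = (\<Sum>\<alpha>\<in>A1 \<union> A2. tensor C U (e \<alpha>) (coord U \<alpha> t))"
    by (rule A1(3)[OF fin(1) Un_upper1 fin(2), symmetric])
  also have "\<dots> = (\<Sum>\<alpha>\<in>A1 \<union> A2. tensor C U (e \<alpha>) (coord U \<alpha> t'))"
    using fin(2) by (intro sum.cong refl arg_cong[of _ _ "tensor C U _"] eq) blast
  also have "\<dots> = t'" by (rule A2(3)[OF fin(1) Un_upper2 fin(2)])
  finally show ?thesis .
qed

section \<open>The coaction in coordinates\<close>

lemma linear_coact: "flinear (coact (cof V))"
  using Vector_Spaces.linear_compose[OF linear_tensor_map[of "tensor_space C C" V "comult C" id]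
      linear_ev_lift[of "\<lambda>(x, c). ev_lift (\<lambda>(a, b). tensor C (tensor_space C V) a (tensor C V b c)) x"]]
  by (simp add: cofree_comodule_def tensor_assoc_def o_def)

lemma coact_dmon:
  assumes \<alpha>: "\<alpha> \<in> MB" and v: "v \<in> vcarrier V" and V: "vspace V"
  shows "coact (cof V) (tensor C V (e \<alpha>) v) =
    (\<Sum>\<beta>\<in>below \<alpha>. tensor C (tensor_space C V) (e \<beta>) (tensor C V (e (\<alpha> - \<beta>)) v))"
proof -
  have lin: "flinear (tensor_assoc C C V)"
    unfolding tensor_assoc_def by (rule linear_ev_lift)
  have "coact (cof V) (tensor C V (e \<alpha>) v) =
      tensor_assoc C C V (tensor (tensor_space C C) V (comult C (e \<alpha>)) v)"
    by (simp add: cofree_comodule_def) (simp only: tensor_map_tensor[OF vlinear_comult vlinear_id(1)] id_apply)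
  also have "\<dots> = tensor_assoc C C V (\<Sum>\<beta>\<in>below \<alpha>. tensor (tensor_space C C) V (tensor C C (e \<beta>) (e (\<alpha> - \<beta>))) v)"
    unfolding comult_C_dmon[OF \<alpha>]
    by (simp only: vlinear_sum[OF vlinear_tensor_left[OF v] vspace_tensor comult_summand_in[OF \<alpha>]])
  also have "\<dots> = (\<Sum>\<beta>\<in>below \<alpha>. tensor C (tensor_space C V) (e \<beta>) (tensor C V (e (\<alpha> - \<beta>)) v))"
    unfolding linear_sumD[OF lin]
  proof (rule sum.cong[OF refl])
    fix \<beta> assume "\<beta> \<in> below \<alpha>"
    then have "e \<beta> \<in> vcarrier C" "e (\<alpha> - \<beta>) \<in> vcarrier C"
      using \<alpha> MB_submultiset[OF \<alpha>, of \<beta>] MB_diff[OF \<alpha>, of \<beta>] by (auto intro: dmon_in_C)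
    from tensor_assoc_tensor[OF vspace_C vspace_C V this v]
    show "tensor_assoc C C V (tensor (tensor_space C C) V (tensor C C (e \<beta>) (e (\<alpha> - \<beta>))) v) =
      tensor C (tensor_space C V) (e \<beta>) (tensor C V (e (\<alpha> - \<beta>)) v)" .
  qed
  finally show ?thesis .
qed

lemma coact_in:
  assumes "t \<in> CT V" "vspace V"
  shows "coact (cof V) t \<in> CT (tensor_space C V)"
  using assms
proof (induction rule: tensor_C_induct)
  case zero
  show ?case unfolding linear_zeroD[OF linear_coact] by (rule vsp_zero[OF vspace_tensor])
next
  case (tensor \<alpha> v)
  have "tensor C (tensor_space C V) (e \<beta>) (tensor C V (e (\<alpha> - \<beta>)) v) \<in> CT (tensor_space C V)"
    if "\<beta> \<in> below \<alpha>" for \<beta>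
    using that MB_submultiset[OF tensor(1), of \<beta>] MB_diff[OF tensor(1), of \<beta>]
    by (intro tensor_in dmon_in_C tensor(2)) auto
  then show ?case unfolding coact_dmon[OF tensor assms(2)]
    by (rule vsp_sum[OF vspace_tensor])
next
  case (add x y)
  show ?case unfolding linear_addD[OF linear_coact] by (rule vsp_add[OF vspace_tensor add(3,4)])
qed

text \<open>The action on \<open>C \<otimes> V\<close> of the functional on \<open>C\<close> dual to
  \<open>e \<beta>\<close>. On basis elements it removes \<open>\<beta>\<close> from the index, see
  \<open>shift_dmon\<close>.\<close>

definition shift :: "('k, 'u::ab_group_add, 'x) vect_scheme \<Rightarrow> 'w multiset
    \<Rightarrow> (((('w list \<Rightarrow> 'k) \<Rightarrow> 'k) \<times> 'u \<Rightarrow> 'k) \<Rightarrow> 'k) \<Rightarrow> (((('w list \<Rightarrow> 'k) \<Rightarrow> 'k) \<times> 'u \<Rightarrow> 'k) \<Rightarrow> 'k)" where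
  "shift V \<beta> t = coord (tensor_space C V) \<beta> (coact (cof V) t)"

lemma linear_shift: "flinear (shift V \<beta>)"
  using Vector_Spaces.linear_compose[OF linear_coact linear_coord[OF vspace_tensor[of C V], of \<beta>, simplified]]
  by (simp add: shift_def[abs_def] o_def)

lemma shift_dmon:
  assumes \<alpha>: "\<alpha> \<in> MB" and \<beta>: "\<beta> \<in> MB" and v: "v \<in> vcarrier V" and V: "vspace V"
  shows "shift V \<beta> (tensor C V (e \<alpha>) v) = (if \<beta> \<subseteq># \<alpha> then tensor C V (e (\<alpha> - \<beta>)) v else 0)"
proof -
  have "shift V \<beta> (tensor C V (e \<alpha>) v) =
      (\<Sum>\<gamma>\<in>below \<alpha>. coord (tensor_space C V) \<beta> (tensor C (tensor_space C V) (e \<gamma>) (tensor C V (e (\<alpha> - \<gamma>)) v)))"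
    unfolding shift_def coact_dmon[OF \<alpha> v V] linear_sumD[OF linear_coord[OF vspace_tensor]] ..
  also have "\<dots> = (\<Sum>\<gamma>\<in>below \<alpha>. if \<gamma> = \<beta> then tensor C V (e (\<alpha> - \<gamma>)) v else 0)"
    using MB_submultiset[OF \<alpha>] \<beta>
    by (intro sum.cong refl coord_dmon[OF vspace_tensor]) auto
  also have "\<dots> = (if \<beta> \<in> below \<alpha> then tensor C V (e (\<alpha> - \<beta>)) v else 0)"
    by (rule sum.delta[OF finite_submultisets])
  finally show ?thesis by simp
qed

lemma shift_in:
  "t \<in> CT V \<Longrightarrow> vspace V \<Longrightarrow> \<beta> \<in> MB \<Longrightarrow> shift V \<beta> t \<in> CT V"
  unfolding shift_def by (intro coord_in coact_in vspace_tensor)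

text \<open>Removing \<open>\<beta>\<close> from \<open>\<alpha>\<close> leaves
  \<open>\<gamma>\<close> exactly if \<open>\<alpha> = \<beta> + \<gamma>\<close>. With
  \<open>\<gamma> = {#}\<close> every coordinate becomes the empty coordinate of a shift.\<close>

lemma coord_shift:
  assumes "t \<in> CT V" and V: "vspace V" and \<beta>: "\<beta> \<in> MB" and \<gamma>: "\<gamma> \<in> MB"
  shows "coord V \<gamma> (shift V \<beta> t) = coord V (\<beta> + \<gamma>) t"
  using assms(1,2)
proof (induction rule: tensor_C_induct)
  case zero
  show ?case unfolding linear_zeroD[OF linear_shift] linear_zeroD[OF linear_coord[OF V]] ..
next
  case (tensor \<alpha> v)
  show ?case
  proof (cases "\<beta> \<subseteq># \<alpha>")
    case True
    then have "\<alpha> - \<beta> = \<gamma> \<longleftrightarrow> \<alpha> = \<beta> + \<gamma>" by auto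
    with True show ?thesis
      unfolding shift_dmon[OF tensor(1) \<beta> tensor(2) V]
      by (simp only: if_True coord_dmon[OF V MB_diff[OF tensor(1)] \<gamma>]
          coord_dmon[OF V tensor(1) MB_add[OF \<beta> \<gamma>]])
  next
    case False
    then have "\<alpha> \<noteq> \<beta> + \<gamma>" by auto
    with False show ?thesis
      unfolding shift_dmon[OF tensor(1) \<beta> tensor(2) V]
      by (simp only: if_False linear_zeroD[OF linear_coord[OF V]]
          coord_dmon[OF V tensor(1) MB_add[OF \<beta> \<gamma>]])
  qed
next
  case (add x y)
  then show ?case unfolding linear_addD[OF linear_shift] linear_addD[OF linear_coord[OF V]] by simp
qed

text \<open>Both sides of the comodule identity lie in \<open>C \<otimes> (C \<otimes> V)\<close>.
  Comparing their \<open>e \<beta>\<close> coordinates turns it into commutation with the shifts,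
  which removes iterated tensor products from the later arguments.\<close>

lemma comodule_hom_cof_iff:
  assumes U: "vspace U" and V: "vspace V"
  shows "f \<in> comodule_hom C (cof U) (cof V) \<longleftrightarrow>
    f \<in> extensional (CT U) \<and> vlinear (cof U) (cof V) f \<and>
    (\<forall>t\<in>CT U. \<forall>\<beta>\<in>MB. f (shift U \<beta> t) = shift V \<beta> (f t))"
proof -
  have "tensor_map C (cof V) id f (coact (cof U) t) = coact (cof V) (f t) \<longleftrightarrow>
      (\<forall>\<beta>\<in>MB. f (shift U \<beta> t) = shift V \<beta> (f t))"
    if f: "vlinear (cof U) (cof V) f" and t: "t \<in> CT U" for t
  proof -
    have ft: "f t \<in> CT V" using vlinear_closed[OF f] t by simp
    have f': "vlinear (tensor_space C U) (tensor_space C V) f" using f by (simp add: vlinear_def)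
    let ?M = "tensor_map C (tensor_space C V) id f"
    have M: "vlinear (tensor_space C (tensor_space C U)) (tensor_space C (tensor_space C V)) ?M"
      by (intro vlinear_tensor_map vlinear_id f' vspace_tensor vspace_C)
    have c: "coord (tensor_space C V) \<beta> (?M x) = f (coord (tensor_space C U) \<beta> x)"
      if "x \<in> CT (tensor_space C U)" and \<beta>: "\<beta> \<in> MB" for x \<beta>
      using that(1) vspace_tensor[of C U]
    proof (induction rule: tensor_C_induct)
      case zero
      show ?case unfolding linear_zeroD[OF linear_tensor_map] linear_zeroD[OF linear_coord[OF vspace_tensor]]
        by (rule vlinear_zero[OF f' vspace_tensor, symmetric])
    next
      case (tensor \<alpha> u)
      show ?case
        unfolding tensor_map_tensor[OF vlinear_id(1) f']
          coord_dmon[OF vspace_tensor tensor(1) \<beta>]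
        using vlinear_zero[OF f' vspace_tensor]
        by (simp add: coord_dmon[OF vspace_tensor tensor(1) \<beta>, simplified])
    next
      case (add x y)
      show ?case unfolding linear_addD[OF linear_tensor_map] linear_addD[OF linear_coord[OF vspace_tensor]]
        by (simp only: add(3,4) vlinear_add[OF f' coord_in[OF add(1) vspace_tensor \<beta>]
              coord_in[OF add(2) vspace_tensor \<beta>]])
    qed
    note ct = coact_in[OF t U]
    have "tensor_map C (cof V) id f (coact (cof U) t) = coact (cof V) (f t) \<longleftrightarrow>
        (\<forall>\<beta>\<in>MB. coord (tensor_space C V) \<beta> (?M (coact (cof U) t)) = coord (tensor_space C V) \<beta> (coact (cof V) (f t)))"
      unfolding tensor_map_cof
      using coord_ext[OF vlinear_closed[OF M ct] coact_in[OF ft V] vspace_tensor] by auto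
    also have "\<dots> \<longleftrightarrow> (\<forall>\<beta>\<in>MB. f (shift U \<beta> t) = shift V \<beta> (f t))"
      unfolding shift_def by (intro ball_cong refl) (simp only: c[OF ct])
    finally show ?thesis .
  qed
  then show ?thesis unfolding comodule_hom_def by auto
qed

end

section \<open>Exterior contraction\<close>

context based_space begin

lemma wedge_mult_twice:
  assumes "\<omega> \<in> vcarrier (L n)"
  shows "wedge_mult scale w (wedge_mult scale w \<omega>) = 0"
  using assms
proof (induction rule: L_induct)
  case zero
  show ?case by (simp only: linear_zeroD[OF linear_wedge_mult])
next
  case (wedge c xs)
  have "wedge scale (w # w # xs) = 0" by (rule wedge_not_distinct) simp
  then show ?case
    by (simp only: linear_scaleD[OF linear_wedge_mult] wedge_mult_wedge' fs.scale_zero_right)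
next
  case (add x y)
  then show ?case by (simp only: linear_addD[OF linear_wedge_mult] add_0_left)
qed

text \<open>Polarisation of \<open>wedge_mult_twice\<close> at \<open>u + w\<close>.\<close>

lemma wedge_mult_anticommute:
  assumes \<omega>: "\<omega> \<in> vcarrier (L n)"
  shows "wedge_mult scale u (wedge_mult scale w \<omega>) = - wedge_mult scale w (wedge_mult scale u \<omega>)"
proof -
  note l1 = linear_addD[OF linear_wedge_mult] and l2 = linear_addD[OF linear_wedge_mult_left[OF \<omega>]]
    and l3 = linear_addD[OF linear_wedge_mult_left[OF wedge_mult_in_L[OF \<omega>]]]
  have "0 = wedge_mult scale (u + w) (wedge_mult scale (u + w) \<omega>)"
    by (rule wedge_mult_twice[OF \<omega>, symmetric])
  also have "\<dots> = wedge_mult scale u (wedge_mult scale w \<omega>) + wedge_mult scale w (wedge_mult scale u \<omega>)"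
    unfolding l3[of u w "u + w"] unfolding l2 l1 wedge_mult_twice[OF \<omega>] by (simp only: add_0_left add_0_right)
  finally show ?thesis by (simp only: eq_neg_iff_add_eq_0)
qed

text \<open>Interior product with the coordinate form \<open>dual b\<close>, written through the
  antiderivation rule so that the alternating signs stay implicit.\<close>

fun contraction_word :: "'w \<Rightarrow> 'w list \<Rightarrow> (('w list \<Rightarrow> 'k) \<Rightarrow> 'k)" where
  "contraction_word b [] = 0"
| "contraction_word b (w # ws) = fscale (dual b w) (wedge scale ws) - wedge_mult scale w (contraction_word b ws)"

lemma L_scale: "x \<in> vcarrier (L n) \<Longrightarrow> fscale c x \<in> vcarrier (L n)"
  using vsp_scale[OF vspace_L, of x n c] by simp

lemma contraction_word_in_L: "contraction_word b xs \<in> vcarrier (L (length xs - 1))"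
proof (induction xs)
  case Nil
  show ?case unfolding contraction_word.simps by (rule vsp_zero[OF vspace_L])
next
  case (Cons x xs)
  have "wedge_mult scale x (contraction_word b xs) \<in> vcarrier (L (length xs))"
  \<comment> \<open>The truncated \<open>length xs - 1\<close> is the true degree only for nonempty
    words; for the empty word the contraction is zero, which lies in every degree.\<close>
  proof (cases xs)
    case Nil
    show ?thesis unfolding Nil contraction_word.simps linear_zeroD[OF linear_wedge_mult]
      by (rule vsp_zero[OF vspace_L])
  next
    case (Cons y ys)
    with wedge_mult_in_L[OF Cons.IH, of x] show ?thesis by simp
  qed
  then have "contraction_word b (x # xs) \<in> vcarrier (L (length xs))"
    unfolding contraction_word.simps by (intro vsp_diff[OF vspace_L] L_scale wedge_in_L refl)
  then show ?case by simp
qed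

lemma linear_minus_map:
  assumes "wlinear f" "wlinear g"
  shows "wlinear (\<lambda>w. f w - g w)"
  by (rule linearI[OF vector_space_axioms vector_space_fscale])
    (simp_all add: linear_addD[OF assms(1)] linear_addD[OF assms(2)] linear_scaleD[OF assms(1)]
      linear_scaleD[OF assms(2)] fs.scale_right_diff_distrib)

lemma linear_contraction_word: "wlinear (\<lambda>w. contraction_word b (us @ w # vs))"
proof (induction us)
  case Nil
  have "wlinear (\<lambda>w. fscale (dual b w) (wedge scale vs))"
    by (rule linearI[OF vector_space_axioms vector_space_fscale])
      (simp_all add: linear_addD[OF linear_dual] linear_scaleD[OF linear_dual] fs.scale_left_distrib)
  then show ?case
    using linear_minus_map[OF _ linear_wedge_mult_left[OF contraction_word_in_L]] by simp
next
  case (Cons u us)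
  have "wlinear (\<lambda>w. fscale (dual b u) (wedge scale (us @ w # vs)))"
    by (rule linearI[OF vector_space_axioms vector_space_fscale])
      (simp_all add: linear_addD[OF linear_wedge] linear_scaleD[OF linear_wedge] fs.scale_right_distrib mult.commute)
  then show ?case
    using linear_minus_map[OF _ Vector_Spaces.linear_compose[OF Cons.IH linear_wedge_mult]]
    by (simp add: o_def)
qed

text \<open>The antiderivation rule applied to \<open>wedge scale (w # ws) = 0\<close>. As the
  contraction is not yet known to be well defined on wedges, this is proved on words; it then yields
  the vanishing on repeated letters that well-definedness requires.\<close>

lemma wedge_mult_contraction_word:
  "w \<in> set ws \<Longrightarrow> wedge_mult scale w (contraction_word b ws) = fscale (dual b w) (wedge scale ws)"
proof (induction ws)
  case (Cons u ws)
  note mem = contraction_word_in_L[of b ws]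
  have lin: "wedge_mult scale w (contraction_word b (u # ws)) = fscale (dual b u) (wedge scale (w # ws))
      - wedge_mult scale w (wedge_mult scale u (contraction_word b ws))"
  proof -
    have "wedge_mult scale w (x - y) = wedge_mult scale w x - wedge_mult scale w y" for x y
      using linear_addD[OF linear_wedge_mult, of w "x - y" y] by (simp only: diff_add_cancel eq_diff_eq)
    then show ?thesis by (simp only: contraction_word.simps linear_scaleD[OF linear_wedge_mult] wedge_mult_wedge')
  qed
  show ?case
  proof (cases "w = u")
    case True
    then show ?thesis unfolding lin by (simp only: wedge_mult_twice[OF mem] diff_0_right)
  next
    case False
    then have w: "w \<in> set ws" using Cons.prems by simp
    have "wedge scale (w # ws) = 0" using w by (intro wedge_not_distinct) simp
    moreover have "wedge_mult scale w (wedge_mult scale u (contraction_word b ws)) = - fscale (dual b w) (wedge scale (u # ws))"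
      unfolding wedge_mult_anticommute[OF mem, of w u] Cons.IH[OF w] linear_scaleD[OF linear_wedge_mult] wedge_mult_wedge' ..
    ultimately show ?thesis unfolding lin by (simp only: fs.scale_zero_right diff_minus_eq_add add_0_left)
  qed
qed simp

lemma contraction_word_not_distinct: "\<not> distinct ws \<Longrightarrow> contraction_word b ws = 0"
proof (induction ws)
  case (Cons w ws)
  show ?case
  proof (cases "w \<in> set ws")
    case True
    then show ?thesis by (simp only: contraction_word.simps wedge_mult_contraction_word diff_self)
  next
    case False
    then have "\<not> distinct ws" using Cons.prems by simp
    then show ?thesis
      by (simp only: contraction_word.simps Cons.IH[OF \<open>\<not> distinct ws\<close>] linear_zeroD[OF linear_wedge_mult]
          wedge_not_distinct[OF \<open>\<not> distinct ws\<close>] fs.scale_zero_right diff_self)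
  qed
qed simp

definition contraction :: "'w \<Rightarrow> (('w list \<Rightarrow> 'k) \<Rightarrow> 'k) \<Rightarrow> (('w list \<Rightarrow> 'k) \<Rightarrow> 'k)" where
  "contraction b = (SOME F. Vector_Spaces.linear fscale fscale F \<and> (\<forall>xs. F (wedge scale xs) = contraction_word b xs))"

lemma contraction_exists:
  shows linear_contraction: "flinear (contraction b)"
    and contraction_wedge: "contraction b (wedge scale xs) = contraction_word b xs"
  using someI_ex[OF wedge_universal[OF vector_space_fscale linear_contraction_word contraction_word_not_distinct],
      folded contraction_def] by auto

lemma contraction_in_L: "\<omega> \<in> vcarrier (L (Suc n)) \<Longrightarrow> contraction b \<omega> \<in> vcarrier (L n)"
proof (induction rule: L_induct)
  case zero
  show ?case unfolding linear_zeroD[OF linear_contraction] by (rule vsp_zero[OF vspace_L])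
next
  case (wedge c xs)
  then show ?case unfolding linear_scaleD[OF linear_contraction] contraction_wedge
    using L_scale[OF contraction_word_in_L, of c b xs] by simp
next
  case (add x y)
  then show ?case unfolding linear_addD[OF linear_contraction] by (rule vsp_add[OF vspace_L])
qed

lemma contraction_L0: "\<omega> \<in> vcarrier (L 0) \<Longrightarrow> contraction b \<omega> = 0"
proof (induction rule: L_induct)
  case zero
  show ?case by (rule linear_zeroD[OF linear_contraction])
next
  case (wedge c xs)
  then have "xs = []" by simp
  then show ?case unfolding linear_scaleD[OF linear_contraction] contraction_wedge
    by (simp only: contraction_word.simps fs.scale_zero_right)
next
  case (add x y)
  then show ?case by (simp only: linear_addD[OF linear_contraction] add_0_left)
qed

lemma contraction_wedge_mult:
  assumes "\<omega> \<in> vcarrier (L n)"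
  shows "contraction b (wedge_mult scale w \<omega>) = fscale (dual b w) \<omega> - wedge_mult scale w (contraction b \<omega>)"
  using assms
proof (induction rule: L_induct)
  case zero
  show ?case by (simp only: linear_zeroD[OF linear_contraction] linear_zeroD[OF linear_wedge_mult] fs.scale_zero_right diff_self)
next
  case (wedge c xs)
  show ?case
    by (simp only: linear_scaleD[OF linear_contraction] linear_scaleD[OF linear_wedge_mult] wedge_mult_wedge'
        contraction_wedge contraction_word.simps fs.scale_right_diff_distrib)
      (simp only: fs.scale_scale mult.commute)
next
  case (add x y)
  show ?case
    by (simp only: linear_addD[OF linear_contraction] linear_addD[OF linear_wedge_mult] add
        fs.scale_right_distrib) (simp only: add_diff_add)
qed

text \<open>For \<open>b\<close> in \<open>B\<close>, the projection onto the multiples of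
  \<open>b\<close> along the wedges of the other basis vectors, see
  \<open>projection_wedge\<close>.\<close>

definition projection :: "'w \<Rightarrow> (('w list \<Rightarrow> 'k) \<Rightarrow> 'k) \<Rightarrow> (('w list \<Rightarrow> 'k) \<Rightarrow> 'k)" where
  "projection b \<omega> = wedge_mult scale b (contraction b \<omega>)"

lemma linear_projection': "flinear (projection b)"
  using Vector_Spaces.linear_compose[OF linear_contraction linear_wedge_mult]
  by (simp add: projection_def[abs_def] o_def)

lemma projection_in_L: "\<omega> \<in> vcarrier (L n) \<Longrightarrow> projection b \<omega> \<in> vcarrier (L n)"
proof (cases n)
  case 0
  assume "\<omega> \<in> vcarrier (L n)"
  then have "projection b \<omega> = 0"
    unfolding projection_def 0 by (simp only: contraction_L0 linear_zeroD[OF linear_wedge_mult])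
  then show ?thesis by (simp only: vsp_zero[OF vspace_L])
next
  case (Suc m)
  assume "\<omega> \<in> vcarrier (L n)"
  then show ?thesis unfolding projection_def Suc by (intro wedge_mult_in_L contraction_in_L)
qed

text \<open>If the first letter is not \<open>b\<close>, then \<open>b\<close> is moved past it, and
  the sign of this exchange cancels the sign of the contraction.\<close>

lemma projection_wedge:
  assumes "b \<in> B" "xs \<in> lists B"
  shows "projection b (wedge scale xs) = (if b \<in> set xs then wedge scale xs else 0)"
  using assms(2)
proof (induction xs)
  case Nil
  show ?case unfolding projection_def contraction_wedge contraction_word.simps linear_zeroD[OF linear_wedge_mult] by simp
next
  case (Cons x xs)
  have lin: "wedge_mult scale w (y - z) = wedge_mult scale w y - wedge_mult scale w z" for w y z
    using linear_addD[OF linear_wedge_mult, of w "y - z" z] by (simp only: diff_add_cancel eq_diff_eq)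
  have *: "projection b (wedge scale (x # xs)) = fscale (dual b x) (wedge scale (b # xs))
      - wedge_mult scale b (wedge_mult scale x (contraction_word b xs))"
    by (simp only: projection_def contraction_wedge contraction_word.simps lin linear_scaleD[OF linear_wedge_mult] wedge_mult_wedge')
  show ?case
  proof (cases "x = b")
    case True
    then show ?thesis unfolding *
      using dual_basis[OF assms(1) assms(1)] wedge_mult_twice[OF contraction_word_in_L, of b b xs] by simp
  next
    case False
    have "wedge_mult scale b (wedge_mult scale x (contraction_word b xs)) = - wedge_mult scale x (projection b (wedge scale xs))"
      unfolding projection_def contraction_wedge by (rule wedge_mult_anticommute[OF contraction_word_in_L])
    moreover have "dual b x = 0" using dual_basis[OF assms(1), of x] Cons False by auto
    ultimately show ?thesis
      unfolding * Cons.IH using False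
      by (simp add: wedge_mult_wedge' linear_zeroD[OF linear_wedge_mult])
  qed
qed

lemma L_basis: "vcarrier (L n) = fspan (wedge scale ` {xs \<in> lists B. length xs = n})"
proof
  have "wedge scale xs \<in> fspan (wedge scale ` {ys \<in> lists B. length ys = length xs})" for xs
    using multilinear_in_span[OF vector_space_fscale linear_wedge, of "[]" xs] by simp
  then show "vcarrier (L n) \<subseteq> fspan (wedge scale ` {xs \<in> lists B. length xs = n})"
    unfolding vcarrier_L by (intro fs.span_minimal) auto
  show "fspan (wedge scale ` {xs \<in> lists B. length xs = n}) \<subseteq> vcarrier (L n)"
    unfolding vcarrier_L by (rule fs.span_mono) auto
qed

text \<open>The composite keeps only the basis words that contain all of \<open>bs\<close>, and a
  word of length \<open>n\<close> has at most \<open>n\<close> different letters.\<close>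

lemma foldr_projection_zero:
  assumes "set bs \<subseteq> B" "distinct bs" "n < length bs" "\<omega> \<in> vcarrier (L n)"
  shows "foldr projection bs \<omega> = 0"
proof -
  have lin: "flinear (foldr projection bs)" for bs
  proof (induction bs)
    case Nil
    show ?case by (rule linearI[OF vector_space_fscale vector_space_fscale]) (simp_all only: foldr.simps id_apply)
  next
    case (Cons b bs)
    show ?case unfolding foldr.simps by (rule Vector_Spaces.linear_compose[OF Cons linear_projection'])
  qed
  have wedge: "foldr projection bs (wedge scale xs) = (if set bs \<subseteq> set xs then wedge scale xs else 0)"
    if "xs \<in> lists B" for xs
    using assms(1)
  proof (induction bs)
    case (Cons b bs)
    then show ?case
      using projection_wedge[of b xs] linear_zeroD[OF linear_projection', of b] that by auto
  qed simp
  have zero: "foldr projection bs (wedge scale xs) = 0" if "xs \<in> lists B" "length xs = n" for xs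
  proof -
    have "\<not> set bs \<subseteq> set xs"
      using card_mono[of "set xs" "set bs"] distinct_card[OF assms(2)] card_length[of xs] assms(3) that(2) by auto
    then show ?thesis using wedge[OF that(1)] by simp
  qed
  from assms(4)[unfolded L_basis] show ?thesis
  proof (induction rule: fs.span_induct_alt)
    case base
    show ?case by (rule linear_zeroD[OF lin])
  next
    case (step c x y)
    then have "foldr projection bs x = 0" using zero by blast
    with step(2) show ?case
      unfolding linear_addD[OF lin] linear_scaleD[OF lin] by (simp only: fs.scale_zero_right add_0_left)
  qed
qed

end

section \<open>Exactness of the Koszul complex of families\<close>

text \<open>Adding an index cancels its row against its column. The diagonal is assumed zero
  separately, since antisymmetry only gives \<open>g c c + g c c = 0\<close>, which is no
  information in characteristic 2.\<close>

lemma sum_antisymmetric: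
  fixes g :: "'c \<Rightarrow> 'c \<Rightarrow> 'z::ab_group_add"
  assumes "finite A" and diag: "\<forall>c\<in>A. g c c = 0" and anti: "\<forall>c\<in>A. \<forall>d\<in>A. g c d = - g d c"
  shows "(\<Sum>c\<in>A. \<Sum>d\<in>A. g c d) = 0"
proof -
  have "(\<Sum>c\<in>S. \<Sum>d\<in>S. g c d) = 0" if "finite S" "S \<subseteq> A" for S
    using that
  proof (induction S rule: finite_induct)
    case empty
    show ?case by (rule sum.empty)
  next
    case (insert x S)
    have row: "(\<Sum>d\<in>S. g x d) = - (\<Sum>d\<in>S. g d x)"
      unfolding sum_negf[symmetric]
    proof (rule sum.cong[OF refl])
      fix d assume "d \<in> S"
      then have "x \<in> A" "d \<in> A" using insert.prems by blast+
      then show "g x d = - g d x" using anti by blast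
    qed
    have IH: "(\<Sum>c\<in>S. \<Sum>d\<in>S. g c d) = 0" using insert.IH insert.prems by blast
    have diag: "g x x = 0" using diag insert.prems by blast
    have "(\<Sum>c\<in>insert x S. \<Sum>d\<in>insert x S. g c d) =
        g x x + (\<Sum>c\<in>S. g c x) + ((\<Sum>d\<in>S. g x d) + (\<Sum>c\<in>S. \<Sum>d\<in>S. g c d))"
      by (simp only: sum.insert[OF insert.hyps] sum.distrib)
    also have "\<dots> = 0" unfolding row IH diag by simp
    finally show ?case .
  qed
  then show ?thesis using assms(1) by blast
qed

context based_space begin

definition family :: "nat \<Rightarrow> ('w multiset \<Rightarrow> (('w list \<Rightarrow> 'k) \<Rightarrow> 'k)) \<Rightarrow> bool" where
  "family n G \<longleftrightarrow> (\<forall>\<alpha>\<in>MB. G \<alpha> \<in> vcarrier (L n))"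

definition dfam :: "('w multiset \<Rightarrow> (('w list \<Rightarrow> 'k) \<Rightarrow> 'k)) \<Rightarrow> 'w multiset \<Rightarrow> (('w list \<Rightarrow> 'k) \<Rightarrow> 'k)" where
  "dfam G \<alpha> = (\<Sum>c\<in>set_mset \<alpha>. wedge_mult scale c (G (\<alpha> - {#c#})))"

lemma familyD: "family n G \<Longrightarrow> \<alpha> \<in> MB \<Longrightarrow> G \<alpha> \<in> vcarrier (L n)"
  unfolding family_def by (rule bspec)

lemma dfam_add: "dfam (\<lambda>\<alpha>. G \<alpha> + H \<alpha>) \<alpha> = dfam G \<alpha> + dfam H \<alpha>"
  unfolding dfam_def linear_addD[OF linear_wedge_mult] by (rule sum.distrib)

lemma dfam_cong:
  assumes "\<alpha> \<in> MB" "\<And>\<beta>. \<beta> \<in> MB \<Longrightarrow> G \<beta> = H \<beta>"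
  shows "dfam G \<alpha> = dfam H \<alpha>"
  unfolding dfam_def
  by (rule sum.cong[OF refl]) (simp only: assms(2)[OF MB_diff[OF assms(1)]])

lemma dfam_dfam:
  assumes G: "family n G" and \<alpha>: "\<alpha> \<in> MB"
  shows "dfam (dfam G) \<alpha> = 0"
proof -
  \<comment> \<open>Extending the inner sum by zero makes the index set a square. The guard matters
    for \<open>d = c\<close>, which is counted only if \<open>c\<close> has multiplicity at least
    two.\<close>
  let ?g = "\<lambda>c d. if d \<in># \<alpha> - {#c#} then wedge_mult scale c (wedge_mult scale d (G (\<alpha> - {#c#} - {#d#}))) else 0"
  have mem: "G (\<alpha> - {#c#} - {#d#}) \<in> vcarrier (L n)" for c d
    by (rule familyD[OF G]) (intro MB_diff \<alpha>)
  have "dfam (dfam G) \<alpha> = (\<Sum>c\<in>set_mset \<alpha>. \<Sum>d\<in>set_mset (\<alpha> - {#c#}). wedge_mult scale c (wedge_mult scale d (G (\<alpha> - {#c#} - {#d#}))))"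
    unfolding dfam_def linear_sumD[OF linear_wedge_mult] ..
  also have "\<dots> = (\<Sum>c\<in>set_mset \<alpha>. \<Sum>d\<in>set_mset \<alpha>. ?g c d)"
  proof (rule sum.cong[OF refl])
    fix c
    show "(\<Sum>d\<in>set_mset (\<alpha> - {#c#}). wedge_mult scale c (wedge_mult scale d (G (\<alpha> - {#c#} - {#d#})))) = (\<Sum>d\<in>set_mset \<alpha>. ?g c d)"
      by (rule sum.mono_neutral_cong_left) (auto dest: in_diffD)
  qed
  also have "\<dots> = 0"
  proof (rule sum_antisymmetric)
    show "\<forall>c\<in>set_mset \<alpha>. ?g c c = 0" using wedge_mult_twice[OF mem] by simp
    have "?g c d = - ?g d c" if "c \<in> set_mset \<alpha>" "d \<in> set_mset \<alpha>" for c d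
    proof (cases "c = d")
      case True
      then show ?thesis using wedge_mult_twice[OF mem] by simp
    next
      case False
      then have "d \<in># \<alpha> - {#c#}" "c \<in># \<alpha> - {#d#}" using that by (auto simp: in_diff_count)
      moreover have "\<alpha> - {#c#} - {#d#} = \<alpha> - {#d#} - {#c#}" by (rule diff_right_commute)
      ultimately show ?thesis
        using wedge_mult_anticommute[OF mem[of c d], of c d] by (simp only: if_True)
    qed
    then show "\<forall>c\<in>set_mset \<alpha>. \<forall>d\<in>set_mset \<alpha>. ?g c d = - ?g d c" by blast
  qed simp
  finally show ?thesis .
qed

text \<open>
  The contracting homotopy of the Koszul complex in the single variable \<open>b\<close>, extended to all variables.
\<close>

lemma dfam_homotopy:
  assumes G: "family n G" and b: "b \<in> B" and \<alpha>: "\<alpha> \<in> MB"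
  shows "dfam (\<lambda>\<alpha>. contraction b (G (add_mset b \<alpha>))) \<alpha> + contraction b (dfam G (add_mset b \<alpha>))
    + (if b \<in># \<alpha> then 0 else projection b (G \<alpha>)) = G \<alpha>"
proof -
  have MBb: "add_mset b \<alpha> \<in> MB" using b \<alpha> by simp
  let ?h = "\<lambda>c. wedge_mult scale c (contraction b (G (add_mset b \<alpha> - {#c#})))"
  have mem: "G (add_mset b \<alpha> - {#c#}) \<in> vcarrier (L n)" for c by (intro familyD[OF G] MB_diff MBb)
  have "contraction b (dfam G (add_mset b \<alpha>)) =
      (\<Sum>c\<in>set_mset (add_mset b \<alpha>). fscale (dual b c) (G (add_mset b \<alpha> - {#c#})) - ?h c)"
    unfolding dfam_def linear_sumD[OF linear_contraction] contraction_wedge_mult[OF mem] ..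
  also have "\<dots> = (\<Sum>c\<in>set_mset (add_mset b \<alpha>). if c = b then G \<alpha> else 0) - (\<Sum>c\<in>set_mset (add_mset b \<alpha>). ?h c)"
  proof (unfold sum_subtractf[symmetric], rule sum.cong[OF refl])
    fix c assume "c \<in># add_mset b \<alpha>"
    then have "c \<in> B" using MBb by auto
    then show "fscale (dual b c) (G (add_mset b \<alpha> - {#c#})) - ?h c = (if c = b then G \<alpha> else 0) - ?h c"
      using dual_basis[OF b, of c] by auto
  qed
  also have "(\<Sum>c\<in>set_mset (add_mset b \<alpha>). if c = b then G \<alpha> else 0) = G \<alpha>" by simp
  \<comment> \<open>If \<open>b\<close> already occurs in \<open>\<alpha>\<close>, adding it does
    not enlarge the set of letters; otherwise there is one extra term, with \<open>c = b\<close>,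
    and it is the projection of \<open>G \<alpha>\<close>.\<close>
  also have "(\<Sum>c\<in>set_mset (add_mset b \<alpha>). ?h c) = (\<Sum>c\<in>set_mset \<alpha>. ?h c) + (if b \<in># \<alpha> then 0 else projection b (G \<alpha>))"
    by (auto simp: insert_absorb projection_def add.commute)
  also have "(\<Sum>c\<in>set_mset \<alpha>. ?h c) = dfam (\<lambda>\<alpha>. contraction b (G (add_mset b \<alpha>))) \<alpha>"
    unfolding dfam_def by (rule sum.cong) (auto simp: diff_union_swap)
  finally show ?thesis by simp
qed

text \<open>\<open>R bs\<close> is the composite of the remainders \<open>P\<close> for the letters
  of \<open>bs\<close>, applied to \<open>G\<close>. Since \<open>R bs\<close> and
  \<open>R (b # bs)\<close> differ by a coboundary, the remainder stays closed and the homotopy for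
  the next letter applies to it; the primitives add up to \<open>H\<close>.\<close>

lemma closed_family_reduction:
  assumes G: "family (Suc n) G" and closed: "\<And>\<alpha>. \<alpha> \<in> MB \<Longrightarrow> dfam G \<alpha> = 0" and bs: "set bs \<subseteq> B"
  defines "R \<equiv> \<lambda>bs \<alpha>. if set bs \<inter> set_mset \<alpha> = {} then foldr projection bs (G \<alpha>) else 0"
  shows "family (Suc n) (R bs) \<and> (\<forall>\<alpha>\<in>MB. dfam (R bs) \<alpha> = 0) \<and>
    (\<exists>H. family n H \<and> (\<forall>\<alpha>\<in>MB. G \<alpha> = dfam H \<alpha> + R bs \<alpha>))"
  using bs
proof (induction bs)
  case Nil
  have R: "R [] = G" by (simp add: R_def fun_eq_iff)
  have "family n (\<lambda>_. 0)" unfolding family_def using vsp_zero[OF vspace_L] by blast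
  moreover have "dfam (\<lambda>_. 0) \<alpha> = 0" for \<alpha>
    unfolding dfam_def linear_zeroD[OF linear_wedge_mult] by simp
  ultimately have "family n (\<lambda>_. 0) \<and> (\<forall>\<alpha>\<in>MB. G \<alpha> = dfam (\<lambda>_. 0) \<alpha> + R [] \<alpha>)"
    by (simp only: R add_0_left) simp
  with G closed show ?case unfolding R by blast
next
  case (Cons b bs)
  then have b: "b \<in> B" by simp
  from Cons obtain H where fam: "family (Suc n) (R bs)" and cl: "\<And>\<alpha>. \<alpha> \<in> MB \<Longrightarrow> dfam (R bs) \<alpha> = 0"
    and H: "family n H" "\<And>\<alpha>. \<alpha> \<in> MB \<Longrightarrow> G \<alpha> = dfam H \<alpha> + R bs \<alpha>" by auto
  let ?K = "\<lambda>\<alpha>. contraction b (R bs (add_mset b \<alpha>))"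
  have K: "family n ?K"
    unfolding family_def using b by (intro ballI contraction_in_L familyD[OF fam]) simp
  have R: "R (b # bs) \<alpha> = (if b \<in># \<alpha> then 0 else projection b (R bs \<alpha>))" for \<alpha>
    using linear_zeroD[OF linear_projection', of b] by (auto simp: R_def)
  have eq: "R bs \<alpha> = dfam ?K \<alpha> + R (b # bs) \<alpha>" if \<alpha>: "\<alpha> \<in> MB" for \<alpha>
  proof -
    have "add_mset b \<alpha> \<in> MB" using b \<alpha> by simp
    from dfam_homotopy[OF fam b \<alpha>] cl[OF this] show ?thesis
      unfolding R by (simp only: linear_zeroD[OF linear_contraction] add_0_right)
  qed
  have fam': "family (Suc n) (R (b # bs))"
    unfolding family_def R using familyD[OF fam] vsp_zero[OF vspace_L] projection_in_L by auto
  moreover have "dfam (R (b # bs)) \<alpha> = 0" if \<alpha>: "\<alpha> \<in> MB" for \<alpha>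
  proof -
    have "dfam (R bs) \<alpha> = dfam (\<lambda>\<alpha>. dfam ?K \<alpha> + R (b # bs) \<alpha>) \<alpha>"
      by (rule dfam_cong[OF \<alpha> eq])
    then show ?thesis using dfam_dfam[OF K \<alpha>] cl[OF \<alpha>] by (simp only: dfam_add add_0_left)
  qed
  moreover have "family n (\<lambda>\<alpha>. H \<alpha> + ?K \<alpha>)"
    unfolding family_def by (intro ballI vsp_add[OF vspace_L] familyD[OF H(1)] familyD[OF K])
  moreover have "G \<alpha> = dfam (\<lambda>\<alpha>. H \<alpha> + ?K \<alpha>) \<alpha> + R (b # bs) \<alpha>" if \<alpha>: "\<alpha> \<in> MB" for \<alpha>
    using H(2)[OF \<alpha>] eq[OF \<alpha>] by (simp only: dfam_add add.assoc)
  ultimately show ?case by blast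
qed

lemma closed_family_exact:
  assumes inf: "infinite B" and G: "family (Suc n) G" and closed: "\<And>\<alpha>. \<alpha> \<in> MB \<Longrightarrow> dfam G \<alpha> = 0"
  shows "\<exists>H. family n H \<and> (\<forall>\<alpha>\<in>MB. G \<alpha> = dfam H \<alpha>)"
proof -
  \<comment> \<open>\<open>n + 2\<close> letters, because the forms have degree
    \<open>n + 1\<close>.\<close>
  obtain S where S: "S \<subseteq> B" "finite S" "card S = Suc (Suc n)"
    using infinite_arbitrarily_large[OF inf] by blast
  obtain bs where bs: "set bs = S" "distinct bs" using finite_distinct_list[OF S(2)] by blast
  have len: "Suc n < length bs" using distinct_card[OF bs(2)] bs(1) S(3) by simp
  have "set bs \<subseteq> B" using bs S by simp
  from closed_family_reduction[OF G closed this]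
  obtain H where H: "family n H" "\<And>\<alpha>. \<alpha> \<in> MB \<Longrightarrow> G \<alpha> = dfam H \<alpha> +
      (if set bs \<inter> set_mset \<alpha> = {} then foldr projection bs (G \<alpha>) else 0)" by blast
  have "G \<alpha> = dfam H \<alpha>" if "\<alpha> \<in> MB" for \<alpha>
  proof -
    have "foldr projection bs (G \<alpha>) = 0"
      by (rule foldr_projection_zero[OF \<open>set bs \<subseteq> B\<close> bs(2) len familyD[OF G that]])
    then show ?thesis by (subst H(2)[OF that]) (simp only: if_cancel add_0_right)
  qed
  with H(1) show ?thesis by blast
qed

text \<open>On forms of degree 0 the contraction vanishes, and with it the projection. The homotopy
  identity for any one \<open>b\<close> then leaves only the contraction of \<open>dfam G\<close>,
  which is zero by closedness.\<close>

lemma closed_family_zero: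
  assumes inf: "infinite B" and G: "family 0 G" and closed: "\<And>\<alpha>. \<alpha> \<in> MB \<Longrightarrow> dfam G \<alpha> = 0" and \<alpha>: "\<alpha> \<in> MB"
  shows "G \<alpha> = 0"
proof -
  obtain b where b: "b \<in> B" using inf by (metis ex_in_conv finite.emptyI)
  have c: "contraction b (G \<beta>) = 0" if "\<beta> \<in> MB" for \<beta>
    by (rule contraction_L0[OF familyD[OF G that]])
  have "dfam (\<lambda>\<alpha>. contraction b (G (add_mset b \<alpha>))) \<alpha> = dfam (\<lambda>_. 0) \<alpha>"
    by (rule dfam_cong[OF \<alpha>]) (rule c, use b in simp)
  also have "\<dots> = 0" unfolding dfam_def linear_zeroD[OF linear_wedge_mult] by simp
  finally have 1: "dfam (\<lambda>\<alpha>. contraction b (G (add_mset b \<alpha>))) \<alpha> = 0" .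
  have 2: "dfam G (add_mset b \<alpha>) = 0" using b \<alpha> by (intro closed) simp
  have 3: "projection b (G \<alpha>) = 0" unfolding projection_def c[OF \<alpha>] by (rule linear_zeroD[OF linear_wedge_mult])
  from dfam_homotopy[OF G b \<alpha>] show ?thesis
    by (simp only: 1 2 3 linear_zeroD[OF linear_contraction] if_cancel add_0_left)
qed

end

section \<open>Morphisms out of the cofree comodule cospanned by the vector space\<close>

lemma submultiset_add_iff: "\<beta> + \<delta> \<subseteq># \<alpha> \<longleftrightarrow> \<beta> \<subseteq># \<alpha> \<and> \<delta> \<subseteq># \<alpha> - \<beta>" for \<alpha> \<beta> \<delta> :: "'a multiset"
proof -
  have "count \<beta> x + count \<delta> x \<le> count \<alpha> x \<longleftrightarrow>
      count \<beta> x \<le> count \<alpha> x \<and> count \<delta> x \<le> count \<alpha> x - count \<beta> x" for x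
    by arith
  then show ?thesis by (simp add: subseteq_mset_def all_conj_distrib)
qed

context based_space begin

abbreviation J where "J \<equiv> cof W"

text \<open>Unlike in \<open>tensor_induct\<close> the scalar stays visible: both factors are basis
  elements and cannot absorb it.\<close>

lemma J_induct [consumes 1, case_names zero basis add]:
  assumes t: "t \<in> vcarrier J" and zero: "P 0"
    and basis: "\<And>k \<alpha> b. \<alpha> \<in> MB \<Longrightarrow> b \<in> B \<Longrightarrow> P (fscale k (tensor C W (e \<alpha>) b))"
    and add: "\<And>x y. \<lbrakk>x \<in> vcarrier J; y \<in> vcarrier J; P x; P y\<rbrakk> \<Longrightarrow> P (x + y)"
  shows "P t"
  using t[unfolded cof_simps] vspace_W
proof (induction rule: tensor_C_induct)
  case (tensor \<alpha> w)
  note e\<alpha> = dmon_in_C[OF tensor(1)]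
  note lin = vlinear_tensor_right[OF e\<alpha>, of W]
  have "w \<in> span B" by (simp add: span_B)
  then show ?case
  proof (induction rule: span_induct_alt)
    case base
    show ?case unfolding tensor_zero_right[OF e\<alpha> vspace_W] by (rule zero)
  next
    case (step c b y)
    have "tensor C W (e \<alpha>) (scale c b + y) = fscale c (tensor C W (e \<alpha>) b) + tensor C W (e \<alpha>) y"
      using vlinear_add[OF lin, of "scale c b" y] vlinear_scale[OF lin, of b c] by simp
    moreover have "fscale c (tensor C W (e \<alpha>) b) \<in> vcarrier J" "tensor C W (e \<alpha>) y \<in> vcarrier J"
      using tensor_in[OF e\<alpha>, of b W] tensor_in[OF e\<alpha>, of y W] vsp_scale[OF vspace_tensor, of _ C W c] by simp_all
    ultimately show ?case using add basis[OF tensor(1) step(1)] step(2) by simp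
  qed
qed (use zero add in simp_all)

lemma linear_on_J_exists:
  assumes s: "vector_space s"
  shows "\<exists>g. Vector_Spaces.linear fscale s g \<and> (\<forall>\<alpha>\<in>MB. \<forall>b\<in>B. g (tensor C W (e \<alpha>) b) = F \<alpha> b)"
proof -
  have "\<exists>g. Vector_Spaces.linear fscale s g \<and> (\<forall>i\<in>MB \<times> B. g ((\<lambda>(\<alpha>, b). tensor C W (e \<alpha>) b) i) = (\<lambda>(\<alpha>, b). F \<alpha> b) i)"
  proof (rule linear_extend_dual_family[OF vector_space_fscale s, where l = "\<lambda>(\<alpha>, b) t. dual b (coord W \<alpha> t)"])
    fix i :: "'w multiset \<times> 'w"
    show "Vector_Spaces.linear fscale (*) ((\<lambda>(\<alpha>, b) t. dual b (coord W \<alpha> t)) i)"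
      using Vector_Spaces.linear_compose[OF linear_coord[OF vspace_W, simplified] linear_dual]
      by (cases i) (simp add: o_def)
  next
    fix i j assume "i \<in> MB \<times> B" "j \<in> MB \<times> B"
    then show "(\<lambda>(\<alpha>, b) t. dual b (coord W \<alpha> t)) i ((\<lambda>(\<alpha>, b). tensor C W (e \<alpha>) b) j) = (if i = j then 1 else 0)"
      using linear_zeroD[OF linear_dual]
      by (cases i, cases j) (auto simp: coord_dmon[OF vspace_W] dual_basis)
  qed
  then show ?thesis by auto
qed

lemma sum_dmon_in:
  assumes V: "vspace V" and F: "\<And>\<alpha>. \<alpha> \<in> MB \<Longrightarrow> F \<alpha> \<in> vcarrier V" and \<alpha>: "\<alpha> \<in> MB"
  shows "(\<Sum>\<beta>\<in>below \<alpha>. tensor C V (e \<beta>) (F (\<alpha> - \<beta>))) \<in> CT V"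
proof (intro vsp_sum[OF vspace_tensor] tensor_in)
  fix \<beta> assume "\<beta> \<in> below \<alpha>"
  then show "e \<beta> \<in> vcarrier C" using MB_submultiset[OF \<alpha>, of \<beta>] by (intro dmon_in_C) blast
  show "F (\<alpha> - \<beta>) \<in> vcarrier V" by (intro F MB_diff \<alpha>)
qed

lemma coord_sum_dmon:
  assumes V: "vspace V" and \<alpha>: "\<alpha> \<in> MB" and \<gamma>: "\<gamma> \<in> MB"
  shows "coord V \<gamma> (\<Sum>\<beta>\<in>below \<alpha>. tensor C V (e \<beta>) (F (\<alpha> - \<beta>))) = (if \<gamma> \<subseteq># \<alpha> then F (\<alpha> - \<gamma>) else 0)"
proof -
  have "coord V \<gamma> (\<Sum>\<beta>\<in>below \<alpha>. tensor C V (e \<beta>) (F (\<alpha> - \<beta>))) =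
      (\<Sum>\<beta>\<in>below \<alpha>. if \<beta> = \<gamma> then F (\<alpha> - \<beta>) else 0)"
    unfolding linear_sumD[OF linear_coord[OF V]]
  proof (rule sum.cong[OF refl])
    fix \<beta> assume "\<beta> \<in> below \<alpha>"
    then have "\<beta> \<in> MB" using MB_submultiset[OF \<alpha>, of \<beta>] by blast
    then show "coord V \<gamma> (tensor C V (e \<beta>) (F (\<alpha> - \<beta>))) = (if \<beta> = \<gamma> then F (\<alpha> - \<beta>) else 0)"
      by (rule coord_dmon[OF V _ \<gamma>])
  qed
  also have "\<dots> = (if \<gamma> \<in> below \<alpha> then F (\<alpha> - \<gamma>) else 0)"
    by (rule sum.delta[OF finite_submultisets])
  finally show ?thesis by simp
qed

lemma basis_in_J: "\<alpha> \<in> MB \<Longrightarrow> tensor C W (e \<alpha>) w \<in> CT W"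
  by (intro tensor_in dmon_in_C) simp_all

text \<open>The existence half of cofreeness, \<open>coord V {#}\<close> being the counit tensored
  with \<open>V\<close>. The morphism has to send \<open>e \<alpha> \<otimes> b\<close> to the sum
  of the \<open>e \<beta> \<otimes> F (\<alpha> - \<beta>) b\<close>; it commutes with the shifts
  because removing \<open>\<beta>\<close> and then \<open>\<gamma>\<close> removes
  \<open>\<beta> + \<gamma>\<close>.\<close>

lemma hom_of_family:
  assumes V: "vspace V" "vscale V = fscale" and F: "\<And>\<alpha> b. \<alpha> \<in> MB \<Longrightarrow> b \<in> B \<Longrightarrow> F \<alpha> b \<in> vcarrier V"
  shows "\<exists>f\<in>comodule_hom C J (cof V). \<forall>\<alpha>\<in>MB. \<forall>b\<in>B. coord V {#} (f (tensor C W (e \<alpha>) b)) = F \<alpha> b"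
proof -
  obtain g where g1: "flinear g" and
    g2: "\<forall>\<alpha>\<in>MB. \<forall>b\<in>B. g (tensor C W (e \<alpha>) b) = (\<Sum>\<beta>\<in>below \<alpha>. tensor C V (e \<beta>) (F (\<alpha> - \<beta>) b))"
    using linear_on_J_exists[OF vector_space_fscale,
        of "\<lambda>\<alpha> b. (\<Sum>\<beta>\<in>below \<alpha>. tensor C V (e \<beta>) (F (\<alpha> - \<beta>) b))"] by (elim exE conjE)
  note g = g1 bspec[OF bspec[OF g2]]
  have coord_g: "coord V \<gamma> (g (tensor C W (e \<alpha>) b)) = (if \<gamma> \<subseteq># \<alpha> then F (\<alpha> - \<gamma>) b else 0)"
    if "\<alpha> \<in> MB" "b \<in> B" "\<gamma> \<in> MB" for \<alpha> b \<gamma>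
    unfolding g(2)[OF that(1,2)] by (rule coord_sum_dmon[OF V(1) that(1,3)])
  have g_gen: "g (tensor C W (e \<alpha>) b) \<in> CT V" if "\<alpha> \<in> MB" "b \<in> B" for \<alpha> b
    unfolding g(2)[OF that] by (rule sum_dmon_in[OF V(1) F that(1)]) (simp_all add: that)
  have g_in: "g t \<in> CT V" if "t \<in> vcarrier J" for t
    using that
  proof (induction rule: J_induct)
    case zero
    show ?case unfolding linear_zeroD[OF g(1)] by (rule vsp_zero[OF vspace_tensor])
  next
    case (basis k \<alpha> b)
    then show ?case unfolding linear_scaleD[OF g(1)]
      using vsp_scale[OF vspace_tensor g_gen[OF basis], of k] by simp
  next
    case (add x y)
    show ?case unfolding linear_addD[OF g(1)] by (rule vsp_add[OF vspace_tensor add(3,4)])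
  qed
  have g_shift: "g (shift W \<beta> t) = shift V \<beta> (g t)" if "t \<in> vcarrier J" and \<beta>: "\<beta> \<in> MB" for t \<beta>
    using that(1)
  proof (induction rule: J_induct)
    case zero
    show ?case by (simp only: linear_zeroD[OF g(1)] linear_zeroD[OF linear_shift])
  next
    case (basis k \<alpha> b)
    have "g (shift W \<beta> (tensor C W (e \<alpha>) b)) = shift V \<beta> (g (tensor C W (e \<alpha>) b))"
    proof (rule coord_ext[OF _ _ V(1)])
      show "g (shift W \<beta> (tensor C W (e \<alpha>) b)) \<in> CT V"
        using shift_in[OF basis_in_J[OF basis(1)] vspace_W \<beta>] by (intro g_in) simp
      show "shift V \<beta> (g (tensor C W (e \<alpha>) b)) \<in> CT V"
        by (rule shift_in[OF g_gen[OF basis] V(1) \<beta>])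
      fix \<gamma> assume \<gamma>: "\<gamma> \<in> MB"
      have "coord V \<gamma> (g (shift W \<beta> (tensor C W (e \<alpha>) b))) = (if \<beta> \<subseteq># \<alpha> \<and> \<gamma> \<subseteq># \<alpha> - \<beta> then F (\<alpha> - \<beta> - \<gamma>) b else 0)"
      proof (cases "\<beta> \<subseteq># \<alpha>")
        case True
        then show ?thesis
          unfolding shift_dmon[OF basis(1) \<beta>, of b W, simplified, OF vspace_W]
          using coord_g[OF MB_diff[OF basis(1)] basis(2) \<gamma>] by simp
      next
        case False
        then show ?thesis
          unfolding shift_dmon[OF basis(1) \<beta>, of b W, simplified, OF vspace_W]
          using linear_zeroD[OF g(1)] linear_zeroD[OF linear_coord[OF V(1)], of \<gamma>] by simp
      qed
      also have "\<dots> = coord V (\<beta> + \<gamma>) (g (tensor C W (e \<alpha>) b))"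
        unfolding coord_g[OF basis MB_add[OF \<beta> \<gamma>]] submultiset_add_iff diff_diff_eq ..
      also have "\<dots> = coord V \<gamma> (shift V \<beta> (g (tensor C W (e \<alpha>) b)))"
        by (rule coord_shift[OF g_gen[OF basis] V(1) \<beta> \<gamma>, symmetric])
      finally show "coord V \<gamma> (g (shift W \<beta> (tensor C W (e \<alpha>) b))) = coord V \<gamma> (shift V \<beta> (g (tensor C W (e \<alpha>) b)))" .
    qed
    then show ?case by (simp only: linear_scaleD[OF g(1)] linear_scaleD[OF linear_shift])
  next
    case (add x y)
    then show ?case by (simp only: linear_addD[OF g(1)] linear_addD[OF linear_shift])
  qed
  let ?f = "restrict g (vcarrier J)"
  have "?f \<in> comodule_hom C J (cof V)"
    unfolding comodule_hom_cof_iff[OF vspace_W V(1)]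
  proof (intro conjI ballI)
    show "?f \<in> extensional (CT W)" by simp
    show "vlinear J (cof V) ?f"
      by (rule vlinear_cong[of _ _ g, OF linear_imp_vlinear vspace_cof])
        (use g(1) g_in in simp_all)
    fix t \<beta> assume t: "t \<in> CT W" and \<beta>: "\<beta> \<in> MB"
    then show "?f (shift W \<beta> t) = shift V \<beta> (?f t)"
      using g_shift[of t \<beta>] shift_in[OF t vspace_W \<beta>] by simp
  qed
  moreover have "coord V {#} (?f (tensor C W (e \<alpha>) b)) = F \<alpha> b" if "\<alpha> \<in> MB" "b \<in> B" for \<alpha> b
    using coord_g[OF that, of "{#}"] basis_in_J[OF that(1), of b] by simp
  ultimately show ?thesis by blast
qed

lemma comodule_hom_cofD:
  assumes "f \<in> comodule_hom C (cof U) (cof V)" "vspace U" "vspace V"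
  shows "f \<in> extensional (CT U)"
    and "vlinear (tensor_space C U) (tensor_space C V) f"
    and "\<And>t \<beta>. t \<in> CT U \<Longrightarrow> \<beta> \<in> MB \<Longrightarrow> f (shift U \<beta> t) = shift V \<beta> (f t)"
    and "\<And>t. t \<in> CT U \<Longrightarrow> f t \<in> CT V"
proof -
  note * = assms(1)[unfolded comodule_hom_cof_iff[OF assms(2,3)]]
  show "f \<in> extensional (CT U)" using * by blast
  show "vlinear (tensor_space C U) (tensor_space C V) f" using * by (simp add: vlinear_def)
  then show "\<And>t. t \<in> CT U \<Longrightarrow> f t \<in> CT V" by (rule vlinear_closed)
  show "\<And>t \<beta>. t \<in> CT U \<Longrightarrow> \<beta> \<in> MB \<Longrightarrow> f (shift U \<beta> t) = shift V \<beta> (f t)" using * by blast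
qed

lemma hom_coord:
  assumes f: "f \<in> comodule_hom C (cof U) (cof V)" and U: "vspace U" and V: "vspace V"
    and t: "t \<in> CT U" and \<alpha>: "\<alpha> \<in> MB"
  shows "coord V \<alpha> (f t) = coord V {#} (f (shift U \<alpha> t))"
  unfolding comodule_hom_cofD(3)[OF f U V t \<alpha>]
  using coord_shift[OF comodule_hom_cofD(4)[OF f U V t] V \<alpha>, of "{#}"] by simp

text \<open>The uniqueness half of cofreeness: morphisms commute with the shifts, and these bring
  every coordinate to the empty one.\<close>

lemma hom_family_ext:
  assumes V: "vspace V" and f: "f \<in> comodule_hom C J (cof V)" and g: "g \<in> comodule_hom C J (cof V)"
    and eq: "\<And>\<alpha> b. \<alpha> \<in> MB \<Longrightarrow> b \<in> B \<Longrightarrow> coord V {#} (f (tensor C W (e \<alpha>) b)) = coord V {#} (g (tensor C W (e \<alpha>) b))"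
  shows "f = g"
proof (rule extensionalityI)
  note f' = comodule_hom_cofD[OF f vspace_W V] and g' = comodule_hom_cofD[OF g vspace_W V]
  show "f \<in> extensional (CT W)" "g \<in> extensional (CT W)"
    by (rule f' g')+
  have c0: "vlinear (tensor_space C V) V (coord V {#})" by (rule vlinear_coord[OF V]) simp
  have 0: "coord V {#} (f t) = coord V {#} (g t)" if "t \<in> vcarrier J" for t
    using that
  proof (induction rule: J_induct)
    case zero
    show ?case unfolding vlinear_zero[OF f'(2) vspace_tensor] vlinear_zero[OF g'(2) vspace_tensor] ..
  next
    case (basis k \<alpha> b)
    note t = basis_in_J[OF basis(1), of b]
    show ?case
      using vlinear_scale[OF f'(2) t, of k] vlinear_scale[OF g'(2) t, of k] eq[OF basis]
        linear_scaleD[OF linear_coord[OF V]] by simp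
  next
    case (add x y)
    then show ?case
      using vlinear_add[OF f'(2), of x y] vlinear_add[OF g'(2), of x y] linear_addD[OF linear_coord[OF V]] by simp
  qed
  fix t assume t: "t \<in> CT W"
  show "f t = g t"
  proof (rule coord_ext[OF f'(4)[OF t] g'(4)[OF t] V])
    fix \<alpha> assume \<alpha>: "\<alpha> \<in> MB"
    show "coord V \<alpha> (f t) = coord V \<alpha> (g t)"
      unfolding hom_coord[OF f vspace_W V t \<alpha>] hom_coord[OF g vspace_W V t \<alpha>]
      using shift_in[OF t vspace_W \<alpha>] by (intro 0) simp
  qed
qed

text \<open>By \<open>hom_coord\<close> the coordinate at \<open>\<beta>\<close> is the empty
  coordinate of \<open>f\<close> at \<open>e (\<alpha> - \<beta>) \<otimes> b\<close>.\<close>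

lemma hom_expansion:
  assumes V: "vspace V" and f: "f \<in> comodule_hom C J (cof V)" and \<alpha>: "\<alpha> \<in> MB"
  shows "f (tensor C W (e \<alpha>) b) =
    (\<Sum>\<beta>\<in>below \<alpha>. tensor C V (e \<beta>) (coord V {#} (f (tensor C W (e (\<alpha> - \<beta>)) b))))"
proof (rule coord_ext[OF _ _ V])
  note f' = comodule_hom_cofD[OF f vspace_W V]
  show "f (tensor C W (e \<alpha>) b) \<in> CT V" by (rule f'(4)[OF basis_in_J[OF \<alpha>]])
  show "(\<Sum>\<beta>\<in>below \<alpha>. tensor C V (e \<beta>) (coord V {#} (f (tensor C W (e (\<alpha> - \<beta>)) b)))) \<in> CT V"
    using coord_in[OF f'(4)[OF basis_in_J] V, of _ "{#}" b]
    by (intro sum_dmon_in[OF V _ \<alpha>, of "\<lambda>\<alpha>. coord V {#} (f (tensor C W (e \<alpha>) b))"]) simp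
  fix \<gamma> assume \<gamma>: "\<gamma> \<in> MB"
  show "coord V \<gamma> (f (tensor C W (e \<alpha>) b)) =
      coord V \<gamma> (\<Sum>\<beta>\<in>below \<alpha>. tensor C V (e \<beta>) (coord V {#} (f (tensor C W (e (\<alpha> - \<beta>)) b))))"
    unfolding coord_sum_dmon[OF V \<alpha> \<gamma>, of "\<lambda>\<alpha>. coord V {#} (f (tensor C W (e \<alpha>) b))"]
      hom_coord[OF f vspace_W V basis_in_J[OF \<alpha>] \<gamma>]
      shift_dmon[OF \<alpha> \<gamma>, of b W, simplified, OF vspace_W]
    using vlinear_zero[OF f'(2) vspace_tensor] linear_zeroD[OF linear_coord[OF V], of "{#}"] by simp
qed

end

section \<open>Modules of comodule morphisms\<close>

text \<open>Linearity of the coaction is what makes pointwise sums and negatives of morphisms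
  between such comodules morphisms again.\<close>

definition linear_comodule ::
    "('k::field, 'c::ab_group_add, 'x) coalgebra_scheme
      \<Rightarrow> ('k, 'c, 'm::ab_group_add, 'y) comodule_scheme \<Rightarrow> bool" where
  "linear_comodule C M \<longleftrightarrow> vspace M \<and> vlinear M (tensor_space C M) (coact M)"

lemma linear_comodule_zero:
  "linear_comodule C (zero_comodule :: ('k::field, 'c::ab_group_add, 'y \<Rightarrow> 'k) comodule)"
  by (auto simp: linear_comodule_def zero_comodule_def vspace_def vector_space_fscale vlinear_def
      vsp_zero[OF vspace_tensor] fs.subspace_0 intro!: fs.subspace_single_0)

locale comodule_pair =
  fixes C :: "('k::field, 'c::ab_group_add, 'x) coalgebra_scheme"
    and M :: "('k, 'c, 'm::ab_group_add, 'y) comodule_scheme"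
    and N :: "('k, 'c, 'n::ab_group_add, 'z) comodule_scheme"
  assumes C: "vspace C" and M: "linear_comodule C M" and N: "linear_comodule C N"
begin

lemma vM: "vspace M" and vN: "vspace N"
  using M N by (auto simp: linear_comodule_def)

lemma coact_M_in: "x \<in> vcarrier M \<Longrightarrow> coact M x \<in> vcarrier (tensor_space C M)"
  using M by (auto simp: linear_comodule_def dest: vlinear_closed)

lemma homI:
  assumes "vlinear M N g" and "\<And>x. x \<in> vcarrier M \<Longrightarrow> tensor_map C N id g (coact M x) = coact N (g x)"
  shows "restrict g (vcarrier M) \<in> comodule_hom C M N"
proof -
  have lin: "vlinear M N (restrict g (vcarrier M))"
    by (rule vlinear_cong[OF assms(1) vM]) simp
  have "tensor_map C N id (restrict g (vcarrier M)) (coact M x) = tensor_map C N id g (coact M x)" if "x \<in> vcarrier M" for x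
    by (rule tensor_map_id_eq[OF vlinear_id(1) lin assms(1) vM C _ coact_M_in[OF that]]) simp
  then show ?thesis using assms lin by (simp add: comodule_hom_def)
qed

lemma homD:
  assumes "f \<in> comodule_hom C M N"
  shows "f \<in> extensional (vcarrier M)" "vlinear M N f"
    and "\<And>x. x \<in> vcarrier M \<Longrightarrow> tensor_map C N id f (coact M x) = coact N (f x)"
  using assms by (auto simp: comodule_hom_def)

lemma coact_N_add: "x \<in> vcarrier N \<Longrightarrow> y \<in> vcarrier N \<Longrightarrow> coact N (x + y) = coact N x + coact N y"
  and coact_N_zero: "coact N 0 = 0"
  and coact_N_minus: "x \<in> vcarrier N \<Longrightarrow> coact N (- x) = - coact N x"
  using N vN by (auto simp: linear_comodule_def dest: vlinear_add vlinear_zero vlinear_minus)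

lemma hom_zero: "(\<lambda>x\<in>vcarrier M. 0) \<in> comodule_hom C M N"
proof (rule homI)
  show "vlinear M N (\<lambda>x. 0)" by (rule vlinear_const_zero[OF vN])
  have *: "tensor_map C N id (\<lambda>x. 0) t = 0" if "t \<in> vcarrier (tensor_space C M)" for t
    by (rule vlinear_tensor_eqI[OF vlinear_tensor_map[OF vlinear_id(1) vlinear_const_zero[OF vN] vM C]
          vlinear_const_zero[OF vspace_tensor] vM C _ that])
      (simp add: tensor_map_tensor[OF vlinear_id(1) vlinear_const_zero[OF vN]] tensor_zero_right vN)
  show "tensor_map C N id (\<lambda>x. 0) (coact M x) = coact N 0" if "x \<in> vcarrier M" for x
    unfolding *[OF coact_M_in[OF that]] coact_N_zero ..
qed

lemma hom_add:
  assumes f: "f \<in> comodule_hom C M N" and g: "g \<in> comodule_hom C M N"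
  shows "(\<lambda>x\<in>vcarrier M. f x + g x) \<in> comodule_hom C M N"
proof (rule homI)
  note f' = homD[OF f] and g' = homD[OF g]
  show "vlinear M N (\<lambda>x. f x + g x)" by (rule vlinear_plus[OF f'(2) g'(2) vN])
  show "tensor_map C N id (\<lambda>x. f x + g x) (coact M x) = coact N (f x + g x)" if "x \<in> vcarrier M" for x
    unfolding tensor_map_plus[OF vlinear_id(1) f'(2) g'(2) vM C vN coact_M_in[OF that]] f'(3)[OF that] g'(3)[OF that]
    by (rule coact_N_add[symmetric]) (rule vlinear_closed[OF f'(2) that] vlinear_closed[OF g'(2) that])+
qed

lemma hom_minus:
  assumes f: "f \<in> comodule_hom C M N"
  shows "(\<lambda>x\<in>vcarrier M. - f x) \<in> comodule_hom C M N"
proof (rule homI)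
  note f' = homD[OF f]
  note lin = vlinear_uminus[OF f'(2) vN]
  show "vlinear M N (\<lambda>x. - f x)" by (rule lin)
  show "tensor_map C N id (\<lambda>x. - f x) (coact M x) = coact N (- f x)" if "x \<in> vcarrier M" for x
  proof -
    have "tensor_map C N id (\<lambda>x. - f x) (coact M x) + tensor_map C N id f (coact M x) =
        tensor_map C N id (\<lambda>x. - f x + f x) (coact M x)"
      by (rule tensor_map_plus[OF vlinear_id(1) lin f'(2) vM C vN coact_M_in[OF that], symmetric])
    also have "\<dots> = tensor_map C N id (restrict (\<lambda>x. 0) (vcarrier M)) (coact M x)"
      by (rule tensor_map_id_eq[OF vlinear_id(1) vlinear_plus[OF lin f'(2) vN] homD(2)[OF hom_zero] vM C _ coact_M_in[OF that]]) simp
    also have "\<dots> = 0" using homD(3)[OF hom_zero that] that coact_N_zero by simp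
    finally show ?thesis
      unfolding f'(3)[OF that] coact_N_minus[OF vlinear_closed[OF f'(2) that]]
      by (simp only: eq_neg_iff_add_eq_0)
  qed
qed

abbreviation Hom where "Hom \<equiv> comodule_Hom C M N"

lemma comodule_Hom_group: "abelian_group Hom"
proof (rule abelian_groupI)
  fix f g h
  assume "f \<in> carrier Hom" "g \<in> carrier Hom" "h \<in> carrier Hom"
  then show "f \<oplus>\<^bsub>Hom\<^esub> g \<oplus>\<^bsub>Hom\<^esub> h = f \<oplus>\<^bsub>Hom\<^esub> (g \<oplus>\<^bsub>Hom\<^esub> h)"
    by (simp add: comodule_Hom_def restrict_def fun_eq_iff add.assoc)
next
  fix f g assume "f \<in> carrier Hom" "g \<in> carrier Hom"
  then show "f \<oplus>\<^bsub>Hom\<^esub> g \<in> carrier Hom"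
    by (simp add: comodule_Hom_def hom_add)
  show "f \<oplus>\<^bsub>Hom\<^esub> g = g \<oplus>\<^bsub>Hom\<^esub> f"
    by (simp add: comodule_Hom_def restrict_def fun_eq_iff add.commute)
next
  show "\<zero>\<^bsub>Hom\<^esub> \<in> carrier Hom"
    by (simp add: comodule_Hom_def hom_zero)
next
  fix f assume "f \<in> carrier Hom"
  then have f: "f \<in> comodule_hom C M N" by (simp add: comodule_Hom_def)
  show "\<zero>\<^bsub>Hom\<^esub> \<oplus>\<^bsub>Hom\<^esub> f = f"
    using homD(1)[OF f] by (auto simp: comodule_Hom_def fun_eq_iff extensional_def)
  show "\<exists>g\<in>carrier Hom. g \<oplus>\<^bsub>Hom\<^esub> f = \<zero>\<^bsub>Hom\<^esub>"
    using hom_minus[OF f] by (intro bexI[of _ "\<lambda>x\<in>vcarrier M. - f x"]) (auto simp: comodule_Hom_def fun_eq_iff)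
qed

end

lemma comodule_hom_compose:
  assumes C: "vspace C" and L: "linear_comodule C L" and M: "linear_comodule C M"
    and f: "f \<in> comodule_hom C M N" and s: "s \<in> comodule_hom C L M"
  shows "compose (vcarrier L) f s \<in> comodule_hom C L N"
proof -
  have vL: "vspace L" and vM: "vspace M" using L M by (auto simp: linear_comodule_def)
  have f': "vlinear M N f" "\<And>x. x \<in> vcarrier M \<Longrightarrow> tensor_map C N id f (coact M x) = coact N (f x)"
    and s': "vlinear L M s" "\<And>x. x \<in> vcarrier L \<Longrightarrow> tensor_map C M id s (coact L x) = coact M (s x)"
    using f s by (auto simp: comodule_hom_def)
  have lin: "vlinear L N (\<lambda>x. f (s x))" by (rule vlinear_compose[OF s'(1) f'(1)])
  have lin': "vlinear L N (compose (vcarrier L) f s)"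
    by (rule vlinear_cong[OF lin vL]) (simp add: compose_def)
  have "tensor_map C N id (compose (vcarrier L) f s) (coact L x) = coact N (f (s x))" if x: "x \<in> vcarrier L" for x
  proof -
    have c: "coact L x \<in> vcarrier (tensor_space C L)"
      using L x by (auto simp: linear_comodule_def dest: vlinear_closed)
    have "tensor_map C N id (compose (vcarrier L) f s) (coact L x) = tensor_map C N id (\<lambda>x. f (s x)) (coact L x)"
      by (rule tensor_map_id_eq[OF vlinear_id(1) lin' lin vL C _ c]) (simp add: compose_def)
    also have "\<dots> = tensor_map C N (\<lambda>v. id (id v)) (\<lambda>x. f (s x)) (coact L x)" by (simp only: id_apply id_def)
    also have "\<dots> = tensor_map C N id f (tensor_map C M id s (coact L x))"
      by (rule tensor_map_compose[OF vlinear_id(1) s'(1) vlinear_id(1) f'(1) vL C vM C c, symmetric])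
    also have "\<dots> = coact N (f (s x))"
      unfolding s'(2)[OF x] by (rule f'(2)[OF vlinear_closed[OF s'(1) x]])
    finally show ?thesis .
  qed
  with lin' show ?thesis by (simp add: comodule_hom_def) (simp add: compose_def)
qed

locale linear_comodule_End =
  fixes C :: "('k::field, 'c::ab_group_add, 'x) coalgebra_scheme"
    and J :: "('k, 'c, 'j::ab_group_add, 'y) comodule_scheme"
  assumes C: "vspace C" and J: "linear_comodule C J"
begin

sublocale JJ: comodule_pair C J J by unfold_locales (rule C J)+

abbreviation S where "S \<equiv> opposite_ring (comodule_End C J)"

lemma S_simps:
  "carrier S = comodule_hom C J J" "x \<otimes>\<^bsub>S\<^esub> y = compose (vcarrier J) y x" "\<one>\<^bsub>S\<^esub> = (\<lambda>x\<in>vcarrier J. x)"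
  "\<zero>\<^bsub>S\<^esub> = (\<lambda>x\<in>vcarrier J. 0)" "x \<oplus>\<^bsub>S\<^esub> y = (\<lambda>t\<in>vcarrier J. x t + y t)"
  by (simp_all add: opposite_ring_def comodule_End_def)

lemma hom_into: "f \<in> comodule_hom C J M \<Longrightarrow> x \<in> vcarrier J \<Longrightarrow> f x \<in> vcarrier M"
  by (auto simp: comodule_hom_def dest: vlinear_closed)

lemma hom_additive: "f \<in> comodule_hom C J M \<Longrightarrow> x \<in> vcarrier J \<Longrightarrow> y \<in> vcarrier J \<Longrightarrow> f (x + y) = f x + f y"
  by (auto simp: comodule_hom_def dest: vlinear_add)

lemma ring_S: "ring S"
proof (rule ringI)
  have g: "abelian_group (comodule_Hom C J J)" by (rule JJ.comodule_Hom_group)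
  then interpret G: abelian_group "comodule_Hom C J J" .
  show "abelian_group S"
  proof (rule abelian_groupI)
    fix f g h assume "f \<in> carrier S" "g \<in> carrier S" "h \<in> carrier S"
    then show "f \<oplus>\<^bsub>S\<^esub> g \<oplus>\<^bsub>S\<^esub> h = f \<oplus>\<^bsub>S\<^esub> (g \<oplus>\<^bsub>S\<^esub> h)"
      using G.a_assoc[of f g h] by (simp add: S_simps comodule_Hom_def)
  next
    fix f g assume "f \<in> carrier S" "g \<in> carrier S"
    then show "f \<oplus>\<^bsub>S\<^esub> g \<in> carrier S" "f \<oplus>\<^bsub>S\<^esub> g = g \<oplus>\<^bsub>S\<^esub> f"
      using G.a_closed[of f g] G.a_comm[of f g] by (simp_all add: S_simps comodule_Hom_def)
  next
    show "\<zero>\<^bsub>S\<^esub> \<in> carrier S" using G.zero_closed by (simp add: S_simps comodule_Hom_def)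
  next
    fix f assume "f \<in> carrier S"
    then show "\<zero>\<^bsub>S\<^esub> \<oplus>\<^bsub>S\<^esub> f = f" "\<exists>g\<in>carrier S. g \<oplus>\<^bsub>S\<^esub> f = \<zero>\<^bsub>S\<^esub>"
      using G.l_zero[of f] G.l_neg[of f] G.a_inv_closed[of f] by (auto simp: S_simps comodule_Hom_def)
  qed
  show "monoid S"
  proof (rule monoidI)
    fix f g assume "f \<in> carrier S" "g \<in> carrier S"
    then show "f \<otimes>\<^bsub>S\<^esub> g \<in> carrier S"
      unfolding S_simps by (intro comodule_hom_compose[OF C J J])
  next
    have "restrict (\<lambda>x. x) (vcarrier J) \<in> comodule_hom C J J"
    proof (rule JJ.homI)
      show "vlinear J J (\<lambda>x. x)" by (rule vlinear_id)
      fix x assume "x \<in> vcarrier J"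
      show "tensor_map C J id (\<lambda>x. x) (coact J x) = coact J x"
        by (rule vlinear_tensor_eqI[OF vlinear_tensor_map[OF vlinear_id(1) vlinear_id(2) JJ.vM C] vlinear_id(2) JJ.vM C _
              JJ.coact_M_in[OF \<open>x \<in> vcarrier J\<close>]])
          (simp add: tensor_map_tensor[OF vlinear_id(1) vlinear_id(2)])
    qed
    then show "\<one>\<^bsub>S\<^esub> \<in> carrier S" by (simp add: S_simps)
  next
    fix f g h assume "f \<in> carrier S" "g \<in> carrier S" "h \<in> carrier S"
    then show "f \<otimes>\<^bsub>S\<^esub> g \<otimes>\<^bsub>S\<^esub> h = f \<otimes>\<^bsub>S\<^esub> (g \<otimes>\<^bsub>S\<^esub> h)"
      by (auto simp: S_simps compose_def fun_eq_iff dest: hom_into)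
  next
    fix f assume f: "f \<in> carrier S"
    then have "f \<in> extensional (vcarrier J)" by (simp add: S_simps comodule_hom_def)
    then show "\<one>\<^bsub>S\<^esub> \<otimes>\<^bsub>S\<^esub> f = f" "f \<otimes>\<^bsub>S\<^esub> \<one>\<^bsub>S\<^esub> = f"
      using f by (auto simp: S_simps compose_def fun_eq_iff extensional_def dest: hom_into)
  qed
next
  fix f g h assume "f \<in> carrier S" "g \<in> carrier S" "h \<in> carrier S"
  then show "(f \<oplus>\<^bsub>S\<^esub> g) \<otimes>\<^bsub>S\<^esub> h = f \<otimes>\<^bsub>S\<^esub> h \<oplus>\<^bsub>S\<^esub> g \<otimes>\<^bsub>S\<^esub> h"
    "h \<otimes>\<^bsub>S\<^esub> (f \<oplus>\<^bsub>S\<^esub> g) = h \<otimes>\<^bsub>S\<^esub> f \<oplus>\<^bsub>S\<^esub> h \<otimes>\<^bsub>S\<^esub> g"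
    using JJ.vM by (auto simp: S_simps compose_def fun_eq_iff hom_into vsp_add hom_additive[where M = J])
qed

end

locale linear_comodule_Hom = linear_comodule_End C J
  for C :: "('k::field, 'c::ab_group_add, 'x) coalgebra_scheme"
    and J :: "('k, 'c, 'j::ab_group_add, 'y) comodule_scheme" +
  fixes N :: "('k, 'c, 'n::ab_group_add, 'z) comodule_scheme"
  assumes N: "linear_comodule C N"
begin

sublocale JN: comodule_pair C J N by unfold_locales (rule C J N)+

abbreviation H where "H \<equiv> comodule_Hom C J N"

lemma H_simps:
  "carrier H = comodule_hom C J N" "\<zero>\<^bsub>H\<^esub> = (\<lambda>x\<in>vcarrier J. 0)"
  "f \<oplus>\<^bsub>H\<^esub> g = (\<lambda>x\<in>vcarrier J. f x + g x)" "s \<odot>\<^bsub>H\<^esub> f = compose (vcarrier J) f s"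
  by (simp_all add: comodule_Hom_def)

lemma left_module_H: "left_module S H"
  unfolding left_module_def left_module_axioms_def
proof (intro conjI allI impI ring_S JN.comodule_Hom_group)
  show "a \<odot>\<^bsub>H\<^esub> x \<in> carrier H" if "a \<in> carrier S" "x \<in> carrier H" for a x
    using that unfolding S_simps H_simps by (intro comodule_hom_compose[OF C J J])
  show "(a \<oplus>\<^bsub>S\<^esub> b) \<odot>\<^bsub>H\<^esub> x = a \<odot>\<^bsub>H\<^esub> x \<oplus>\<^bsub>H\<^esub> b \<odot>\<^bsub>H\<^esub> x"
    if "a \<in> carrier S" "b \<in> carrier S" "x \<in> carrier H" for a b x
    using that by (auto simp: S_simps H_simps compose_def fun_eq_iff hom_into[where M = J] hom_additive[where M = N])
  show "a \<odot>\<^bsub>H\<^esub> (x \<oplus>\<^bsub>H\<^esub> y) = a \<odot>\<^bsub>H\<^esub> x \<oplus>\<^bsub>H\<^esub> a \<odot>\<^bsub>H\<^esub> y"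
    if "a \<in> carrier S" "x \<in> carrier H" "y \<in> carrier H" for a x y
    using that by (auto simp: S_simps H_simps compose_def fun_eq_iff hom_into[where M = J])
  show "a \<otimes>\<^bsub>S\<^esub> b \<odot>\<^bsub>H\<^esub> x = a \<odot>\<^bsub>H\<^esub> (b \<odot>\<^bsub>H\<^esub> x)"
    if "a \<in> carrier S" "b \<in> carrier S" "x \<in> carrier H" for a b x
    using that by (auto simp: S_simps H_simps compose_def fun_eq_iff hom_into[where M = J])
  show "\<one>\<^bsub>S\<^esub> \<odot>\<^bsub>H\<^esub> x = x" if "x \<in> carrier H" for x
    using JN.homD(1)[OF that[unfolded H_simps]] by (auto simp: S_simps H_simps compose_def fun_eq_iff extensional_def)
qed

context
  fixes \<theta> \<kappa>
  assumes \<theta>: "\<theta> \<in> comodule_hom C J N" and \<kappa>: "\<kappa> \<in> comodule_hom C N J"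
    and retract: "\<And>x. x \<in> vcarrier N \<Longrightarrow> \<theta> (\<kappa> x) = x"
begin

lemma compose_\<kappa>_in_S: "f \<in> carrier H \<Longrightarrow> compose (vcarrier J) \<kappa> f \<in> carrier S"
  unfolding S_simps H_simps by (intro comodule_hom_compose[OF C J N \<kappa>])

text \<open>Scalars act by precomposition, so \<open>\<kappa> \<circ> f\<close> takes
  \<open>\<theta>\<close> to \<open>\<theta> \<circ> \<kappa> \<circ> f = f\<close>: the module is
  cyclic, generated by \<open>\<theta>\<close>.\<close>

lemma retract_generates:
  assumes "f \<in> carrier H"
  shows "compose (vcarrier J) \<kappa> f \<odot>\<^bsub>H\<^esub> \<theta> = f"
  using assms JN.homD(1)[OF assms[unfolded H_simps]]
  by (auto simp: H_simps compose_def fun_eq_iff extensional_def retract hom_into[where M = N])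

lemma finitely_generated_retract: "finitely_generated_module S H"
  unfolding finitely_generated_module_def
proof (intro exI[of _ "{\<theta>}"] conjI ballI)
  interpret H: abelian_group H by (rule JN.comodule_Hom_group)
  fix f assume f: "f \<in> carrier H"
  show "\<exists>r\<in>{\<theta>} \<rightarrow> carrier S. f = (\<Oplus>\<^bsub>H\<^esub>a\<in>{\<theta>}. r a \<odot>\<^bsub>H\<^esub> a)"
  proof (rule bexI[of _ "\<lambda>_. compose (vcarrier J) \<kappa> f"])
    show "f = (\<Oplus>\<^bsub>H\<^esub>a\<in>{\<theta>}. compose (vcarrier J) \<kappa> f \<odot>\<^bsub>H\<^esub> a)"
      using f retract_generates[OF f] by (subst H.finsum_insert) simp_all
  qed (use compose_\<kappa>_in_S[OF f] in simp)
qed (use \<theta> in \<open>simp_all add: H_simps\<close>)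

lemma projective_retract: "projective_module S H"
proof -
  \<comment> \<open>\<open>projective_module\<close> takes its index sets from the type of module
    elements; a single arbitrary index presents \<open>S\<close> itself as a free module.\<close>
  let ?x = "undefined :: 'j \<Rightarrow> 'n"
  let ?F = "free_module S {?x}"
  let ?i = "\<lambda>f. \<lambda>x\<in>{?x}. compose (vcarrier J) \<kappa> f"
  let ?p = "\<lambda>\<phi>. compose (vcarrier J) \<theta> (\<phi> ?x)"
  have \<kappa>_into: "x \<in> vcarrier N \<Longrightarrow> \<kappa> x \<in> vcarrier J" for x
    using \<kappa> by (auto simp: comodule_hom_def dest: vlinear_closed)
  have \<kappa>_add: "x \<in> vcarrier N \<Longrightarrow> y \<in> vcarrier N \<Longrightarrow> \<kappa> (x + y) = \<kappa> x + \<kappa> y" for x y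
    using \<kappa> by (auto simp: comodule_hom_def dest: vlinear_add)
  have retr: "?p (?i f) = f" if "f \<in> carrier H" for f
    using retract_generates[OF that] by (simp add: H_simps)
  have p: "?p \<in> left_module_hom S ?F H"
    unfolding left_module_hom_def
  proof (intro CollectI conjI ballI funcsetI)
    fix \<phi> assume "\<phi> \<in> carrier ?F"
    then have \<phi>: "\<phi> ?x \<in> comodule_hom C J J" by (auto simp: free_module_def S_simps)
    then show "?p \<phi> \<in> carrier H" unfolding H_simps by (rule comodule_hom_compose[OF C J J \<theta>])
    {
      fix a assume a: "a \<in> carrier S"
      then show "?p (a \<odot>\<^bsub>?F\<^esub> \<phi>) = a \<odot>\<^bsub>H\<^esub> ?p \<phi>"
        by (auto simp: free_module_def S_simps H_simps compose_def fun_eq_iff hom_into[where M = J])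
    }
    fix \<psi> assume "\<psi> \<in> carrier ?F"
    then have \<psi>: "\<psi> ?x \<in> comodule_hom C J J" by (auto simp: free_module_def S_simps)
    show "?p (\<phi> \<oplus>\<^bsub>?F\<^esub> \<psi>) = ?p \<phi> \<oplus>\<^bsub>H\<^esub> ?p \<psi>"
      using \<phi> \<psi> \<theta> by (auto simp: free_module_def S_simps H_simps compose_def fun_eq_iff hom_into[where M = J] hom_additive[where M = N])
  qed
  have i: "?i \<in> left_module_hom S H ?F"
    unfolding left_module_hom_def
  proof (intro CollectI conjI ballI funcsetI)
    fix f assume f: "f \<in> carrier H"
    then show "?i f \<in> carrier ?F" using compose_\<kappa>_in_S[OF f] by (simp add: free_module_def)
    show "?i (a \<odot>\<^bsub>H\<^esub> f) = a \<odot>\<^bsub>?F\<^esub> ?i f" if "a \<in> carrier S" for a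
      using that f by (auto simp: free_module_def S_simps H_simps compose_def fun_eq_iff hom_into[where M = J])
    show "?i (f \<oplus>\<^bsub>H\<^esub> g) = ?i f \<oplus>\<^bsub>?F\<^esub> ?i g" if "g \<in> carrier H" for g
      using that f by (auto simp: free_module_def S_simps H_simps compose_def fun_eq_iff hom_into[where M = N] \<kappa>_add)
  qed
  show ?thesis
    unfolding projective_module_def
    by (intro exI[of _ "{?x}"] bexI[OF _ i] bexI[OF _ p] ballI retr)
qed

end

end

section \<open>The Koszul coresolution\<close>

context based_space begin

abbreviation JHom where "JHom n \<equiv> comodule_hom C J (cof (L n))"

abbreviation kd where "kd n \<equiv> koszul_diff scale (int n)"

abbreviation dK where "dK n f \<equiv> compose (vcarrier J) (koszul_diff scale n) f"

lemma linear_comodule_cof: "vspace V \<Longrightarrow> linear_comodule C (cof V)"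
  unfolding linear_comodule_def tensor_space_cof
  by (intro conjI vspace_cof linear_imp_vlinear) (simp_all add: linear_coact coact_in)

lemma koszul_diff_in:
  assumes "t \<in> CT (L n)"
  shows "kd n t \<in> CT (L (Suc n))"
  using assms vspace_L
proof (induction rule: tensor_C_induct)
  case zero
  show ?case unfolding linear_zeroD[OF linear_koszul_diff] by (rule vsp_zero[OF vspace_tensor])
next
  case (tensor \<alpha> \<omega>)
  show ?case unfolding koszul_diff_dmon[OF tensor]
    by (intro vsp_sum[OF vspace_tensor] tensor_in dmon_in_C MB_diff tensor(1) wedge_mult_in_L[OF tensor(2)])
next
  case (add x y)
  show ?case unfolding linear_addD[OF linear_koszul_diff] by (rule vsp_add[OF vspace_tensor add(3,4)])
qed

text \<open>Both composites remove \<open>\<beta>\<close> and one letter \<open>b\<close>, only in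
  different orders, and they run over the same \<open>b\<close>. By
  \<open>comodule_hom_cof_iff\<close> this is what makes the differential a comodule
  morphism.\<close>

lemma koszul_diff_shift:
  assumes "t \<in> CT (L n)" and \<beta>: "\<beta> \<in> MB"
  shows "kd n (shift (L n) \<beta> t) = shift (L (Suc n)) \<beta> (kd n t)"
  using assms(1) vspace_L
proof (induction rule: tensor_C_induct)
  case zero
  show ?case unfolding linear_zeroD[OF linear_koszul_diff] linear_zeroD[OF linear_shift] ..
next
  case (tensor \<alpha> \<omega>)
  let ?h = "\<lambda>\<gamma> b. tensor C (L (Suc n)) (e \<gamma>) (wedge_mult scale b \<omega>)"
  have iff: "b \<in># \<alpha> \<and> \<beta> \<subseteq># \<alpha> - {#b#} \<longleftrightarrow> \<beta> \<subseteq># \<alpha> \<and> b \<in># \<alpha> - \<beta>" for b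
    using submultiset_add_iff[of "{#b#}" \<beta> \<alpha>] submultiset_add_iff[of \<beta> "{#b#}" \<alpha>]
    unfolding add.commute[of \<beta> "{#b#}"] single_subset_iff by blast
  have "shift (L (Suc n)) \<beta> (kd n (tensor C (L n) (e \<alpha>) \<omega>)) =
      (\<Sum>b\<in>set_mset \<alpha>. if \<beta> \<subseteq># \<alpha> - {#b#} then ?h (\<alpha> - {#b#} - \<beta>) b else 0)"
    unfolding koszul_diff_dmon[OF tensor] linear_sumD[OF linear_shift]
    by (intro sum.cong refl shift_dmon[OF _ \<beta> _ vspace_L] MB_diff tensor(1) wedge_mult_in_L[OF tensor(2)])
  also have "\<dots> = (\<Sum>b\<in>{b \<in> set_mset \<alpha>. \<beta> \<subseteq># \<alpha> - {#b#}}. ?h (\<alpha> - {#b#} - \<beta>) b)"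
    by (rule sum.inter_filter[symmetric]) simp
  also have "\<dots> = (\<Sum>b\<in>{b. \<beta> \<subseteq># \<alpha> \<and> b \<in># \<alpha> - \<beta>}. ?h (\<alpha> - \<beta> - {#b#}) b)"
    by (rule sum.cong[OF Collect_cong[OF iff]]) (simp only: diff_right_commute[of \<alpha> _ \<beta>])
  also have "\<dots> = kd n (shift (L n) \<beta> (tensor C (L n) (e \<alpha>) \<omega>))"
  proof (cases "\<beta> \<subseteq># \<alpha>")
    case True
    have "{b. \<beta> \<subseteq># \<alpha> \<and> b \<in># \<alpha> - \<beta>} = set_mset (\<alpha> - \<beta>)" using True by blast
    then show ?thesis
      unfolding shift_dmon[OF tensor(1) \<beta> tensor(2) vspace_L] if_P[OF True]
        koszul_diff_dmon[OF MB_diff[OF tensor(1)] tensor(2)] by (rule sum.cong) (rule refl)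
  next
    case False
    have "{b. \<beta> \<subseteq># \<alpha> \<and> b \<in># \<alpha> - \<beta>} = {}" using False by blast
    then show ?thesis
      unfolding shift_dmon[OF tensor(1) \<beta> tensor(2) vspace_L] if_not_P[OF False]
        linear_zeroD[OF linear_koszul_diff] by (simp only: sum.empty)
  qed
  finally show ?case by (rule sym)
next
  case (add x y)
  show ?case unfolding linear_addD[OF linear_koszul_diff] linear_addD[OF linear_shift] add(3,4) ..
qed

lemma koszul_diff_hom:
  assumes f: "f \<in> JHom n"
  shows "dK (int n) f \<in> JHom (Suc n)"
  unfolding comodule_hom_cof_iff[OF vspace_W vspace_L]
proof (intro conjI ballI)
  note f' = comodule_hom_cofD[OF f vspace_W vspace_L]
  have lin: "vlinear J (cof (L n)) f" using f by (simp add: comodule_hom_def)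
  have k: "vlinear (cof (L n)) (cof (L (Suc n))) (kd n)"
    by (rule linear_imp_vlinear) (simp_all add: linear_koszul_diff koszul_diff_in)
  show "dK (int n) f \<in> extensional (CT W)"
    by (simp add: compose_def)
  show "vlinear J (cof (L (Suc n))) (dK (int n) f)"
    by (rule vlinear_cong[OF vlinear_compose[OF lin k] vspace_cof]) (simp add: compose_def)
  fix t \<beta> assume t: "t \<in> CT W" and \<beta>: "\<beta> \<in> MB"
  show "dK (int n) f (shift W \<beta> t) =
      shift (L (Suc n)) \<beta> (dK (int n) f t)"
    using t shift_in[OF t vspace_W \<beta>]
    by (simp add: compose_def f'(3)[OF t \<beta>] koszul_diff_shift[OF f'(4)[OF t] \<beta>])
qed

text \<open>The basis vector \<open>b\<close> of the source is a mere parameter: the differential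
  acts on the family of each \<open>b\<close> separately.\<close>

abbreviation fam where "fam n f b \<alpha> \<equiv> coord (L n) {#} (f (tensor C W (e \<alpha>) b))"

lemma family_fam:
  assumes "f \<in> JHom n"
  shows "family n (fam n f b)"
  unfolding family_def
proof
  fix \<alpha> assume "\<alpha> \<in> MB"
  from comodule_hom_cofD(4)[OF assms vspace_W vspace_L basis_in_J[OF this]]
  show "fam n f b \<alpha> \<in> vcarrier (L n)" by (rule coord_in[OF _ vspace_L]) simp
qed

text \<open>Only a one-letter \<open>\<beta>\<close> becomes empty when one letter is removed. The
  sum is written over the letters of \<open>\<alpha>\<close>, independently of
  \<open>\<beta>\<close>, so that it can be interchanged with the sum over \<open>\<beta>\<close> in
  \<open>fam_koszul_diff\<close>.\<close>

lemma coord_empty_koszul_diff: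
  assumes \<beta>: "\<beta> \<in> MB" and \<omega>: "\<omega> \<in> vcarrier (L n)" and sub: "\<beta> \<subseteq># \<alpha>"
  shows "coord (L (Suc n)) {#} (kd n (tensor C (L n) (e \<beta>) \<omega>)) =
    (\<Sum>c\<in>set_mset \<alpha>. if \<beta> = {#c#} then wedge_mult scale c \<omega> else 0)"
proof -
  have "coord (L (Suc n)) {#} (kd n (tensor C (L n) (e \<beta>) \<omega>)) =
      (\<Sum>c\<in>set_mset \<beta>. if \<beta> - {#c#} = {#} then wedge_mult scale c \<omega> else 0)"
    unfolding koszul_diff_dmon[OF \<beta> \<omega>] linear_sumD[OF linear_coord[OF vspace_L]]
    by (intro sum.cong refl coord_dmon[OF vspace_L MB_diff[OF \<beta>]]) simp
  also have "\<dots> = (\<Sum>c\<in>set_mset \<beta>. if \<beta> = {#c#} then wedge_mult scale c \<omega> else 0)"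
  proof (rule sum.cong[OF refl])
    fix c assume "c \<in># \<beta>"
    then have "\<beta> - {#c#} = {#} \<longleftrightarrow> \<beta> = {#c#}" by (auto dest: insert_DiffM)
    then show "(if \<beta> - {#c#} = {#} then wedge_mult scale c \<omega> else 0) = (if \<beta> = {#c#} then wedge_mult scale c \<omega> else 0)"
      by (simp only:)
  qed
  also have "\<dots> = (\<Sum>c\<in>set_mset \<alpha>. if \<beta> = {#c#} then wedge_mult scale c \<omega> else 0)"
    using set_mset_mono[OF sub] by (intro sum.mono_neutral_left) auto
  finally show ?thesis .
qed

text \<open>The expansion of \<open>f\<close> through its own empty coordinates expresses the empty
  coordinate of the differential of \<open>f\<close> by them; only the summands with a one-letter
  \<open>\<beta>\<close> survive.\<close>

lemma fam_koszul_diff: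
  assumes f: "f \<in> JHom n" and \<alpha>: "\<alpha> \<in> MB"
  shows "fam (Suc n) (dK (int n) f) b \<alpha> = dfam (fam n f b) \<alpha>"
proof -
  note F = familyD[OF family_fam[OF f]]
  have "fam (Suc n) (dK (int n) f) b \<alpha> =
      coord (L (Suc n)) {#} (kd n (f (tensor C W (e \<alpha>) b)))"
    using basis_in_J[OF \<alpha>, of b] by (simp add: compose_def)
  also have "\<dots> = (\<Sum>\<beta>\<in>below \<alpha>. coord (L (Suc n)) {#} (kd n (tensor C (L n) (e \<beta>) (fam n f b (\<alpha> - \<beta>)))))"
    by (subst hom_expansion[OF vspace_L f \<alpha>])
      (simp only: linear_sumD[OF linear_koszul_diff] linear_sumD[OF linear_coord[OF vspace_L]])
  also have "\<dots> = (\<Sum>\<beta>\<in>below \<alpha>. \<Sum>c\<in>set_mset \<alpha>. if \<beta> = {#c#} then wedge_mult scale c (fam n f b (\<alpha> - \<beta>)) else 0)"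
  proof (rule sum.cong[OF refl])
    fix \<beta> assume "\<beta> \<in> below \<alpha>"
    then have sub: "\<beta> \<subseteq># \<alpha>" by simp
    show "coord (L (Suc n)) {#} (kd n (tensor C (L n) (e \<beta>) (fam n f b (\<alpha> - \<beta>)))) =
      (\<Sum>c\<in>set_mset \<alpha>. if \<beta> = {#c#} then wedge_mult scale c (fam n f b (\<alpha> - \<beta>)) else 0)"
      by (rule coord_empty_koszul_diff[OF MB_submultiset[OF \<alpha> sub] F[OF MB_diff[OF \<alpha>]] sub])
  qed
  also have "\<dots> = (\<Sum>c\<in>set_mset \<alpha>. \<Sum>\<beta>\<in>below \<alpha>. if \<beta> = {#c#} then wedge_mult scale c (fam n f b (\<alpha> - \<beta>)) else 0)"
    by (rule sum.swap)
  also have "\<dots> = dfam (fam n f b) \<alpha>"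
    unfolding dfam_def
  proof (rule sum.cong[OF refl])
    fix c assume "c \<in># \<alpha>"
    then show "(\<Sum>\<beta>\<in>below \<alpha>. if \<beta> = {#c#} then wedge_mult scale c (fam n f b (\<alpha> - \<beta>)) else 0) =
        wedge_mult scale c (fam n f b (\<alpha> - {#c#}))"
      by (subst sum.delta[OF finite_submultisets]) (simp only: mem_Collect_eq single_subset_iff if_True)
  qed
  finally show ?thesis .
qed

lemma zero_hom_J: "linear_comodule C N \<Longrightarrow> (\<lambda>x\<in>vcarrier J. 0) \<in> comodule_hom C J N"
  by (rule comodule_pair.hom_zero)
    (unfold_locales, rule vspace_C, rule linear_comodule_cof[OF vspace_W])

lemma fam_zero: "\<alpha> \<in> MB \<Longrightarrow> fam n (\<lambda>x\<in>vcarrier J. 0) b \<alpha> = 0"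
  using basis_in_J[of \<alpha> b] linear_zeroD[OF linear_coord[OF vspace_L, of n "{#}"]] by simp

lemma koszul_diff_diff:
  assumes f: "f \<in> JHom n"
  shows "dK (int (Suc n)) (dK (int n) f)
    = (\<lambda>x\<in>vcarrier J. 0)"
proof (rule hom_family_ext[OF vspace_L])
  note df = koszul_diff_hom[OF f]
  show "dK (int (Suc n)) (dK (int n) f)
    \<in> comodule_hom C J (cof (L (Suc (Suc n))))" by (rule koszul_diff_hom[OF df])
  show "(\<lambda>x\<in>vcarrier J. 0) \<in> comodule_hom C J (cof (L (Suc (Suc n))))"
    by (rule zero_hom_J[OF linear_comodule_cof[OF vspace_L]])
  fix \<alpha> b assume \<alpha>: "\<alpha> \<in> MB"
  show "fam (Suc (Suc n)) (dK (int (Suc n)) (dK (int n) f)) b \<alpha>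
    = fam (Suc (Suc n)) (\<lambda>x\<in>vcarrier J. 0) b \<alpha>"
    unfolding fam_koszul_diff[OF df \<alpha>] fam_zero[OF \<alpha>]
    using dfam_cong[OF \<alpha>, of "fam (Suc n) (dK (int n) f) b" "dfam (fam n f b)"]
      fam_koszul_diff[OF f, of _ b] dfam_dfam[OF family_fam[OF f] \<alpha>, of b] by metis
qed

lemma closed_fam:
  assumes f: "f \<in> JHom n"
    and closed: "dK (int n) f = (\<lambda>x\<in>vcarrier J. 0)" and \<alpha>: "\<alpha> \<in> MB"
  shows "dfam (fam n f b) \<alpha> = 0"
  using fam_koszul_diff[OF f \<alpha>, of b] unfolding closed fam_zero[OF \<alpha>] by (rule sym)

lemma koszul_exact_0:
  assumes inf: "infinite B" and f: "f \<in> comodule_hom C J (cof (L 0))"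
    and closed: "dK 0 f = (\<lambda>x\<in>vcarrier J. 0)"
  shows "f = (\<lambda>x\<in>vcarrier J. 0)"
proof (rule hom_family_ext[OF vspace_L f])
  show "(\<lambda>x\<in>vcarrier J. 0) \<in> comodule_hom C J (cof (L 0))"
    by (rule zero_hom_J[OF linear_comodule_cof[OF vspace_L]])
  fix \<alpha> b assume \<alpha>: "\<alpha> \<in> MB"
  have "dK (int 0) f = (\<lambda>x\<in>vcarrier J. 0)" using closed by simp
  from closed_family_zero[OF inf family_fam[OF f] closed_fam[OF f this] \<alpha>]
  show "fam 0 f b \<alpha> = fam 0 (\<lambda>x\<in>vcarrier J. 0) b \<alpha>" unfolding fam_zero[OF \<alpha>] .
qed

lemma koszul_exact_Suc:
  assumes inf: "infinite B" and f: "f \<in> JHom (Suc n)"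
    and closed: "dK (int (Suc n)) f = (\<lambda>x\<in>vcarrier J. 0)"
  shows "\<exists>g\<in>JHom n. f = dK (int n) g"
proof -
  \<comment> \<open>Primitives are chosen for each \<open>b\<close> independently; cofreeness
    assembles any such choice into a morphism.\<close>
  have "\<forall>b. \<exists>H. family n H \<and> (\<forall>\<alpha>\<in>MB. fam (Suc n) f b \<alpha> = dfam H \<alpha>)"
    by (intro allI closed_family_exact[OF inf family_fam[OF f] closed_fam[OF f closed]])
  then obtain H where H: "\<forall>b. family n (H b) \<and> (\<forall>\<alpha>\<in>MB. fam (Suc n) f b \<alpha> = dfam (H b) \<alpha>)"
    by (rule choice[THEN exE])
  have "\<And>\<alpha> b. \<alpha> \<in> MB \<Longrightarrow> b \<in> B \<Longrightarrow> H b \<alpha> \<in> vcarrier (L n)"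
    by (rule familyD) (use H in blast)+
  from hom_of_family[where F = "\<lambda>\<alpha> b. H b \<alpha>", OF vspace_L vscale_L this]
  obtain g where g: "g \<in> JHom n" and gH: "\<forall>\<alpha>\<in>MB. \<forall>b\<in>B. fam n g b \<alpha> = H b \<alpha>" by blast
  have "f = dK (int n) g"
  proof (rule hom_family_ext[OF vspace_L f koszul_diff_hom[OF g]])
    fix \<alpha> b assume \<alpha>: "\<alpha> \<in> MB" and b: "b \<in> B"
    have "fam (Suc n) f b \<alpha> = dfam (H b) \<alpha>" using H \<alpha> by blast
    also have "\<dots> = dfam (fam n g b) \<alpha>"
      by (rule dfam_cong[OF \<alpha>], rule bspec[OF bspec[OF gH] b, symmetric])
    finally show "fam (Suc n) f b \<alpha> = fam (Suc n) (dK (int n) g) b \<alpha>"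
      unfolding fam_koszul_diff[OF g \<alpha>] .
  qed
  with g show ?thesis by blast
qed

section \<open>Exterior powers as direct summands of \<open>W\<close>\<close>

lemma inj_words:
  assumes inf: "infinite B"
  shows "\<exists>j. inj_on j {xs \<in> lists B. length xs = n} \<and> j ` {xs \<in> lists B. length xs = n} \<subseteq> B"
proof (induction n)
  case 0
  obtain b where "b \<in> B" using inf by (metis ex_in_conv finite.emptyI)
  then show ?case by (intro exI[of _ "\<lambda>_. b"]) (auto intro!: inj_onI)
next
  case (Suc n)
  then obtain j where j: "inj_on j {xs \<in> lists B. length xs = n}" "j ` {xs \<in> lists B. length xs = n} \<subseteq> B" by blast
  obtain h where h: "inj_on h (B \<times> B)" "h ` (B \<times> B) \<subseteq> B"
    using card_of_Times_same_infinite[OF inf] card_of_ordLeq[of "B \<times> B" B] by (auto simp: ordIso_iff_ordLeq)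
  show ?case
  proof (intro exI[of _ "\<lambda>xs. h (hd xs, j (tl xs))"] conjI inj_onI)
    fix xs ys assume xs: "xs \<in> {xs \<in> lists B. length xs = Suc n}" and ys: "ys \<in> {xs \<in> lists B. length xs = Suc n}"
      and eq: "h (hd xs, j (tl xs)) = h (hd ys, j (tl ys))"
    obtain x xs' where x: "xs = x # xs'" "x \<in> B" "xs' \<in> {xs \<in> lists B. length xs = n}"
      using xs by (cases xs) auto
    obtain y ys' where y: "ys = y # ys'" "y \<in> B" "ys' \<in> {xs \<in> lists B. length xs = n}"
      using ys by (cases ys) auto
    have "(x, j xs') = (y, j ys')"
      by (rule inj_onD[OF h(1)]) (use eq x y j(2) in auto)
    then show "xs = ys" using inj_onD[OF j(1) _ x(3) y(3)] x(1) y(1) by simp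
  next
    show "(\<lambda>xs. h (hd xs, j (tl xs))) ` {xs \<in> lists B. length xs = Suc n} \<subseteq> B"
    proof (rule image_subsetI)
      fix xs assume "xs \<in> {xs \<in> lists B. length xs = Suc n}"
      then obtain x xs' where x: "xs = x # xs'" "x \<in> B" "xs' \<in> {xs \<in> lists B. length xs = n}" by (cases xs) auto
      then have "(x, j xs') \<in> B \<times> B" using j(2) by blast
      then show "h (hd xs, j (tl xs)) \<in> B" using h(2) unfolding x(1) list.sel by blast
    qed
  qed
qed

text \<open>A basis \<open>E\<close> of the exterior power is picked among the wedges of words over
  \<open>B\<close>. Choosing a word for each of its elements and embedding the words in
  \<open>B\<close> embeds \<open>E\<close> in \<open>B\<close>; \<open>i\<close> follows this
  embedding, and \<open>p\<close> inverts it and kills the rest of \<open>B\<close>.\<close>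

lemma exterior_power_retract:
  assumes inf: "infinite B"
  shows "\<exists>i p. vlinear (L n) W i \<and> vlinear W (L n) p \<and> (\<forall>\<omega>\<in>vcarrier (L n). p (i \<omega>) = \<omega>)"
proof -
  let ?X = "{xs \<in> lists B. length xs = n}"
  obtain j where j: "inj_on j ?X" "j ` ?X \<subseteq> B" using inj_words[OF inf] by blast
  obtain E where E: "E \<subseteq> wedge scale ` ?X" "fs.independent E" "wedge scale ` ?X \<subseteq> fspan E"
    by (rule fs.maximal_independent_subset)
  have span: "vcarrier (L n) = fspan E"
    unfolding L_basis
    by (rule subset_antisym[OF fs.span_minimal[OF E(3) fs.subspace_span] fs.span_mono[OF E(1)]])
  let ?\<phi> = "\<lambda>x. j (inv_into ?X (wedge scale) x)"
  have E_inv: "inv_into ?X (wedge scale) x \<in> ?X" "wedge scale (inv_into ?X (wedge scale) x) = x" if "x \<in> E" for x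
    using inv_into_into[OF subsetD[OF E(1) that]] f_inv_into_f[OF subsetD[OF E(1) that]] .
  have \<phi>B: "?\<phi> x \<in> B" if "x \<in> E" for x
    using E_inv(1)[OF that] j(2) by blast
  have \<phi>inj: "inj_on ?\<phi> E"
  proof (rule inj_onI)
    fix x y assume x: "x \<in> E" and y: "y \<in> E" and eq: "?\<phi> x = ?\<phi> y"
    have "inv_into ?X (wedge scale) x = inv_into ?X (wedge scale) y"
      by (rule inj_onD[OF j(1) eq E_inv(1)[OF x] E_inv(1)[OF y]])
    then have "wedge scale (inv_into ?X (wedge scale) x) = wedge scale (inv_into ?X (wedge scale) y)" by (rule arg_cong)
    then show "x = y" unfolding E_inv(2)[OF x] E_inv(2)[OF y] .
  qed
  interpret LW: vector_space_pair "fscale :: 'k \<Rightarrow> (('w list \<Rightarrow> 'k) \<Rightarrow> 'k) \<Rightarrow> _" scale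
    by (simp add: vector_space_pair_def vector_space_fscale vector_space_axioms)
  interpret WL: vector_space_pair scale "fscale :: 'k \<Rightarrow> (('w list \<Rightarrow> 'k) \<Rightarrow> 'k) \<Rightarrow> _"
    by (simp add: vector_space_pair_def vector_space_fscale vector_space_axioms)
  obtain i where i: "Vector_Spaces.linear fscale scale i" "\<forall>x\<in>E. i x = ?\<phi> x"
    using LW.linear_independent_extend[OF E(2), of ?\<phi>] by (elim exE conjE)
  obtain p where p: "wlinear p" "\<forall>b\<in>B. p b = (if b \<in> ?\<phi> ` E then inv_into E ?\<phi> b else 0)"
    using WL.linear_independent_extend[OF indep, of "\<lambda>b. if b \<in> ?\<phi> ` E then inv_into E ?\<phi> b else 0"] by (elim exE conjE)
  have pB: "p b \<in> fspan E" if "b \<in> B" for b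
  proof (cases "b \<in> ?\<phi> ` E")
    case True
    then have "p b = inv_into E ?\<phi> b" using p(2) that by (simp only: if_True)
    with inv_into_into[OF True] show ?thesis by (simp only: fs.span_base)
  next
    case False
    then have "p b = 0" using p(2) that by (simp only: if_False)
    then show ?thesis by (simp only: fs.span_zero)
  qed
  have p_in: "p w \<in> vcarrier (L n)" for w
  proof -
    have "w \<in> span B" by (simp add: span_B)
    then show ?thesis unfolding span
    proof (induction rule: span_induct_alt)
      case base
      show ?case unfolding linear_zeroD[OF p(1)] by (rule fs.span_zero)
    next
      case (step c x y)
      show ?case unfolding linear_addD[OF p(1)] linear_scaleD[OF p(1)]
        by (rule fs.span_add[OF fs.span_scale[OF pB[OF step(1)]] step(2)])
    qed
  qed
  have pi: "p (i \<omega>) = \<omega>" if "\<omega> \<in> vcarrier (L n)" for \<omega>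
    using that unfolding span
  proof (induction rule: fs.span_induct_alt)
    case base
    show ?case unfolding linear_zeroD[OF i(1)] linear_zeroD[OF p(1)] ..
  next
    case (step c x y)
    have "p (i x) = p (?\<phi> x)" using i(2) step(1) by (simp only:)
    also have "\<dots> = inv_into E ?\<phi> (?\<phi> x)"
      using p(2) \<phi>B[OF step(1)] imageI[OF step(1), of ?\<phi>] by (simp only: if_True)
    also have "\<dots> = x" by (rule inv_into_f_f[OF \<phi>inj step(1)])
    finally have "p (i x) = x" .
    then show ?case
      unfolding linear_addD[OF i(1)] linear_scaleD[OF i(1)] linear_addD[OF p(1)] linear_scaleD[OF p(1)] step(2)
      by (simp only:)
  qed
  have "vlinear (L n) W i" by (rule linear_imp_vlinear) (simp_all add: i(1))
  moreover have "vlinear W (L n) p" by (rule linear_imp_vlinear) (simp_all add: p(1) p_in)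
  ultimately show ?thesis using pi by blast
qed

section \<open>Morphisms of cofree comodules induced by linear maps\<close>

definition cof_map where
  "cof_map V U h = restrict (tensor_map C U id h) (vcarrier (cof V))"

lemma cof_map_tensor:
  assumes "vlinear V U h" "c \<in> vcarrier C" "v \<in> vcarrier V"
  shows "cof_map V U h (tensor C V c v) = tensor C U c (h v)"
  using tensor_in[OF assms(2,3)] tensor_map_tensor[OF vlinear_id(1) assms(1), of C c v]
  by (simp add: cof_map_def)

lemma cof_map_hom:
  assumes h: "vlinear V U h" and V: "vspace V" and U: "vspace U"
  shows "cof_map V U h \<in> comodule_hom C (cof V) (cof U)"
  unfolding comodule_hom_cof_iff[OF V U]
proof (intro conjI ballI)
  let ?g = "tensor_map C U id h"
  show "cof_map V U h \<in> extensional (CT V)" by (simp add: cof_map_def)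
  have "vlinear (tensor_space C V) (tensor_space C U) ?g"
    by (rule vlinear_tensor_map[OF vlinear_id(1) h V vspace_C])
  then have g: "vlinear (cof V) (cof U) ?g" by (simp add: vlinear_def)
  show "vlinear (cof V) (cof U) (cof_map V U h)"
    by (rule vlinear_cong[OF g vspace_cof]) (simp add: cof_map_def)
  fix t \<beta> assume t: "t \<in> CT V" and \<beta>: "\<beta> \<in> MB"
  have "?g (shift V \<beta> t) = shift U \<beta> (?g t)"
    using t V
  proof (induction rule: tensor_C_induct)
    case zero
    show ?case by (simp only: linear_zeroD[OF linear_tensor_map] linear_zeroD[OF linear_shift])
  next
    case (tensor \<alpha> v)
    have gt: "?g (tensor C V c v) = tensor C U c (h v)" for c
      by (simp only: tensor_map_tensor[OF vlinear_id(1) h] id_apply)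
    show ?case
      unfolding gt shift_dmon[OF tensor(1) \<beta> tensor(2) V]
        shift_dmon[OF tensor(1) \<beta> vlinear_closed[OF h tensor(2)] U]
    proof (cases "\<beta> \<subseteq># \<alpha>")
      case True
      show "?g (if \<beta> \<subseteq># \<alpha> then tensor C V (e (\<alpha> - \<beta>)) v else 0) = (if \<beta> \<subseteq># \<alpha> then tensor C U (e (\<alpha> - \<beta>)) (h v) else 0)"
        unfolding if_P[OF True] by (rule gt)
    next
      case False
      show "?g (if \<beta> \<subseteq># \<alpha> then tensor C V (e (\<alpha> - \<beta>)) v else 0) = (if \<beta> \<subseteq># \<alpha> then tensor C U (e (\<alpha> - \<beta>)) (h v) else 0)"
        unfolding if_not_P[OF False] by (rule linear_zeroD[OF linear_tensor_map])
    qed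
  next
    case (add x y)
    show ?case unfolding linear_addD[OF linear_tensor_map] linear_addD[OF linear_shift] add(3,4) ..
  qed
  then show "cof_map V U h (shift V \<beta> t) = shift U \<beta> (cof_map V U h t)"
    using t shift_in[OF t V \<beta>] by (simp add: cof_map_def)
qed

lemma cof_map_retract:
  assumes i: "vlinear V U i" and p: "vlinear U V p" and V: "vspace V" and U: "vspace U"
    and pi: "\<And>v. v \<in> vcarrier V \<Longrightarrow> p (i v) = v" and x: "x \<in> vcarrier (cof V)"
  shows "cof_map U V p (cof_map V U i x) = x"
proof -
  note hp = comodule_hom_cofD[OF cof_map_hom[OF p U V] U V] and hi = comodule_hom_cofD[OF cof_map_hom[OF i V U] V U]
  show ?thesis
    by (rule vlinear_tensor_eqI[OF vlinear_compose[OF hi(2) hp(2)] vlinear_id(2) V vspace_C])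
      (use x pi vlinear_closed[OF i] in \<open>simp_all add: cof_map_tensor[OF i] cof_map_tensor[OF p]\<close>)
qed


section \<open>The complex of modules over \<open>S\<close>\<close>

abbreviation K where "K \<equiv> koszul_term scale"
abbreviation SJ where "SJ \<equiv> opposite_ring (comodule_End C J)"
abbreviation HJ where "HJ n \<equiv> comodule_Hom C J (K n)"

lemma koszul_term_nat: "K (int n) = cof (L n)"
  by (simp add: koszul_term_def)

lemma koszul_term_neg: "n < 0 \<Longrightarrow> K n = zero_comodule"
  by (simp add: koszul_term_def)

lemma linear_comodule_koszul_term: "linear_comodule C (K n)"
proof (cases "n < 0")
  case True
  show ?thesis unfolding koszul_term_neg[OF True] by (rule linear_comodule_zero)
next
  case False
  then obtain m where "n = int m" by (metis nonneg_int_cases not_less)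
  then show ?thesis by (simp only: koszul_term_nat linear_comodule_cof[OF vspace_L])
qed

lemma linear_comodule_J: "linear_comodule C J"
  by (rule linear_comodule_cof[OF vspace_W])

lemma Hom_koszul: "linear_comodule_Hom C J (K n)"
  by unfold_locales (rule vspace_C linear_comodule_J linear_comodule_koszul_term)+

lemma hom_koszul_neg:
  assumes n: "n < 0" and f: "f \<in> comodule_hom C J (K n)"
  shows "f = (\<lambda>x\<in>vcarrier J. 0)"
proof (rule extensionalityI)
  show "f \<in> extensional (vcarrier J)" using f by (simp add: comodule_hom_def)
  fix x assume x: "x \<in> vcarrier J"
  have "vlinear J (K n) f" using f by (simp add: comodule_hom_def)
  from vlinear_closed[OF this x] have "f x = 0" by (simp add: koszul_term_neg[OF n] zero_comodule_def)
  then show "f x = (\<lambda>x\<in>vcarrier J. 0) x" using x by simp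
qed simp

lemma dK_neg: "n < 0 \<Longrightarrow> dK n f = (\<lambda>x\<in>vcarrier J. 0)"
  by (simp add: koszul_diff_def compose_def)

lemma dK_zero: "dK n (\<lambda>x\<in>vcarrier J. 0) = (\<lambda>x\<in>vcarrier J. 0)"
  using linear_zeroD[OF linear_koszul_diff, of n] by (simp add: compose_def fun_eq_iff)

lemma dK_closed:
  assumes "f \<in> comodule_hom C J (K n)"
  shows "dK n f \<in> comodule_hom C J (K (n + 1))"
proof (cases "n < 0")
  case True
  show ?thesis unfolding dK_neg[OF True] by (rule zero_hom_J[OF linear_comodule_koszul_term])
next
  case False
  then obtain m where n: "n = int m" by (metis nonneg_int_cases not_less)
  have Suc: "int m + 1 = int (Suc m)" by simp
  show ?thesis using assms unfolding n Suc koszul_term_nat by (rule koszul_diff_hom)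
qed

lemma dK_dK:
  assumes "f \<in> comodule_hom C J (K n)"
  shows "dK (n + 1) (dK n f) = (\<lambda>x\<in>vcarrier J. 0)"
proof (cases "n < 0")
  case True
  show ?thesis unfolding dK_neg[OF True] by (rule dK_zero)
next
  case False
  then obtain m where n: "n = int m" by (metis nonneg_int_cases not_less)
  have Suc: "int m + 1 = int (Suc m)" by simp
  show ?thesis using assms unfolding n Suc koszul_term_nat by (rule koszul_diff_diff)
qed

lemma dK_exact:
  assumes inf: "infinite B" and f: "f \<in> comodule_hom C J (K n)" and closed: "dK n f = (\<lambda>x\<in>vcarrier J. 0)"
  shows "f \<in> dK (n - 1) ` comodule_hom C J (K (n - 1))"
proof -
  have zero: "(\<lambda>x\<in>vcarrier J. 0) \<in> dK (n - 1) ` comodule_hom C J (K (n - 1))"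
    by (rule image_eqI, rule dK_zero[symmetric], rule zero_hom_J[OF linear_comodule_koszul_term])
  show ?thesis
  proof (cases "n < 0")
    case True
    from hom_koszul_neg[OF this f] zero show ?thesis by (simp only:)
  next
    case False
    then obtain m where m: "n = int m" by (metis nonneg_int_cases not_less)
    show ?thesis
    proof (cases m)
      case 0
      have n: "n = 0" using m 0 by simp
      have K0: "K 0 = cof (L 0)" using koszul_term_nat[of 0] by simp
      have "f = (\<lambda>x\<in>vcarrier J. 0)"
        by (rule koszul_exact_0[OF inf f[unfolded n K0] closed[unfolded n]])
      with zero show ?thesis by (simp only:)
    next
      case (Suc l)
      have n: "n = int (Suc l)" using m Suc by simp
      have l: "int (Suc l) - 1 = int l" by simp
      from koszul_exact_Suc[OF inf f[unfolded n koszul_term_nat] closed[unfolded n]]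
      show ?thesis unfolding n l koszul_term_nat by (elim bexE) (rule image_eqI)
    qed
  qed
qed

text \<open>Finite generation and projectivity follow from this, and in degree 1 it supplies the
  generator used against contractibility. In nonnegative degrees the retraction of \<open>W\<close>
  onto the exterior power is tensored with \<open>C\<close>.\<close>

lemma koszul_term_retract:
  assumes inf: "infinite B"
  shows "\<exists>\<theta>\<in>comodule_hom C J (K n). \<exists>\<kappa>\<in>comodule_hom C (K n) J. \<forall>x\<in>vcarrier (K n). \<theta> (\<kappa> x) = x"
proof (cases "n < 0")
  case True
  have \<kappa>: "(\<lambda>x\<in>vcarrier (K n). 0) \<in> comodule_hom C (K n) J"
    by (rule comodule_pair.hom_zero)
      (unfold_locales, (rule vspace_C linear_comodule_J linear_comodule_koszul_term)+)
  have retract: "\<forall>x\<in>vcarrier (K n). (\<lambda>x\<in>vcarrier J. 0) ((\<lambda>x\<in>vcarrier (K n). 0) x) = x"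
    using vsp_zero[OF vspace_tensor[of C W]] by (simp add: koszul_term_neg[OF True] zero_comodule_def)
  show ?thesis by (rule bexI[OF _ zero_hom_J[OF linear_comodule_koszul_term]], rule bexI[OF _ \<kappa>], rule retract)
next
  case False
  then obtain m where n: "n = int m" by (metis nonneg_int_cases not_less)
  obtain i p where ip: "vlinear (L m) W i" "vlinear W (L m) p" "\<forall>\<omega>\<in>vcarrier (L m). p (i \<omega>) = \<omega>"
    using exterior_power_retract[OF inf, of m] by (elim exE conjE)
  have retract: "\<forall>x\<in>vcarrier (cof (L m)). cof_map W (L m) p (cof_map (L m) W i x) = x"
    using cof_map_retract[OF ip(1,2) vspace_L vspace_W] ip(3) by blast
  show ?thesis unfolding n koszul_term_nat
    by (rule bexI[OF _ cof_map_hom[OF ip(2) vspace_W vspace_L]],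
        rule bexI[OF _ cof_map_hom[OF ip(1) vspace_L vspace_W]], rule retract)
qed

lemma wedge_Nil_nonzero: "wedge scale [] \<noteq> 0"
proof
  \<comment> \<open>Multilinearity concerns only words with at least one letter, and on these the
    form is zero.\<close>
  let ?\<phi> = "\<lambda>xs :: 'w list. if xs = [] then 1 else 0 :: 'k"
  assume "wedge scale [] = 0"
  then have "wedge scale [] ?\<phi> = 0" by (simp only: zero_fun_apply)
  moreover have "?\<phi> \<in> alternating_forms scale"
    by (auto simp: alternating_forms_def multilinear_forms_def linear_zero_form)
  ultimately show False by (simp add: wedge_def ev_def)
qed

text \<open>
  The unit element \<open>e {#} \<otimes> \<omega>\<close> of the term of degree \<open>0\<close> is killed by the differential, but it is
  a value of some morphism from \<open>J\<close>.  Evaluating a contracting homotopy at that morphism gives a contradiction.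
\<close>

lemma exists_hom_nonzero:
  assumes inf: "infinite B"
  shows "\<exists>f\<in>comodule_hom C J (K 0). \<exists>x\<in>vcarrier J. f x \<noteq> 0 \<and> koszul_diff scale 0 (f x) = 0"
proof -
  obtain i p where ip: "vlinear (L 0) W i" "vlinear W (L 0) p" "\<forall>\<omega>\<in>vcarrier (L 0). p (i \<omega>) = \<omega>"
    using exterior_power_retract[OF inf, of 0] by (elim exE conjE)
  let ?\<omega> = "wedge scale []"
  have \<omega>: "?\<omega> \<in> vcarrier (L 0)" by (rule wedge_in_L) simp
  let ?x = "tensor C W (e {#}) (i ?\<omega>)"
  have MB: "{#} \<in> MB" by simp
  have fx: "cof_map W (L 0) p ?x = tensor C (L 0) (e {#}) ?\<omega>"
    using cof_map_tensor[OF ip(2) dmon_in_C[OF MB], of "i ?\<omega>"] ip(3) \<omega> by simp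
  have coord: "coord (L 0) {#} (tensor C (L 0) (e {#}) ?\<omega>) = ?\<omega>"
    by (simp only: coord_dmon[OF vspace_L MB MB] simp_thms if_True)
  have nz: "cof_map W (L 0) p ?x \<noteq> 0"
  proof
    assume "cof_map W (L 0) p ?x = 0"
    then have "tensor C (L 0) (e {#}) ?\<omega> = 0" unfolding fx .
    from coord[unfolded this linear_zeroD[OF linear_coord[OF vspace_L]]] wedge_Nil_nonzero
    show False by simp
  qed
  \<comment> \<open>An empty sum: there is no letter to remove from \<open>{#}\<close>.\<close>
  have z: "koszul_diff scale 0 (cof_map W (L 0) p ?x) = 0"
    unfolding fx using koszul_diff_dmon[OF MB \<omega>] by simp
  have x: "?x \<in> vcarrier J" using basis_in_J[OF MB] by simp
  have f: "cof_map W (L 0) p \<in> comodule_hom C J (K 0)"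
    using cof_map_hom[OF ip(2) vspace_W vspace_L] koszul_term_nat[of 0] by simp
  show ?thesis by (rule bexI[OF _ f], rule bexI[OF _ x], rule conjI[OF nz z])
qed

lemma not_contractible:
  assumes inf: "infinite B"
  shows "\<not> contractible_complex SJ HJ dK"
proof
  assume "contractible_complex SJ HJ dK"
  then have "\<exists>h. (\<forall>n. h n \<in> left_module_hom SJ (HJ n) (HJ (n - 1))) \<and>
      (\<forall>n. \<forall>x\<in>carrier (HJ n). x = dK (n - 1) (h n x) \<oplus>\<^bsub>HJ n\<^esub> h (n + 1) (dK n x))"
    unfolding contractible_complex_def .
  then obtain h where h': "(\<forall>n. h n \<in> left_module_hom SJ (HJ n) (HJ (n - 1))) \<and>
      (\<forall>n. \<forall>x\<in>carrier (HJ n). x = dK (n - 1) (h n x) \<oplus>\<^bsub>HJ n\<^esub> h (n + 1) (dK n x))"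
    by (rule exE)
  note h = conjunct1[OF h'] and hom = conjunct2[OF h']
  interpret H0: linear_comodule_Hom C J "K 0" by (rule Hom_koszul)
  interpret H1: linear_comodule_Hom C J "K 1" by (rule Hom_koszul)
  obtain f x where f: "f \<in> comodule_hom C J (K 0)" and x: "x \<in> vcarrier J"
    and fx: "f x \<noteq> 0" "koszul_diff scale 0 (f x) = 0"
    using exists_hom_nonzero[OF inf] by blast
  let ?\<phi> = "dK 0 f"
  have \<phi>: "?\<phi> \<in> comodule_hom C J (K 1)" using dK_closed[OF f] unfolding add_0_left .
  obtain \<theta> \<kappa> where \<theta>: "\<theta> \<in> comodule_hom C J (K 1)" and \<kappa>: "\<kappa> \<in> comodule_hom C (K 1) J"
    and "\<forall>x\<in>vcarrier (K 1). \<theta> (\<kappa> x) = x"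
    using koszul_term_retract[OF inf, of 1] by blast
  then have retract: "\<And>x. x \<in> vcarrier (K 1) \<Longrightarrow> \<theta> (\<kappa> x) = x" by (elim bspec)
  \<comment> \<open>The differential of \<open>f\<close> is \<open>?s\<close> acting on the
    generator \<open>\<theta>\<close>, so \<open>h 1\<close> sends it to
    \<open>h 1 \<theta> \<circ> ?s\<close>. This vanishes at \<open>x\<close> because
    \<open>?s x = \<kappa> 0 = 0\<close>, whatever \<open>h\<close> is.\<close>
  let ?s = "compose (vcarrier J) \<kappa> ?\<phi>"
  have \<phi>HJ: "?\<phi> \<in> carrier (HJ 1)" unfolding H1.H_simps(1) by (rule \<phi>)
  have s: "?s \<in> carrier SJ" by (rule H1.compose_\<kappa>_in_S) (rule \<theta>, rule \<kappa>, erule retract, rule \<phi>HJ)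
  have \<phi>s: "?s \<odot>\<^bsub>HJ 1\<^esub> \<theta> = ?\<phi>" by (rule H1.retract_generates) (rule \<theta>, rule \<kappa>, erule retract, rule \<phi>HJ)
  have "vlinear (K 1) J \<kappa>" using \<kappa> unfolding comodule_hom_def by blast
  then have "\<kappa> 0 = 0" by (rule vlinear_zero[OF _ H1.JN.vN])
  then have sx: "?s x = 0" unfolding compose_def restrict_apply if_P[OF x] fx(2) .
  have h1: "h 1 \<in> left_module_hom SJ (HJ 1) (HJ 0)"
    using spec[OF h, of 1] unfolding diff_self .
  have \<theta>HJ: "\<theta> \<in> carrier (HJ 1)" unfolding H1.H_simps(1) by (rule \<theta>)
  have "h 1 \<theta> \<in> carrier (HJ 0)" using h1 \<theta>HJ unfolding left_module_hom_def by blast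
  then have h1\<theta>: "h 1 \<theta> \<in> comodule_hom C J (K 0)" unfolding H0.H_simps(1) .
  from h1 s \<theta>HJ have "h 1 (?s \<odot>\<^bsub>HJ 1\<^esub> \<theta>) = ?s \<odot>\<^bsub>HJ 0\<^esub> h 1 \<theta>"
    unfolding left_module_hom_def by blast
  then have "h 1 ?\<phi> = ?s \<odot>\<^bsub>HJ 0\<^esub> h 1 \<theta>" unfolding \<phi>s .
  then have "h 1 ?\<phi> x = h 1 \<theta> (?s x)" by (simp only: H0.H_simps(4) compose_eq[OF x])
  also have "\<dots> = 0" unfolding sx using vlinear_zero[OF H0.JN.homD(2)[OF h1\<theta>] H0.JN.vM] .
  finally have 1: "h 1 ?\<phi> x = 0" .
  have "f \<in> carrier (HJ 0)" unfolding H0.H_simps(1) by (rule f)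
  from bspec[OF spec[OF hom, of 0] this, symmetric]
  have "dK (- 1) (h 0 f) \<oplus>\<^bsub>HJ 0\<^esub> h 1 ?\<phi> = f" unfolding diff_0 add_0_left .
  from fun_cong[OF this, of x] have "dK (- 1) (h 0 f) x + h 1 ?\<phi> x = f x"
    unfolding H0.H_simps(3) restrict_apply if_P[OF x] .
  \<comment> \<open>The complex starts in degree 0, so the homotopy identity at \<open>f\<close>
    retains only the term with \<open>h 1\<close>, and \<open>f x\<close> would have to
    vanish.\<close>
  moreover have "dK (- 1) (h 0 f) x = 0"
    using dK_neg[of "- 1" "h 0 f"] x by (simp only: restrict_apply if_True neg_less_0_iff_less zero_less_one)
  ultimately have "f x = 0" using 1 by (metis add_0_left)
  with fx(1) show False by (rule notE)
qed

lemma dK_module_hom: "dK n \<in> left_module_hom SJ (HJ n) (HJ (n + 1))"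
proof -
  interpret Hn: linear_comodule_Hom C J "K n" by (rule Hom_koszul)
  interpret Hn': linear_comodule_Hom C J "K (n + 1)" by (rule Hom_koszul)
  show ?thesis
    unfolding left_module_hom_def
  proof (intro CollectI conjI ballI funcsetI)
    fix f assume f: "f \<in> carrier (HJ n)"
    then show "dK n f \<in> carrier (HJ (n + 1))"
      unfolding Hn.H_simps Hn'.H_simps by (rule dK_closed)
    fix g assume "g \<in> carrier (HJ n)"
    show "dK n (f \<oplus>\<^bsub>HJ n\<^esub> g) = dK n f \<oplus>\<^bsub>HJ (n + 1)\<^esub> dK n g"
      by (auto simp: Hn.H_simps Hn'.H_simps compose_def fun_eq_iff linear_addD[OF linear_koszul_diff])
  next
    fix s f assume "s \<in> carrier SJ"
    then have "s x \<in> vcarrier J" if "x \<in> vcarrier J" for x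
      using that by (auto simp: Hn.S_simps comodule_hom_def dest: vlinear_closed)
    then show "dK n (s \<odot>\<^bsub>HJ n\<^esub> f) = s \<odot>\<^bsub>HJ (n + 1)\<^esub> dK n f"
      by (auto simp: Hn.H_simps Hn'.H_simps compose_def fun_eq_iff)
  qed
qed

lemma koszul_Hom_complex:
  assumes inf: "infinite B"
  shows "cochain_complex SJ HJ dK" "bounded_below_complex HJ"
    "finitely_generated_module SJ (HJ n)" "projective_module SJ (HJ n)" "acyclic_complex HJ dK"
proof -
  have carrier: "carrier (HJ n) = comodule_hom C J (K n)" and zero: "\<zero>\<^bsub>HJ n\<^esub> = (\<lambda>x\<in>vcarrier J. 0)" for n
    by (simp_all add: comodule_Hom_def)
  show "cochain_complex SJ HJ dK"
    unfolding cochain_complex_def carrier zero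
  proof (intro conjI allI ballI)
    show "left_module SJ (HJ n)" for n
      by (rule linear_comodule_Hom.left_module_H[OF Hom_koszul])
    show "dK n \<in> left_module_hom SJ (HJ n) (HJ (n + 1))" for n
      by (rule dK_module_hom)
  qed (rule dK_dK)
  show "bounded_below_complex HJ"
    unfolding bounded_below_complex_def carrier zero
    using hom_koszul_neg zero_hom_J[OF linear_comodule_koszul_term] by (intro exI[of _ 0]) blast
  show "acyclic_complex HJ dK"
    unfolding acyclic_complex_def carrier zero
  proof (intro allI subset_antisym subsetI)
    fix n f assume "f \<in> {x \<in> comodule_hom C J (K n). dK n x = (\<lambda>x\<in>vcarrier J. 0)}"
    then show "f \<in> dK (n - 1) ` comodule_hom C J (K (n - 1))" using dK_exact[OF inf] by blast
  next
    fix n f assume "f \<in> dK (n - 1) ` comodule_hom C J (K (n - 1))"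
    then obtain g where g: "g \<in> comodule_hom C J (K (n - 1))" "f = dK (n - 1) g" by blast
    then show "f \<in> {x \<in> comodule_hom C J (K n). dK n x = (\<lambda>x\<in>vcarrier J. 0)}"
      using dK_closed[OF g(1)] dK_dK[OF g(1)] by simp
  qed
  obtain \<theta> \<kappa> where \<theta>: "\<theta> \<in> comodule_hom C J (K n)" and \<kappa>: "\<kappa> \<in> comodule_hom C (K n) J"
    and "\<forall>x\<in>vcarrier (K n). \<theta> (\<kappa> x) = x"
    using koszul_term_retract[OF inf, of n] by blast
  then have retract: "\<And>x. x \<in> vcarrier (K n) \<Longrightarrow> \<theta> (\<kappa> x) = x" by (elim bspec)
  interpret linear_comodule_Hom C J "K n" by (rule Hom_koszul)
  show "finitely_generated_module SJ (HJ n)"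
    by (rule finitely_generated_retract) (rule \<theta>, rule \<kappa>, erule retract)
  show "projective_module SJ (HJ n)"
    by (rule projective_retract) (rule \<theta>, rule \<kappa>, erule retract)
qed

end

theorem corollary7p2:
  fixes scale :: "'k::field \<Rightarrow> 'w::ab_group_add \<Rightarrow> 'w"
  assumes "vector_space scale"
    and "\<nexists>B. finite_dimensional_vector_space scale B"
  shows "let C = sym_coalgebra scale;
             J = cofree_comodule C (whole_space scale);
             S = opposite_ring (comodule_End C J);
             H = (\<lambda>n. comodule_Hom C J (koszul_term scale n));
             d = (\<lambda>n f. compose (vcarrier J) (koszul_diff scale n) f)
         in cochain_complex S H d \<and>
            bounded_below_complex H \<and>
            (\<forall>n. finitely_generated_module S (H n) \<and> projective_module S (H n)) \<and>
            acyclic_complex H d \<and>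
            \<not> contractible_complex S H d"
proof -
  interpret vector_space scale by (rule assms(1))
  obtain B where B: "independent B" "UNIV \<subseteq> span B"
    using maximal_independent_subset[of UNIV] by blast
  have span_B: "span B = UNIV" using B(2) by blast
  interpret W: based_space scale B by unfold_locales (rule B(1), rule span_B)
  have "infinite B"
  proof
    assume "finite B"
    then have "finite_dimensional_vector_space scale B"
      by unfold_locales (rule \<open>finite B\<close>, rule B(1), rule span_B)
    with assms(2) show False by blast
  qed
  note complex = W.koszul_Hom_complex[OF this] W.not_contractible[OF this]
  show ?thesis
    unfolding Let_def by (intro conjI allI complex)
qed

end
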